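(* For each $N$ let $D=D_N=\mathrm{diag}(d_1,\dots,d_N)$ be a random real diagonal matrix whose entries have finite expectations, let $O$ be Haar distributed on the orthogonal group $O(N)$ and independent of $D$, and let $\mathbb{E}(D)=\mathrm{diag}(\mathbb{E}(d_1),\dots,\mathbb{E}(d_N))$. Assume: (1) there are numbers $M_N=o(\sqrt N)$ with $\lim_{N\to\infty}\mathbb{P}(\max_{1\le i\le N}|d_i|>M_N)=0$; (2) for every $c>0$, $\displaystyle\lim_{N\to\infty}\mathbb{P}\Big(W_2\big(\mu_N(D),\mu_N(\mathbb{E}(D))\big)>\tfrac{c}{\sqrt N}\Big)=0.$ Then, for every $\beta\ge0$, $$\big|\Phi_N(\beta,O,D)-\Gamma_N(\beta,\mathbb{E}(D))\big|\longrightarrow0\qquad\text{in probability as }N\to\infty .$$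
   Context: For a diagonal matrix $\Lambda=\mathrm{diag}(\lambda_1,\dots,\lambda_N)$, $\mu_N(\Lambda)=\frac1N\sum_{i=1}^N\delta_{\lambda_i}$. $W_2$ is the 2-Wasserstein distance between probability measures on $\mathbb{R}$. $S_N=\{-1,+1\}^N$. For $\beta\ge0$, $O\in O(N)$ and a diagonal matrix $D$, $$Z_N(\beta,O,D)=\frac1{2^N}\sum_{\sigma\in S_N}\exp\big(\beta\,\sigma^TODO^T\sigma\big),\qquad \Phi_N(\beta,O,D)=\frac1N\log Z_N(\beta,O,D).$$ For a deterministic diagonal matrix $\Lambda$, $\Gamma_N(\beta,\Lambda)=\frac1N\mathbb{E}_0\big(\log Z_N(\beta,O,\Lambda)\big)$, where $\mathbb{E}_0$ denotes expectation over $O$ with respect to Haar probability measure on $O(N)$. *)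

theory Defs
  imports
    "HOL-Probability.Probability"
    "HOL-Library.Landau_Symbols"
    "Jordan_Normal_Form.Matrix"
begin

text \<open>
  Since the dimension \<open>N\<close> tends to infinity, matrices and vectors are those of
  \<open>Jordan_Normal_Form\<close>, whose dimensions are natural numbers; indices run over \<open>{0..<N}\<close>.
\<close>

unbundle no vec_syntax and no inner_syntax

subsection \<open>The orthogonal group and its Haar measure\<close>

definition orthogonal_group :: "nat \<Rightarrow> real mat set" where
  "orthogonal_group N = {A \<in> carrier_mat N N. transpose_mat A * A = 1\<^sub>m N \<and> A * transpose_mat A = 1\<^sub>m N}"

text \<open>
  The Borel \<open>\<sigma>\<close>-algebra on real \<open>N \<times> N\<close> matrices, obtained by identifying a matrix with the
  family of its \<open>N\<^sup>2\<close> entries, and its trace on \<open>O(N)\<close>. Only the \<open>\<sigma>\<close>-algebras of these two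
  measures are meaningful.
\<close>

definition mat_borel :: "nat \<Rightarrow> real mat measure" where
  "mat_borel N = vimage_algebra (carrier_mat N N)
     (\<lambda>A. \<lambda>p\<in>{..<N} \<times> {..<N}. A $$ p) (\<Pi>\<^sub>M p\<in>{..<N} \<times> {..<N}. borel)"

definition orth_borel :: "nat \<Rightarrow> real mat measure" where
  "orth_borel N = restrict_space (mat_borel N) (orthogonal_group N)"

definition is_haar_prob :: "nat \<Rightarrow> real mat measure \<Rightarrow> bool" where
  "is_haar_prob N \<mu> \<longleftrightarrow>
     prob_space \<mu> \<and> sets \<mu> = sets (orth_borel N) \<and>
     (\<forall>A\<in>orthogonal_group N. distr \<mu> (orth_borel N) (\<lambda>X. A * X) = \<mu>)"

text \<open>The description is unique by lemma \<open>is_haar_prob_unique\<close> below.\<close>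

definition haar_prob :: "nat \<Rightarrow> real mat measure" where
  "haar_prob N = (THE \<mu>. is_haar_prob N \<mu>)"

lemma space_mat_borel [simp]: "space (mat_borel N) = carrier_mat N N"
  by (simp add: mat_borel_def)

lemma orthogonal_group_carrier: "A \<in> orthogonal_group N \<Longrightarrow> A \<in> carrier_mat N N"
  by (simp add: orthogonal_group_def)

lemma space_orth_borel [simp]: "space (orth_borel N) = orthogonal_group N"
  by (auto simp: orth_borel_def space_restrict_space orthogonal_group_def)

lemma measurable_mat_borelI:
  assumes "\<And>x. x \<in> space M \<Longrightarrow> f x \<in> carrier_mat N N"
    and "\<And>i j. i < N \<Longrightarrow> j < N \<Longrightarrow> (\<lambda>x. f x $$ (i, j)) \<in> borel_measurable M"
  shows "f \<in> M \<rightarrow>\<^sub>M mat_borel N"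
  unfolding mat_borel_def
proof (rule measurable_vimage_algebra2)
  show "f \<in> space M \<rightarrow> carrier_mat N N"
    using assms(1) by auto
  show "(\<lambda>x. \<lambda>p\<in>{..<N} \<times> {..<N}. f x $$ p) \<in> M \<rightarrow>\<^sub>M (\<Pi>\<^sub>M p\<in>{..<N} \<times> {..<N}. borel)"
    using assms(2) by (intro measurable_restrict) auto
qed

lemma measurable_mat_borel_entry:
  assumes "i < N" "j < N"
  shows "(\<lambda>A. A $$ (i, j)) \<in> borel_measurable (mat_borel N)"
proof -
  have "(\<lambda>A. \<lambda>p\<in>{..<N} \<times> {..<N}. A $$ p) \<in> mat_borel N \<rightarrow>\<^sub>M (\<Pi>\<^sub>M p\<in>{..<N} \<times> {..<N}. (borel :: real measure))"
    unfolding mat_borel_def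
    by (rule measurable_vimage_algebra1) (auto simp: space_PiM)
  from measurable_compose[OF this measurable_component_singleton[of "(i, j)"]]
  show ?thesis using assms by simp
qed

lemma measurable_orth_borelI:
  assumes "\<And>x. x \<in> space M \<Longrightarrow> f x \<in> orthogonal_group N"
    and "\<And>i j. i < N \<Longrightarrow> j < N \<Longrightarrow> (\<lambda>x. f x $$ (i, j)) \<in> borel_measurable M"
  shows "f \<in> M \<rightarrow>\<^sub>M orth_borel N"
  unfolding orth_borel_def
  using assms
  by (intro measurable_restrict_space2 measurable_mat_borelI) (auto simp: orthogonal_group_carrier)

lemma measurable_orth_borel_entry:
  "i < N \<Longrightarrow> j < N \<Longrightarrow> (\<lambda>A. A $$ (i, j)) \<in> borel_measurable (orth_borel N)"
  unfolding orth_borel_def by (intro measurable_restrict_space1 measurable_mat_borel_entry)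

lemma orthogonal_group_transpose:
  "A \<in> orthogonal_group N \<Longrightarrow> transpose_mat A \<in> orthogonal_group N"
  by (auto simp: orthogonal_group_def)

lemma orthogonal_group_mult:
  assumes "A \<in> orthogonal_group N" "B \<in> orthogonal_group N"
  shows "A * B \<in> orthogonal_group N"
proof -
  have A: "A \<in> carrier_mat N N" "transpose_mat A * A = 1\<^sub>m N" "A * transpose_mat A = 1\<^sub>m N"
    and B: "B \<in> carrier_mat N N" "transpose_mat B * B = 1\<^sub>m N" "B * transpose_mat B = 1\<^sub>m N"
    using assms by (auto simp: orthogonal_group_def)
  have T: "transpose_mat A \<in> carrier_mat N N" "transpose_mat B \<in> carrier_mat N N"
    using A B by auto
  have "transpose_mat B * transpose_mat A * (A * B) = transpose_mat B * (transpose_mat A * A * B)"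
    using A(1) B(1) T by (simp add: assoc_mult_mat[of _ N N _ N _ N])
  moreover have "A * B * (transpose_mat B * transpose_mat A) = A * (B * transpose_mat B * transpose_mat A)"
    using A(1) B(1) T by (simp add: assoc_mult_mat[of _ N N _ N _ N])
  ultimately show ?thesis
    using A B T by (auto simp: orthogonal_group_def transpose_mult[of A N N B N])
qed

lemma measurable_orth_transpose: "transpose_mat \<in> orth_borel N \<rightarrow>\<^sub>M orth_borel N"
proof (rule measurable_orth_borelI)
  fix i j assume ij: "i < N" "j < N"
  have "(\<lambda>A. A $$ (j, i)) \<in> borel_measurable (orth_borel N)"
    using ij by (intro measurable_orth_borel_entry)
  then show "(\<lambda>A. transpose_mat A $$ (i, j)) \<in> borel_measurable (orth_borel N)"
    by (rule measurable_cong[THEN iffD1, rotated])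
      (use ij in \<open>auto dest!: orthogonal_group_carrier\<close>)
qed (simp add: orthogonal_group_transpose)

lemma measurable_orth_mult:
  assumes f: "f \<in> M \<rightarrow>\<^sub>M orth_borel N" and g: "g \<in> M \<rightarrow>\<^sub>M orth_borel N"
  shows "(\<lambda>x. f x * g x) \<in> M \<rightarrow>\<^sub>M orth_borel N"
proof (rule measurable_orth_borelI)
  fix x assume "x \<in> space M"
  then show "f x * g x \<in> orthogonal_group N"
    using measurable_space[OF f] measurable_space[OF g] by (auto intro: orthogonal_group_mult)
next
  fix i j assume ij: "i < N" "j < N"
  have "(\<lambda>x. \<Sum>k\<in>{0..<N}. f x $$ (i, k) * g x $$ (k, j)) \<in> borel_measurable M"
    using ij
    by (intro borel_measurable_sum borel_measurable_times
        measurable_compose[OF f measurable_orth_borel_entry]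
        measurable_compose[OF g measurable_orth_borel_entry]) auto
  then show "(\<lambda>x. (f x * g x) $$ (i, j)) \<in> borel_measurable M"
  proof (rule measurable_cong[THEN iffD1, rotated])
    fix x assume "x \<in> space M"
    then have "f x \<in> carrier_mat N N" "g x \<in> carrier_mat N N"
      using measurable_space[OF f] measurable_space[OF g] by (auto intro: orthogonal_group_carrier)
    then show "(\<Sum>k\<in>{0..<N}. f x $$ (i, k) * g x $$ (k, j)) = (f x * g x) $$ (i, j)"
      using ij by (auto simp: scalar_prod_def)
  qed
qed

lemma is_haar_prob_eq_transpose:
  assumes \<mu>: "is_haar_prob N \<mu>" and \<nu>: "is_haar_prob N \<nu>"
  shows "\<mu> = distr \<nu> (orth_borel N) transpose_mat"
proof (rule measure_eqI)
  interpret \<mu>: prob_space \<mu> using \<mu> by (simp add: is_haar_prob_def)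
  interpret \<nu>: prob_space \<nu> using \<nu> by (simp add: is_haar_prob_def)
  interpret pair_sigma_finite \<nu> \<mu> ..
  have s\<mu> [measurable_cong]: "sets \<mu> = sets (orth_borel N)"
    and s\<nu> [measurable_cong]: "sets \<nu> = sets (orth_borel N)"
    using \<mu> \<nu> by (auto simp: is_haar_prob_def)
  have sp: "space \<mu> = orthogonal_group N" "space \<nu> = orthogonal_group N"
    using sets_eq_imp_space_eq[OF s\<mu>] sets_eq_imp_space_eq[OF s\<nu>] by auto
  note [measurable] = measurable_orth_transpose measurable_orth_mult
  show "sets \<mu> = sets (distr \<nu> (orth_borel N) transpose_mat)"
    using s\<mu> by simp
  fix S assume "S \<in> sets \<mu>"
  then have S [measurable]: "S \<in> sets (orth_borel N)" using s\<mu> by simp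
  have 1: "(\<integral>\<^sup>+x. indicator S (A * x) \<partial>\<rho>) = emeasure \<rho> S"
    if \<rho>: "is_haar_prob N \<rho>" and A: "A \<in> orthogonal_group N" and S: "S \<in> sets (orth_borel N)" for \<rho> A S
  proof -
    have s\<rho>: "sets \<rho> = sets (orth_borel N)"
      using \<rho> by (simp add: is_haar_prob_def)
    have "(\<lambda>x. A * x) \<in> orth_borel N \<rightarrow>\<^sub>M orth_borel N"
      using A by (intro measurable_orth_mult measurable_const measurable_ident_sets[OF refl]) simp
    then have m: "(\<lambda>x. A * x) \<in> \<rho> \<rightarrow>\<^sub>M orth_borel N"
      unfolding measurable_cong_sets[OF s\<rho> refl] .
    have "emeasure \<rho> S = (\<integral>\<^sup>+x. indicator S x \<partial>distr \<rho> (orth_borel N) (\<lambda>X. A * X))"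
      using \<rho> A S s\<rho> unfolding is_haar_prob_def by (subst nn_integral_indicator) simp_all
    also have "\<dots> = (\<integral>\<^sup>+x. indicator S (A * x) \<partial>\<rho>)"
      using m S by (intro nn_integral_distr) auto
    finally show ?thesis ..
  qed
  have "emeasure \<mu> S = (\<integral>\<^sup>+y. \<integral>\<^sup>+x. indicator S (transpose_mat y * x) \<partial>\<mu> \<partial>\<nu>)"
    by (subst nn_integral_cong[where v = "\<lambda>_. emeasure \<mu> S"])
      (use 1[OF \<mu> _ S] in \<open>auto simp: sp orthogonal_group_transpose \<nu>.emeasure_space_1[unfolded sp]\<close>)
  also have "\<dots> = (\<integral>\<^sup>+x. \<integral>\<^sup>+y. indicator S (transpose_mat y * x) \<partial>\<nu> \<partial>\<mu>)"
    by (rule Fubini'[symmetric]) measurable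
  also have "\<dots> = (\<integral>\<^sup>+x. emeasure (distr \<nu> (orth_borel N) transpose_mat) S \<partial>\<mu>)"
  proof (rule nn_integral_cong)
    fix x assume "x \<in> space \<mu>"
    then have x: "x \<in> orthogonal_group N" by (simp add: sp)
    let ?S = "transpose_mat -` S \<inter> space (orth_borel N)"
    have S': "?S \<in> sets (orth_borel N)" by (rule measurable_sets[OF measurable_orth_transpose S])
    have "(\<integral>\<^sup>+y. indicator S (transpose_mat y * x) \<partial>\<nu>)
        = (\<integral>\<^sup>+y. indicator ?S (transpose_mat x * y) \<partial>\<nu>)"
    proof (rule nn_integral_cong)
      fix y assume "y \<in> space \<nu>"
      then have y: "y \<in> orthogonal_group N" by (simp add: sp)
      have "transpose_mat (transpose_mat x * y) = transpose_mat y * x"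
        using x y by (subst transpose_mult[of _ N N _ N]) (auto dest: orthogonal_group_carrier)
      moreover have "transpose_mat x * y \<in> orthogonal_group N"
        using x y by (intro orthogonal_group_mult orthogonal_group_transpose)
      ultimately show "indicator S (transpose_mat y * x) = (indicator ?S (transpose_mat x * y) :: ennreal)"
        by (auto simp: indicator_def)
    qed
    also have "\<dots> = emeasure \<nu> ?S"
      using x by (intro 1 \<nu> S' orthogonal_group_transpose)
    also have "\<dots> = emeasure (distr \<nu> (orth_borel N) transpose_mat) S"
      by (subst emeasure_distr) (auto simp: sp)
    finally show "(\<integral>\<^sup>+y. indicator S (transpose_mat y * x) \<partial>\<nu>)
        = emeasure (distr \<nu> (orth_borel N) transpose_mat) S" .
  qed
  also have "\<dots> = emeasure (distr \<nu> (orth_borel N) transpose_mat) S"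
    by (simp add: \<mu>.emeasure_space_1[unfolded sp] sp)
  finally show "emeasure \<mu> S = emeasure (distr \<nu> (orth_borel N) transpose_mat) S" .
qed

lemma is_haar_prob_unique:
  assumes "is_haar_prob N \<mu>" "is_haar_prob N \<nu>"
  shows "\<mu> = \<nu>"
  using is_haar_prob_eq_transpose[OF assms] is_haar_prob_eq_transpose[OF assms(2) assms(2)] by simp

lemma haar_prob_eqI: "is_haar_prob N \<mu> \<Longrightarrow> haar_prob N = \<mu>"
  unfolding haar_prob_def by (rule the_equality) (auto intro: is_haar_prob_unique)

subsection \<open>Empirical spectral measure and Wasserstein distance\<close>

definition empirical_measure :: "nat \<Rightarrow> real mat \<Rightarrow> real measure" where
  "empirical_measure N D = measure_of UNIV (sets borel)
     (\<lambda>B. ennreal (1 / real N) * (\<Sum>i<N. emeasure (return borel (D $$ (i, i))) B))"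

lemma sets_empirical_measure [simp, measurable_cong]:
  "sets (empirical_measure N D) = sets borel"
  using sets.sigma_sets_eq[of "borel :: real measure"] by (simp add: empirical_measure_def)

lemma emeasure_empirical_measure:
  assumes "B \<in> sets borel"
  shows "emeasure (empirical_measure N D) B
    = ennreal (1 / real N) * (\<Sum>i<N. emeasure (return borel (D $$ (i, i))) B)"
proof (rule emeasure_measure_of[OF empirical_measure_def])
  let ?f = "\<lambda>B. ennreal (1 / real N) * (\<Sum>i<N. emeasure (return borel (D $$ (i, i))) B)"
  show "positive (sets (empirical_measure N D)) ?f"
    by (simp add: positive_def)
  show "countably_additive (sets (empirical_measure N D)) ?f"
  proof (rule countably_additiveI)
    fix A :: "nat \<Rightarrow> real set"
    assume A: "range A \<subseteq> sets (empirical_measure N D)" "disjoint_family A"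
    then have A': "range A \<subseteq> sets (return borel x)" for x by simp
    have "(\<Sum>n. ?f (A n)) = ennreal (1 / real N) * (\<Sum>n. \<Sum>i<N. emeasure (return borel (D $$ (i, i))) (A n))"
      by (rule ennreal_suminf_cmult)
    also have "(\<Sum>n. \<Sum>i<N. emeasure (return borel (D $$ (i, i))) (A n))
      = (\<Sum>i<N. \<Sum>n. emeasure (return borel (D $$ (i, i))) (A n))"
      by (rule suminf_sum) auto
    also have "\<dots> = (\<Sum>i<N. emeasure (return borel (D $$ (i, i))) (\<Union>n. A n))"
      by (intro sum.cong refl suminf_emeasure A' A(2))
    finally show "(\<Sum>n. ?f (A n)) = ?f (\<Union>n. A n)" .
  qed
qed (use assms in auto)

definition couplings :: "real measure \<Rightarrow> real measure \<Rightarrow> (real \<times> real) measure set" where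
  "couplings \<mu> \<nu> = {\<pi>. prob_space \<pi> \<and> sets \<pi> = sets (borel \<Otimes>\<^sub>M borel) \<and>
     distr \<pi> borel fst = \<mu> \<and> distr \<pi> borel snd = \<nu>}"

text \<open>
  For probability measures with finite second moment the infimum is finite. (An infinite
  transport cost would be sent to \<open>0\<close> by \<open>enn2real\<close>; it cannot occur for finitely supported
  measures such as the empirical ones.)
\<close>

definition W2 :: "real measure \<Rightarrow> real measure \<Rightarrow> real" where
  "W2 \<mu> \<nu> = sqrt (enn2real (INF \<pi>\<in>couplings \<mu> \<nu>. \<integral>\<^sup>+(x, y). ennreal ((x - y)\<^sup>2) \<partial>\<pi>))"

subsection \<open>Partition function and free energies\<close>

definition spins :: "nat \<Rightarrow> real vec set" where
  "spins N = {\<sigma> \<in> carrier_vec N. \<forall>i<N. vec_index \<sigma> i \<in> {-1, 1}}"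

definition Z_N :: "nat \<Rightarrow> real \<Rightarrow> real mat \<Rightarrow> real mat \<Rightarrow> real" where
  "Z_N N \<beta> Q D = 1 / 2 ^ N *
     (\<Sum>\<sigma>\<in>spins N. exp (\<beta> * scalar_prod \<sigma> ((Q * D * transpose_mat Q) *\<^sub>v \<sigma>)))"

definition Phi_N :: "nat \<Rightarrow> real \<Rightarrow> real mat \<Rightarrow> real mat \<Rightarrow> real" where
  "Phi_N N \<beta> Q D = 1 / real N * ln (Z_N N \<beta> Q D)"

definition Gamma_N :: "nat \<Rightarrow> real \<Rightarrow> real mat \<Rightarrow> real" where
  "Gamma_N N \<beta> \<Lambda> = 1 / real N * (\<integral>Q. ln (Z_N N \<beta> Q \<Lambda>) \<partial>haar_prob N)"

end

theory Submission
  imports Defs "Jordan_Normal_Form.Determinant"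
begin

text \<open>
  The free energy \<open>\<Phi>\<close> concentrates around its Haar mean by a Poincare inequality on \<open>O(N)\<close> whose
  constant is of order \<open>1/N\<close>. Let \<open>D\<^sub>i\<^sub>j\<close> be the derivatives along plane rotations and
  \<open>L = - \<Sum> D\<^sub>i\<^sub>j\<^sup>2\<close>. Since \<open>L\<close> commutes with every \<open>D\<^sub>i\<^sub>j\<close>, integration by parts gives
  \<open>E (L f)\<^sup>2 = \<Sum> E (D\<^sub>k\<^sub>l D\<^sub>i\<^sub>j f)\<^sup>2\<close>, and the antisymmetric part of the Hessian consists of the
  commutators \<open>[D\<^sub>i\<^sub>j, D\<^sub>j\<^sub>l] = D\<^sub>l\<^sub>i\<close>; hence \<open>4 E (L f)\<^sup>2 \<ge> (N - 2) \<Sum> E (D\<^sub>i\<^sub>j f)\<^sup>2\<close>. For polynomials of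
  bounded degree \<open>L\<close> is bounded, so the iteration \<open>f \<mapsto> f - \<epsilon> L f\<close> upgrades a Poincare inequality
  with any constant, obtained from Givens rotations, to one with constant \<open>8/(N - 2)\<close>. It passes to
  \<open>\<Phi>\<close> by polynomial approximation together with the gradients. The squared gradient of \<open>\<Phi>\<close> is at
  most \<open>16 \<beta>\<^sup>2 max |d\<^sub>i|\<^sup>2\<close>, whence the variance is \<open>O(M\<^sub>N\<^sup>2/N) = o(1)\<close>.

  To replace \<open>D\<close> by \<open>E(D)\<close> in \<open>\<Gamma>\<close>, note that \<open>\<Gamma>\<close> is invariant under permutations of the
  eigenvalues and Lipschitz in the maximum norm, while \<open>W\<^sub>2 \<le> c / \<surd>N\<close> yields a matching of the
  eigenvalues whose squared differences sum up to at most \<open>c\<^sup>2\<close>.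
\<close>

subsection \<open>Polynomials in the matrix entries and rotational derivatives\<close>

text \<open>The inequality cannot hold for all polynomials: \<open>O(N)\<close> has two components,
  and the determinant is a nonconstant function whose rotational derivatives all vanish. Hence the
  invariance under a sign change of the last column (\<open>colflip\<close>), which exchanges the
  components. The quadratic form depends on each column only through a square, so the free energy is
  invariant.

  The gap would usually be read off from the Bochner bound by an eigenfunction expansion or the heat
  semigroup. Here explicit Euler steps of the heat flow take their place, and these are stable only
  for a bounded operator. This is why the sum of the coefficients is tracked along with the degree:
  a derivative keeps the degree and multiplies that sum by a factor depending on the degree alone.
  The final constant depends neither on the degree nor on the step size, so nothing is lost when the
  degree of the approximants is unbounded.

  Sums over planes run over ordered pairs, so \<open>L\<close> and the Dirichlet form count every
  plane twice. Constant factors are given away freely; only the order \<open>1/N\<close> matters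
  against \<open>M\<^sub>N\<^sup>2 = o(N)\<close>.\<close>

definition rot :: "nat \<Rightarrow> nat \<Rightarrow> real \<Rightarrow> (nat \<Rightarrow> nat \<Rightarrow> real) \<Rightarrow> nat \<Rightarrow> nat \<Rightarrow> real" where
  "rot i j t X = (\<lambda>k l. if i = j then X k l
     else if k = i then cos t * X i l + sin t * X j l
     else if k = j then cos t * X j l - sin t * X i l
     else X k l)"

lemma rot_0 [simp]: "rot i j 0 X = X"
  by (auto simp: rot_def fun_eq_iff)

text \<open>The convention for \<open>i = j\<close> lets every sum over planes run over the full
  square of indices without a side condition.\<close>

lemma rot_same [simp]: "rot i i t X = X"
  by (auto simp: rot_def fun_eq_iff)

lemma rot_add: "rot i j s (rot i j t X) = rot i j (s + t) X"
  by (auto simp: rot_def fun_eq_iff cos_add sin_add algebra_simps)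

text \<open>\<open>pol m C f\<close>: the function \<open>f\<close> is a polynomial of degree at most \<open>m\<close> whose coefficients
  have absolute values summing up to at most \<open>C\<close>.\<close>

inductive pol :: "nat \<Rightarrow> real \<Rightarrow> ((nat \<Rightarrow> nat \<Rightarrow> real) \<Rightarrow> real) \<Rightarrow> bool" where
  pol_const: "pol m \<bar>c\<bar> (\<lambda>X. c)"
| pol_entry: "pol 1 1 (\<lambda>X. X k l)"
| pol_add: "pol m B f \<Longrightarrow> pol m C g \<Longrightarrow> pol m (B + C) (\<lambda>X. f X + g X)"
| pol_mult: "pol m B f \<Longrightarrow> pol n C g \<Longrightarrow> pol (m + n) (B * C) (\<lambda>X. f X * g X)"
| pol_mono: "pol m B f \<Longrightarrow> m \<le> n \<Longrightarrow> B \<le> C \<Longrightarrow> pol n C f"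

lemma pol_nonneg: "pol m C f \<Longrightarrow> 0 \<le> C"
  by (induction rule: pol.induct) auto

lemma pol_bound:
  assumes "pol m C f" "\<And>k l. \<bar>X k l\<bar> \<le> 1"
  shows "\<bar>f X\<bar> \<le> C"
  using assms
proof (induction rule: pol.induct)
  case (pol_add m B f C g)
  then show ?case by (metis abs_triangle_ineq add_mono order_trans)
next
  case (pol_mult m B f n C g)
  then show ?case by (metis abs_ge_zero abs_mult mult_mono' )
qed force+

lemma pol_cmult: "pol m C f \<Longrightarrow> pol m (\<bar>c\<bar> * C) (\<lambda>X. c * f X)"
  using pol_mult[OF pol_const[of 0 c], of m C f] by simp

text \<open>An infinitesimal rotation replaces an entry by plus or minus another entry or by 0, so
  the Leibniz rule keeps the degree and costs a factor proportional to it. What matters is that the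
  factor depends on \<open>m\<close> alone: iterated derivatives then grow only geometrically. The 2
  is slack.\<close>

lemma pol_deriv:
  assumes "pol m C f"
  shows "\<exists>g. pol m (2 * real m * C) g \<and>
    (\<forall>X t. ((\<lambda>t. f (rot i j t X)) has_real_derivative g (rot i j t X)) (at t))"
  using assms
proof (induction rule: pol.induct)
  case (pol_const m c)
  have "pol m (2 * real m * \<bar>c\<bar>) (\<lambda>X. 0)"
    using pol_mono[OF pol.pol_const[of m 0]] by simp
  then show ?case by (intro exI[of _ "\<lambda>X. 0"]) auto
next
  case (pol_entry k l)
  let ?g = "\<lambda>X :: nat \<Rightarrow> nat \<Rightarrow> real.
    if i = j then 0 else if k = i then X j l else if k = j then - 1 * X i l else 0"
  have 0: "pol 1 2 (\<lambda>X. 0)"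
    using pol_mono[OF pol.pol_const[of 1 0]] by simp
  have 1: "pol 1 2 (\<lambda>X. X j l)"
    by (rule pol.pol_mono[OF pol.pol_entry]) simp_all
  have 2: "pol 1 2 (\<lambda>X. - 1 * X i l)"
    by (rule pol.pol_mono[OF pol_cmult[OF pol.pol_entry]]) simp_all
  have "pol 1 2 ?g"
    using 0 1 2 by (cases "i = j"; cases "k = i"; cases "k = j") simp_all
  moreover have "((\<lambda>t. rot i j t X k l) has_real_derivative ?g (rot i j t X)) (at t)" for X t
    by (auto simp: rot_def intro!: derivative_eq_intros)
  ultimately show ?case by (intro exI[of _ ?g]) auto
next
  case (pol_add m B f C g)
  then obtain f' g' where
    "pol m (2 * real m * B) f'" "\<And>X t. ((\<lambda>t. f (rot i j t X)) has_real_derivative f' (rot i j t X)) (at t)"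
    "pol m (2 * real m * C) g'" "\<And>X t. ((\<lambda>t. g (rot i j t X)) has_real_derivative g' (rot i j t X)) (at t)"
    by metis
  then show ?case
    by (intro exI[of _ "\<lambda>X. f' X + g' X"])
      (auto intro!: derivative_intros pol.pol_add simp: algebra_simps)
next
  case (pol_mult m B f n C g)
  then obtain f' g' where fg:
    "pol m (2 * real m * B) f'" "\<And>X t. ((\<lambda>t. f (rot i j t X)) has_real_derivative f' (rot i j t X)) (at t)"
    "pol n (2 * real n * C) g'" "\<And>X t. ((\<lambda>t. g (rot i j t X)) has_real_derivative g' (rot i j t X)) (at t)"
    by metis
  have "pol (m + n) (2 * real m * B * C + B * (2 * real n * C)) (\<lambda>X. f' X * g X + f X * g' X)"
    using pol_mult fg by (intro pol.pol_add pol.pol_mult) auto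
  then show ?case
    using fg by (intro exI[of _ "\<lambda>X. f' X * g X + f X * g' X"])
      (auto intro!: derivative_eq_intros simp: algebra_simps)
next
  case (pol_mono m B f n C)
  then obtain f' where f': "pol m (2 * real m * B) f'"
    "\<And>X t. ((\<lambda>t. f (rot i j t X)) has_real_derivative f' (rot i j t X)) (at t)"
    by metis
  have "2 * real m * B \<le> 2 * real n * C"
    using pol_mono pol_nonneg[OF pol_mono(1)] by (intro mult_mono) auto
  with f' show ?case
    by (intro exI[of _ f'] conjI pol.pol_mono[OF f'(1)]) (use pol_mono in auto)
qed

section \<open>The derivations along plane rotations and their commutators\<close>

definition polf :: "((nat \<Rightarrow> nat \<Rightarrow> real) \<Rightarrow> real) \<Rightarrow> bool" where
  "polf f \<longleftrightarrow> (\<exists>m C. pol m C f)"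

text \<open>On \<open>O(N)\<close> these are the right-invariant vector fields that come from left
  multiplication by plane rotations. They span the tangent space, each plane occurring with both
  orientations (\<open>D_antisym\<close>).\<close>

definition D :: "nat \<Rightarrow> nat \<Rightarrow> ((nat \<Rightarrow> nat \<Rightarrow> real) \<Rightarrow> real) \<Rightarrow> (nat \<Rightarrow> nat \<Rightarrow> real) \<Rightarrow> real" where
  "D i j f X = deriv (\<lambda>t. f (rot i j t X)) 0"

lemma D_eqI:
  assumes "\<And>X. ((\<lambda>t. f (rot i j t X)) has_real_derivative g X) (at 0)"
  shows "D i j f = g"
  using assms by (auto simp: D_def fun_eq_iff intro!: DERIV_imp_deriv)

lemma pol_D: "pol m C f \<Longrightarrow> pol m (2 * real m * C) (D i j f)"
  using pol_deriv[of m C f i j] D_eqI[of f i j] by (metis rot_0)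

lemma polf_has_derivative:
  assumes "polf f"
  shows "((\<lambda>t. f (rot i j t X)) has_real_derivative D i j f (rot i j t X)) (at t)"
  using assms pol_deriv[of _ _ f i j] D_eqI[of f i j] unfolding polf_def by (metis rot_0)

lemma polf_has_derivative0:
  "polf f \<Longrightarrow> ((\<lambda>t. f (rot i j t X)) has_real_derivative D i j f X) (at 0)"
  using polf_has_derivative[of f i j X 0] by simp

lemma polf_D [simp, intro]: "polf f \<Longrightarrow> polf (D i j f)"
  by (meson pol_D polf_def)

lemma polf_const [simp, intro]: "polf (\<lambda>X. c)"
  unfolding polf_def by (rule exI, rule exI, rule pol_const)

lemma polf_entry [simp, intro]: "polf (\<lambda>X. X k l)"
  unfolding polf_def by (rule exI, rule exI, rule pol_entry)

lemma polf_add [simp, intro]: "polf f \<Longrightarrow> polf g \<Longrightarrow> polf (\<lambda>X. f X + g X)"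
proof -
  assume "polf f" "polf g"
  then obtain m B n C where "pol m B f" "pol n C g" by (auto simp: polf_def)
  then have "pol (max m n) (B + C) (\<lambda>X. f X + g X)"
    by (intro pol_add pol_mono[where m = m and n = "max m n"] pol_mono[where m = n and n = "max m n"]) auto
  then show ?thesis unfolding polf_def by blast
qed

lemma polf_mult [simp, intro]: "polf f \<Longrightarrow> polf g \<Longrightarrow> polf (\<lambda>X. f X * g X)"
proof -
  assume "polf f" "polf g"
  then obtain m B n C where "pol m B f" "pol n C g" by (auto simp: polf_def)
  then have "pol (m + n) (B * C) (\<lambda>X. f X * g X)"
    by (rule pol_mult)
  then show ?thesis unfolding polf_def by blast
qed

lemma polf_minus [simp, intro]: "polf f \<Longrightarrow> polf (\<lambda>X. - f X)"
  using polf_mult[of "\<lambda>X. - 1" f] by simp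

lemma polf_diff [simp, intro]: "polf f \<Longrightarrow> polf g \<Longrightarrow> polf (\<lambda>X. f X - g X)"
  using polf_add[of f "\<lambda>X. - g X"] by simp

lemma polf_power [simp, intro]: "polf f \<Longrightarrow> polf (\<lambda>X. f X ^ n)"
  by (induction n) auto

lemma polf_sum [simp, intro]: "(\<And>i. i \<in> I \<Longrightarrow> polf (f i)) \<Longrightarrow> polf (\<lambda>X. \<Sum>i\<in>I. f i X)"
  by (induction I rule: infinite_finite_induct) auto

lemma D_const [simp]: "D i j (\<lambda>X. c) = (\<lambda>X. 0)"
  by (rule D_eqI) auto

lemma D_add [simp]: "polf f \<Longrightarrow> polf g \<Longrightarrow> D i j (\<lambda>X. f X + g X) = (\<lambda>X. D i j f X + D i j g X)"
  by (rule D_eqI) (auto intro!: derivative_intros polf_has_derivative0)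

lemma D_mult [simp]:
  "polf f \<Longrightarrow> polf g \<Longrightarrow> D i j (\<lambda>X. f X * g X) = (\<lambda>X. D i j f X * g X + f X * D i j g X)"
  by (rule D_eqI) (auto intro!: derivative_eq_intros polf_has_derivative0)

lemma D_minus [simp]: "polf f \<Longrightarrow> D i j (\<lambda>X. - f X) = (\<lambda>X. - D i j f X)"
  by (rule D_eqI) (auto intro!: derivative_eq_intros polf_has_derivative0)

lemma D_diff [simp]: "polf f \<Longrightarrow> polf g \<Longrightarrow> D i j (\<lambda>X. f X - g X) = (\<lambda>X. D i j f X - D i j g X)"
  by (rule D_eqI) (auto intro!: derivative_eq_intros polf_has_derivative0)

lemma D_sum [simp]:
  "(\<And>i. i \<in> I \<Longrightarrow> polf (f i)) \<Longrightarrow> D a b (\<lambda>X. \<Sum>i\<in>I. f i X) = (\<lambda>X. \<Sum>i\<in>I. D a b (f i) X)"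
  by (induction I rule: infinite_finite_induct) auto

lemma D_entry:
  "D i j (\<lambda>X. X k l) = (\<lambda>X. (if k = i then X j l else 0) - (if k = j then X i l else 0))"
proof (rule D_eqI)
  fix X :: "nat \<Rightarrow> nat \<Rightarrow> real"
  show "((\<lambda>t. rot i j t X k l) has_real_derivative
    (if k = i then X j l else 0) - (if k = j then X i l else 0)) (at 0)"
    by (cases "k = i"; cases "k = j"; cases "i = j")
      (auto simp: rot_def intro!: derivative_eq_intros)
qed

lemma polf_if [simp, intro]: "polf f \<Longrightarrow> polf (\<lambda>X. if b then f X else 0)"
  by (cases b) auto

lemma D_if: "D i j (\<lambda>X. if b then f X else 0) = (\<lambda>X. if b then D i j f X else 0)"
  by (cases b) auto

lemma polf_induct [consumes 1, case_names const entry add mult]: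
  assumes "polf f" "\<And>c. P (\<lambda>X. c)" "\<And>k l. P (\<lambda>X. X k l)"
    "\<And>f g. polf f \<Longrightarrow> polf g \<Longrightarrow> P f \<Longrightarrow> P g \<Longrightarrow> P (\<lambda>X. f X + g X)"
    "\<And>f g. polf f \<Longrightarrow> polf g \<Longrightarrow> P f \<Longrightarrow> P g \<Longrightarrow> P (\<lambda>X. f X * g X)"
  shows "P f"
proof -
  obtain m C where "pol m C f" using assms(1) polf_def by auto
  then show ?thesis
  proof induction
    case (pol_add m B f C g)
    then show ?case by (intro assms(4)) (auto simp: polf_def)
  next
    case (pol_mult m B f n C g)
    then show ?case by (intro assms(5)) (auto simp: polf_def)
  qed (auto intro: assms)
qed

lemma D_antisym: "polf f \<Longrightarrow> D i j f X = - D j i f X"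
  by (induction f rule: polf_induct) (auto simp: D_entry)

lemma D_same [simp]: "D i i f = (\<lambda>X. 0)"
  by (rule D_eqI) auto

text \<open>The bracket relations of \<open>so(N)\<close>. A commutator of derivations is again a
  derivation, so it suffices to compare both sides on entries.\<close>

lemma D_commutator:
  assumes "polf f"
  shows "D i j (D k l f) X - D k l (D i j f) X
    = (if i = l then D k j f X else 0) + (if j = l then D i k f X else 0)
    + (if i = k then D j l f X else 0) + (if j = k then D l i f X else 0)"
  using assms
proof (induction f rule: polf_induct)
  case (entry p q)
  then show ?case by (simp add: D_entry D_if)
next
  case (mult f g)
  have "D i j (D k l (\<lambda>X. f X * g X)) X - D k l (D i j (\<lambda>X. f X * g X)) X
    = (D i j (D k l f) X - D k l (D i j f) X) * g X + f X * (D i j (D k l g) X - D k l (D i j g) X)"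
    using mult by (simp add: algebra_simps)
  also note mult.IH(1)
  also note mult.IH(2)
  finally show ?case using mult.hyps by (simp add: algebra_simps)
qed (simp_all add: algebra_simps)

subsection \<open>Haar integrals and integration by parts\<close>

text \<open>Padding by zero frees the entries from the dimension, so that the calculus above needs
  no carrier conditions.\<close>

definition ent :: "nat \<Rightarrow> real mat \<Rightarrow> nat \<Rightarrow> nat \<Rightarrow> real" where
  "ent N A = (\<lambda>k l. if k < N \<and> l < N then A $$ (k, l) else 0)"

definition rotm :: "nat \<Rightarrow> nat \<Rightarrow> nat \<Rightarrow> real \<Rightarrow> real mat" where
  "rotm N i j t = mat N N (\<lambda>(k, l). rot i j t (ent N (1\<^sub>m N)) k l)"

lemma rotm_carrier [simp]: "rotm N i j t \<in> carrier_mat N N"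
  by (simp add: rotm_def)

lemma ent_inj:
  assumes "A \<in> carrier_mat N N" "B \<in> carrier_mat N N" "ent N A = ent N B"
  shows "A = B"
proof (rule eq_matI)
  fix k l assume "k < dim_row B" "l < dim_col B"
  then show "A $$ (k, l) = B $$ (k, l)"
    using assms(1,2) arg_cong[OF assms(3), of "\<lambda>X. X k l"] by (simp add: ent_def)
qed (use assms in auto)

lemma ent_mult:
  assumes "A \<in> carrier_mat N N" "B \<in> carrier_mat N N" "k < N" "l < N"
  shows "ent N (A * B) k l = (\<Sum>p<N. ent N A k p * ent N B p l)"
  using assms by (auto simp: ent_def scalar_prod_def lessThan_atLeast0 intro!: sum.cong)

lemma ent_one: "ent N (1\<^sub>m N) k l = (if k = l \<and> k < N then 1 else 0)"
  by (auto simp: ent_def)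

lemma ent_rotm:
  assumes "i < N" "j < N" "A \<in> carrier_mat N N"
  shows "ent N (rotm N i j t * A) = rot i j t (ent N A)"
proof (intro ext)
  fix k l
  show "ent N (rotm N i j t * A) k l = rot i j t (ent N A) k l"
  proof (cases "k < N \<and> l < N")
    case False
    then show ?thesis using assms by (auto simp: ent_def rot_def)
  next
    case True
    have *: "(\<Sum>p<N. (if a = p then 1 else 0) * x p) = x a" if "a < N" for a and x :: "nat \<Rightarrow> real"
      using that by (subst sum.cong[OF refl, of _ _ "\<lambda>p. if p = a then x p else 0"]) auto
    have "ent N (rotm N i j t * A) k l = (\<Sum>p<N. rot i j t (ent N (1\<^sub>m N)) k p * ent N A p l)"
      using True assms by (subst ent_mult) (auto simp: rotm_def ent_def intro!: sum.cong)
    also have "\<dots> = rot i j t (ent N A) k l"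
      using True assms
      by (simp add: rot_def ent_one distrib_right left_diff_distrib sum.distrib sum_subtractf
          mult.assoc sum_distrib_left[symmetric] * )
    finally show ?thesis .
  qed
qed

lemma transpose_rotm:
  "i < N \<Longrightarrow> j < N \<Longrightarrow> transpose_mat (rotm N i j t) = rotm N i j (- t)"
  by (rule eq_matI) (auto simp: rotm_def rot_def ent_one)

lemma rotm_mult: "i < N \<Longrightarrow> j < N \<Longrightarrow> rotm N i j s * rotm N i j t = rotm N i j (s + t)"
proof -
  assume ij: "i < N" "j < N"
  have R: "rotm N i j u = rotm N i j u * 1\<^sub>m N" for u
    by (rule right_mult_one_mat[OF rotm_carrier, symmetric])
  have "ent N (rotm N i j s * (rotm N i j t * 1\<^sub>m N)) = ent N (rotm N i j (s + t) * 1\<^sub>m N)"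
    using ij by (simp only: ent_rotm mult_carrier_mat[OF rotm_carrier one_carrier_mat] one_carrier_mat rot_add)
  then have "ent N (rotm N i j s * rotm N i j t) = ent N (rotm N i j (s + t))"
    using R by simp
  then show ?thesis by (intro ent_inj[of _ N] mult_carrier_mat[of _ N N] rotm_carrier)
qed

lemma rotm_0: "rotm N i j 0 = 1\<^sub>m N"
  by (rule eq_matI) (auto simp: rotm_def ent_one)

lemma rotm_orthogonal: "i < N \<Longrightarrow> j < N \<Longrightarrow> rotm N i j t \<in> orthogonal_group N"
  by (simp add: orthogonal_group_def transpose_rotm rotm_mult rotm_0)

lemma orthogonal_rows:
  assumes "A \<in> orthogonal_group N" "k < N" "l < N"
  shows "(\<Sum>p<N. A $$ (k, p) * A $$ (l, p)) = (if k = l then 1 else 0)"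
proof -
  have A: "A \<in> carrier_mat N N" "A * transpose_mat A = 1\<^sub>m N"
    using assms by (auto simp: orthogonal_group_def)
  have "(A * transpose_mat A) $$ (k, l) = (\<Sum>p<N. A $$ (k, p) * A $$ (l, p))"
    using A(1) assms by (auto simp: scalar_prod_def lessThan_atLeast0 intro!: sum.cong)
  then show ?thesis using A assms by simp
qed

lemma orthogonal_cols:
  assumes "A \<in> orthogonal_group N" "k < N" "l < N"
  shows "(\<Sum>p<N. A $$ (p, k) * A $$ (p, l)) = (if k = l then 1 else 0)"
  using orthogonal_rows[OF orthogonal_group_transpose[OF assms(1)] assms(2,3)] assms
    orthogonal_group_carrier[OF assms(1)] by simp

definition orth_ents :: "nat \<Rightarrow> (nat \<Rightarrow> nat \<Rightarrow> real) set" where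
  "orth_ents N = ent N ` orthogonal_group N"

lemma orth_ents_rot: "X \<in> orth_ents N \<Longrightarrow> i < N \<Longrightarrow> j < N \<Longrightarrow> rot i j t X \<in> orth_ents N"
  unfolding orth_ents_def
  by (auto simp: image_iff intro!: bexI[of _ "rotm N i j t * _"] ent_rotm[symmetric]
      orthogonal_group_mult rotm_orthogonal orthogonal_group_carrier)

lemma orth_ents_le_1: "X \<in> orth_ents N \<Longrightarrow> \<bar>X k l\<bar> \<le> 1"
proof -
  assume "X \<in> orth_ents N"
  then obtain A where A: "A \<in> orthogonal_group N" "X = ent N A" by (auto simp: orth_ents_def)
  have "\<bar>A $$ (k, l)\<bar> \<le> 1" if "k < N" "l < N"
  proof -
    have "(A $$ (k, l))\<^sup>2 \<le> (\<Sum>p<N. A $$ (k, p) * A $$ (k, p))"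
      using that by (subst power2_eq_square) (rule member_le_sum[of l], auto)
    then show ?thesis using orthogonal_rows[OF A(1) that(1) that(1)] by (simp add: abs_square_le_1)
  qed
  then show ?thesis by (auto simp: A ent_def)
qed

lemma pol_bound_orth: "pol m C f \<Longrightarrow> X \<in> orth_ents N \<Longrightarrow> \<bar>f X\<bar> \<le> C"
  by (rule pol_bound) (auto intro: orth_ents_le_1)

lemma polf_bound_orth: "polf f \<Longrightarrow> \<exists>C\<ge>0. \<forall>X\<in>orth_ents N. \<bar>f X\<bar> \<le> C"
  unfolding polf_def by (metis pol_bound_orth pol_nonneg)

lemma polf_rot [simp, intro]: "polf f \<Longrightarrow> polf (\<lambda>X. f (rot i j t X))"
proof (induction f rule: polf_induct)
  case (entry k l)
  have "polf (\<lambda>X. cos t * X i l + sin t * X j l)" "polf (\<lambda>X. cos t * X j l - sin t * X i l)"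
    by auto
  then show ?case
    by (cases "i = j"; cases "k = i"; cases "k = j") (simp_all add: rot_def)
qed auto

text \<open>Uniform in the point because rotations stay on the group, where second derivatives of
  polynomials are bounded. Using the mean value inequality twice gives \<open>C\<close> in place of
  the sharp \<open>C / 2\<close>.\<close>

lemma polf_taylor:
  assumes "polf f" "i < N" "j < N"
  shows "\<exists>C\<ge>0. \<forall>X\<in>orth_ents N. \<forall>s. \<bar>f (rot i j s X) - f X - s * D i j f X\<bar> \<le> C * s\<^sup>2"
proof -
  obtain C where C: "C \<ge> 0" "\<And>X. X \<in> orth_ents N \<Longrightarrow> \<bar>D i j (D i j f) X\<bar> \<le> C"
    using polf_bound_orth[of "D i j (D i j f)" N] assms by auto
  have "\<bar>f (rot i j s X) - f X - s * D i j f X\<bar> \<le> C * s\<^sup>2" if X: "X \<in> orth_ents N" for s X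
  proof -
    let ?S = "cball 0 \<bar>s\<bar> :: real set"
    have 1: "\<bar>D i j f (rot i j t X) - D i j f X\<bar> \<le> C * \<bar>s\<bar>" if "t \<in> ?S" for t
    proof -
      have "norm (D i j f (rot i j t X) - D i j f (rot i j 0 X)) \<le> C * norm (t - 0)"
      proof (rule field_differentiable_bound[of UNIV])
        fix u
        show "((\<lambda>u. D i j f (rot i j u X)) has_field_derivative D i j (D i j f) (rot i j u X)) (at u within UNIV)"
          using polf_has_derivative[of "D i j f"] assms by auto
        show "norm (D i j (D i j f) (rot i j u X)) \<le> C"
          using C X orth_ents_rot assms by auto
      qed auto
      also have "\<dots> \<le> C * \<bar>s\<bar>" using that C by (auto intro!: mult_left_mono)
      finally show ?thesis by simp
    qed
    have "norm ((f (rot i j s X) - s * D i j f X) - (f (rot i j 0 X) - 0 * D i j f X)) \<le> (C * \<bar>s\<bar>) * norm (s - 0)"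
    proof (rule field_differentiable_bound[of ?S])
      fix u assume "u \<in> ?S"
      show "((\<lambda>u. f (rot i j u X) - u * D i j f X) has_field_derivative
          D i j f (rot i j u X) - D i j f X) (at u within ?S)"
        using assms
        by (auto intro!: derivative_eq_intros has_field_derivative_at_within[OF polf_has_derivative])
      show "norm (D i j f (rot i j u X) - D i j f X) \<le> C * \<bar>s\<bar>"
        using 1[OF \<open>u \<in> ?S\<close>] by simp
    qed auto
    then show ?thesis by (simp add: power2_eq_square algebra_simps)
  qed
  with C(1) show ?thesis by blast
qed

text \<open>The measure is a parameter, so that existence of a Haar measure is not at stake: in the
  end it is the law of \<open>Q N\<close>. By uniqueness it agrees with
  \<open>haar_prob N\<close>.\<close>

locale haar =
  fixes N :: nat and \<mu> :: "real mat measure"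
  assumes haar: "is_haar_prob N \<mu>"
begin

sublocale prob_space \<mu>
  using haar by (simp add: is_haar_prob_def)

lemma sets_haar [measurable_cong]: "sets \<mu> = sets (orth_borel N)"
  using haar by (simp add: is_haar_prob_def)

lemma space_haar [simp]: "space \<mu> = orthogonal_group N"
  using sets_eq_imp_space_eq[OF sets_haar] by simp

lemma measurable_left_mult:
  "A \<in> orthogonal_group N \<Longrightarrow> (\<lambda>x. A * x) \<in> orth_borel N \<rightarrow>\<^sub>M orth_borel N"
  by (intro measurable_orth_mult measurable_const measurable_ident_sets[OF refl]) simp

lemma measurable_right_mult:
  "A \<in> orthogonal_group N \<Longrightarrow> (\<lambda>x. x * A) \<in> orth_borel N \<rightarrow>\<^sub>M orth_borel N"
  by (intro measurable_orth_mult measurable_const measurable_ident_sets[OF refl]) simp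

lemma integral_left_mult:
  fixes f :: "real mat \<Rightarrow> real"
  assumes "A \<in> orthogonal_group N" "f \<in> borel_measurable (orth_borel N)"
  shows "(\<integral>x. f (A * x) \<partial>\<mu>) = (\<integral>x. f x \<partial>\<mu>)"
proof -
  have m: "(\<lambda>x. A * x) \<in> \<mu> \<rightarrow>\<^sub>M orth_borel N"
    using measurable_left_mult[OF assms(1)] by measurable
  have "(\<integral>x. f x \<partial>distr \<mu> (orth_borel N) (\<lambda>x. A * x)) = (\<integral>x. f (A * x) \<partial>\<mu>)"
    by (rule integral_distr[OF m assms(2)])
  then show ?thesis using haar assms(1) by (simp add: is_haar_prob_def)
qed

lemma integral_transpose:
  fixes f :: "real mat \<Rightarrow> real"
  assumes "f \<in> borel_measurable (orth_borel N)"
  shows "(\<integral>x. f (transpose_mat x) \<partial>\<mu>) = (\<integral>x. f x \<partial>\<mu>)"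
proof -
  have m: "transpose_mat \<in> \<mu> \<rightarrow>\<^sub>M orth_borel N"
    using measurable_orth_transpose by measurable
  have "(\<integral>x. f x \<partial>distr \<mu> (orth_borel N) transpose_mat) = (\<integral>x. f (transpose_mat x) \<partial>\<mu>)"
    by (rule integral_distr[OF m assms])
  then show ?thesis using is_haar_prob_eq_transpose[OF haar haar] by simp
qed

text \<open>Only left invariance is given; transposition preserves the measure and exchanges the two
  sides.\<close>

lemma integral_right_mult:
  fixes f :: "real mat \<Rightarrow> real"
  assumes A: "A \<in> orthogonal_group N" and f: "f \<in> borel_measurable (orth_borel N)"
  shows "(\<integral>x. f (x * A) \<partial>\<mu>) = (\<integral>x. f x \<partial>\<mu>)"
proof -
  have t: "(\<lambda>x. f (transpose_mat x)) \<in> borel_measurable (orth_borel N)"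
    using measurable_compose[OF measurable_orth_transpose f] .
  have "(\<integral>x. f (x * A) \<partial>\<mu>) = (\<integral>x. f (transpose_mat x * A) \<partial>\<mu>)"
    by (subst integral_transpose[symmetric, of "\<lambda>x. f (x * A)"])
      (use measurable_compose[OF measurable_right_mult[OF A] f] in auto)
  also have "\<dots> = (\<integral>x. f (transpose_mat (transpose_mat A * x)) \<partial>\<mu>)"
  proof (rule Bochner_Integration.integral_cong[OF refl])
    fix x assume "x \<in> space \<mu>"
    then have "x \<in> carrier_mat N N" "A \<in> carrier_mat N N"
      using A by (auto dest: orthogonal_group_carrier)
    then show "f (transpose_mat x * A) = f (transpose_mat (transpose_mat A * x))"
      by (subst transpose_mult[of _ N N _ N]) auto
  qed
  also have "\<dots> = (\<integral>x. f x \<partial>\<mu>)"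
    using integral_left_mult[OF orthogonal_group_transpose[OF A] t] integral_transpose[OF f] by simp
  finally show ?thesis .
qed

lemma measurable_ent [measurable]: "(\<lambda>x. ent N x k l) \<in> borel_measurable (orth_borel N)"
  by (cases "k < N \<and> l < N") (auto simp: ent_def measurable_orth_borel_entry)

lemma measurable_polf: "polf f \<Longrightarrow> (\<lambda>x. f (ent N x)) \<in> borel_measurable (orth_borel N)"
  by (induction f rule: polf_induct) auto

lemma ent_in [simp, intro]: "x \<in> orthogonal_group N \<Longrightarrow> ent N x \<in> orth_ents N"
  by (auto simp: orth_ents_def)

lemma integrable_polf [simp, intro]: "polf f \<Longrightarrow> integrable \<mu> (\<lambda>x. f (ent N x))"
proof -
  assume f: "polf f"
  then obtain C where "\<forall>X\<in>orth_ents N. \<bar>f X\<bar> \<le> C" using polf_bound_orth[OF f, of N] by auto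
  then show ?thesis
    using measurable_polf[OF f] by (intro integrable_const_bound[of _ C] AE_I2) auto
qed

section \<open>Averages of polynomials and integration by parts\<close>

definition mean :: "((nat \<Rightarrow> nat \<Rightarrow> real) \<Rightarrow> real) \<Rightarrow> real" where
  "mean f = (\<integral>x. f (ent N x) \<partial>\<mu>)"

lemma mean_const [simp]: "mean (\<lambda>X. c) = c"
  using prob_space by (simp add: mean_def)

lemma mean_add: "polf f \<Longrightarrow> polf g \<Longrightarrow> mean (\<lambda>X. f X + g X) = mean f + mean g"
  by (simp add: mean_def)

lemma mean_diff: "polf f \<Longrightarrow> polf g \<Longrightarrow> mean (\<lambda>X. f X - g X) = mean f - mean g"
  by (simp add: mean_def)

lemma mean_minus: "mean (\<lambda>X. - f X) = - mean f"
  by (simp add: mean_def)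

lemma mean_cmult: "mean (\<lambda>X. c * f X) = c * mean f"
  by (simp add: mean_def)

lemma mean_sum: "(\<And>i. i \<in> I \<Longrightarrow> polf (f i)) \<Longrightarrow> mean (\<lambda>X. \<Sum>i\<in>I. f i X) = (\<Sum>i\<in>I. mean (f i))"
  by (simp add: mean_def Bochner_Integration.integral_sum)

lemma mean_mono: "polf f \<Longrightarrow> polf g \<Longrightarrow> (\<And>X. X \<in> orth_ents N \<Longrightarrow> f X \<le> g X) \<Longrightarrow> mean f \<le> mean g"
  unfolding mean_def by (rule integral_mono) auto

lemma mean_nonneg: "(\<And>X. X \<in> orth_ents N \<Longrightarrow> 0 \<le> f X) \<Longrightarrow> 0 \<le> mean f"
  unfolding mean_def by (rule integral_nonneg_AE) auto

lemma mean_rot: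
  assumes "polf f" "i < N" "j < N"
  shows "mean (\<lambda>X. f (rot i j t X)) = mean f"
proof -
  have "mean (\<lambda>X. f (rot i j t X)) = (\<integral>x. f (ent N (rotm N i j t * x)) \<partial>\<mu>)"
    unfolding mean_def using assms
    by (intro Bochner_Integration.integral_cong refl) (auto simp: ent_rotm orthogonal_group_carrier)
  also have "\<dots> = mean f"
    unfolding mean_def using assms
    by (intro integral_left_mult[of _ "\<lambda>x. f (ent N x)"] rotm_orthogonal measurable_polf)
  finally show ?thesis .
qed

text \<open>By invariance the increment of \<open>f\<close> along a rotation has mean zero; the
  uniform Taylor bound replaces differentiation under the integral sign.\<close>

lemma mean_D:
  assumes "polf f" "i < N" "j < N"
  shows "mean (D i j f) = 0"
proof -
  obtain C where C: "C \<ge> 0"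
    "\<And>X s. X \<in> orth_ents N \<Longrightarrow> \<bar>f (rot i j s X) - f X - s * D i j f X\<bar> \<le> C * s\<^sup>2"
    using polf_taylor[OF assms] by blast
  have *: "\<bar>mean (D i j f)\<bar> * s \<le> C * s\<^sup>2" if "s > 0" for s
  proof -
    let ?g = "\<lambda>X. f (rot i j s X) - f X - s * D i j f X"
    have g: "mean ?g = - s * mean (D i j f)"
      using assms by (simp add: mean_diff mean_rot mean_cmult)
    have "?g X \<le> C * s\<^sup>2 \<and> - (C * s\<^sup>2) \<le> ?g X" if "X \<in> orth_ents N" for X
      using C(2)[OF that, of s] by linarith
    then have "mean ?g \<le> mean (\<lambda>X. C * s\<^sup>2)" "mean (\<lambda>X. - (C * s\<^sup>2)) \<le> mean ?g"
      by (intro mean_mono; use assms in simp)+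
    then show ?thesis using that unfolding g by (simp add: abs_if mult.commute)
  qed
  show ?thesis
  proof (rule ccontr)
    define a where "a = \<bar>mean (D i j f)\<bar>"
    assume "mean (D i j f) \<noteq> 0"
    then have a: "a > 0" by (simp add: a_def)
    \<comment> \<open>Small enough that the quadratic error \<open>C * s^2\<close> cannot match
      \<open>a * s\<close>; the 1 covers \<open>C = 0\<close>.\<close>
    define s where "s = a / (C + 1)"
    have s: "s > 0" using a C(1) by (simp add: s_def)
    have "a * s \<le> (C * s) * s"
      using *[OF s] by (simp add: a_def power2_eq_square mult.assoc)
    then have "a \<le> C * s" using s by simp
    moreover have "(C + 1) * s = a" using C(1) by (simp add: s_def)
    ultimately show False using s by (simp add: distrib_right)
  qed
qed

lemma mean_by_parts:
  assumes "polf f" "polf g" "i < N" "j < N"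
  shows "mean (\<lambda>X. D i j f X * g X) = - mean (\<lambda>X. f X * D i j g X)"
  using mean_D[of "\<lambda>X. f X * g X" i j] assms by (simp add: mean_add)

lemma mean_cauchy_schwarz:
  assumes "polf f" "polf g"
  shows "(mean (\<lambda>X. f X * g X))\<^sup>2 \<le> mean (\<lambda>X. (f X)\<^sup>2) * mean (\<lambda>X. (g X)\<^sup>2)"
proof -
  have *: "0 \<le> mean (\<lambda>X. (f X)\<^sup>2) * a\<^sup>2 + 2 * mean (\<lambda>X. f X * g X) * a * b + mean (\<lambda>X. (g X)\<^sup>2) * b\<^sup>2" for a b
  proof -
    have "0 \<le> mean (\<lambda>X. (a * f X + b * g X)\<^sup>2)" by (rule mean_nonneg) auto
    also have "(\<lambda>X. (a * f X + b * g X)\<^sup>2) = (\<lambda>X. a\<^sup>2 * (f X)\<^sup>2 + (2 * a * b * (f X * g X) + b\<^sup>2 * (g X)\<^sup>2))"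
      by (auto simp: fun_eq_iff power2_eq_square algebra_simps)
    also have "mean \<dots> = a\<^sup>2 * mean (\<lambda>X. (f X)\<^sup>2) + (2 * a * b * mean (\<lambda>X. f X * g X) + b\<^sup>2 * mean (\<lambda>X. (g X)\<^sup>2))"
      using assms by (simp add: mean_add mean_cmult)
    finally show ?thesis by (simp add: algebra_simps)
  qed
  let ?a = "mean (\<lambda>X. (f X)\<^sup>2)" and ?b = "mean (\<lambda>X. f X * g X)" and ?c = "mean (\<lambda>X. (g X)\<^sup>2)"
  have a: "0 \<le> ?a" "0 \<le> ?c" by (auto intro: mean_nonneg)
  show ?thesis
  proof (cases "?c = 0")
    case False
    then have "?c > 0" using a by simp
    have "0 \<le> ?c * (?a * ?c - ?b\<^sup>2)"
      using *[of ?c "- ?b"] by (simp add: power2_eq_square algebra_simps)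
    then show ?thesis using \<open>?c > 0\<close> by (simp add: zero_le_mult_iff)
  next
    case True
    have "?b = 0"
    proof (rule ccontr)
      assume b: "?b \<noteq> 0"
      \<comment> \<open>The second coefficient is chosen so that the right-hand side equals
        -1.\<close>
      have "0 \<le> ?a + 2 * ?b * (- (?a + 1) / (2 * ?b))"
        using *[of 1 "- (?a + 1) / (2 * ?b)"] True by simp
      then show False using b by (simp add: field_simps)
    qed
    then show ?thesis using True by simp
  qed
qed

end

subsection \<open>The Laplacian and its commutation identities\<close>

lemma pol_sum:
  assumes "finite I" "\<And>i. i \<in> I \<Longrightarrow> pol m C (f i)"
  shows "pol m (real (card I) * C) (\<lambda>X. \<Sum>i\<in>I. f i X)"
  using assms
proof (induction I rule: finite_induct)
  case empty
  show ?case using pol_const[of m 0] by simp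
next
  case (insert i I)
  have "pol m (C + real (card I) * C) (\<lambda>X. f i X + (\<Sum>i\<in>I. f i X))"
    using insert by (intro pol_add) auto
  then show ?case using insert by (simp add: algebra_simps)
qed

lemma sum_if_row:
  fixes h :: "nat \<Rightarrow> nat \<Rightarrow> real"
  assumes "b < N"
  shows "(\<Sum>i<N. \<Sum>j<N. if i = b then h i j else 0) = (\<Sum>j<N. h b j)"
  using assms by (subst sum.swap) simp

text \<open>Log-convexity makes the ratios \<open>c (k + 1) / c k\<close> nondecreasing, so a first
  ratio \<open>r > q\<close> would force growth like \<open>r ^ k\<close>. The constant
  \<open>B\<close> drops out: a growth rate measured in a strong norm becomes an operator bound in
  mean square.\<close>

lemma log_convex_growth:
  fixes c :: "nat \<Rightarrow> real"
  assumes nonneg: "\<And>k. 0 \<le> c k" and convex: "\<And>k. (c (Suc k))\<^sup>2 \<le> c k * c (Suc (Suc k))"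
    and growth: "\<And>k. c k \<le> B * q ^ k" and q: "0 \<le> q"
  shows "c 1 \<le> q * c 0"
proof (cases "c 0 = 0")
  case True
  then show ?thesis using convex[of 0] by simp
next
  case False
  then have c0: "c 0 > 0" using nonneg[of 0] by simp
  show ?thesis
  proof (rule ccontr)
    assume "\<not> c 1 \<le> q * c 0"
    define r where "r = c 1 / c 0"
    have r: "q < r"
      using \<open>\<not> c 1 \<le> q * c 0\<close> c0 by (simp add: r_def field_simps)
    have step: "c k > 0 \<and> r * c k \<le> c (Suc k)" for k
    proof (induction k)
      case 0
      then show ?case using c0 by (simp add: r_def)
    next
      case (Suc k)
      then have "r * c k > 0" using r q by simp
      then have pos: "c (Suc k) > 0" using Suc by linarith
      have "(r * c (Suc k)) * c k \<le> c (Suc k) * c (Suc k)"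
        using Suc pos by (simp add: mult.assoc mult.left_commute)
      also have "\<dots> \<le> c (Suc (Suc k)) * c k"
        using convex[of k] by (simp add: power2_eq_square mult.commute)
      finally show ?case using Suc pos by simp
    qed
    have lower: "r ^ k * c 0 \<le> c k" for k
    proof (induction k)
      case (Suc k)
      have "r ^ Suc k * c 0 \<le> r * c k"
        using Suc r q by (simp add: mult.assoc mult_left_mono)
      then show ?case using step[of k] by linarith
    qed simp
    have q0: "q > 0"
    proof (rule ccontr)
      assume "\<not> q > 0"
      then have "c 1 \<le> 0" using q growth[of 1] by simp
      then show False using step[of 1] by simp
    qed
    obtain n where n: "B / c 0 < (r / q) ^ n"
      using real_arch_pow[of "r / q" "B / c 0"] r q0 by auto
    have "r ^ n * c 0 \<le> B * q ^ n"
      using lower[of n] growth[of n] by linarith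
    then have "(r / q) ^ n \<le> B / c 0"
      using q0 c0 by (simp add: power_divide field_simps)
    with n show False by simp
  qed
qed

context haar
begin

text \<open>The sign makes the operator nonnegative; its quadratic form is the Dirichlet form
  \<open>dir\<close> (\<open>mean_lap\<close>).\<close>

definition lap :: "((nat \<Rightarrow> nat \<Rightarrow> real) \<Rightarrow> real) \<Rightarrow> (nat \<Rightarrow> nat \<Rightarrow> real) \<Rightarrow> real" where
  "lap f X = - (\<Sum>i<N. \<Sum>j<N. D i j (D i j f) X)"

definition dir :: "((nat \<Rightarrow> nat \<Rightarrow> real) \<Rightarrow> real) \<Rightarrow> ((nat \<Rightarrow> nat \<Rightarrow> real) \<Rightarrow> real) \<Rightarrow> real" where
  "dir f g = (\<Sum>i<N. \<Sum>j<N. mean (\<lambda>X. D i j f X * D i j g X))"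

lemma lap_eq: "lap f = (\<lambda>X. - (\<Sum>i<N. \<Sum>j<N. D i j (D i j f) X))"
  by (simp add: lap_def fun_eq_iff)

lemma polf_lap [simp, intro]: "polf f \<Longrightarrow> polf (lap f)"
  unfolding lap_eq by auto

text \<open>Two derivatives cost \<open>2 * m\<close> each, and there are \<open>N^2\<close> pairs
  of indices.\<close>

lemma pol_lap:
  assumes "pol m C f"
  shows "pol m ((2 * real N * real m)\<^sup>2 * C) (lap f)"
proof -
  have "pol m (2 * real m * (2 * real m * C)) (D i j (D i j f))" for i j
    using assms by (intro pol_D)
  then have "pol m (\<bar>- 1\<bar> * (real (card {..<N}) * (real (card {..<N}) * (2 * real m * (2 * real m * C)))))
      (\<lambda>X. - 1 * (\<Sum>i<N. \<Sum>j<N. D i j (D i j f) X))"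
    by (intro pol_cmult pol_sum) auto
  then show ?thesis by (simp add: lap_eq power2_eq_square algebra_simps)
qed

text \<open>The operator is a Casimir element, central in the algebra generated by the
  \<open>D i j\<close>. Moving \<open>D a b\<close> past \<open>D i j\<close> twice leaves one
  commutator outside and one inside a derivative; summed over all pairs, the two families are
  opposite (\<open>s1\<close> and \<open>s2\<close>).\<close>

lemma D_lap:
  assumes f: "polf f" and ab: "a < N" "b < N"
  shows "D a b (lap f) = lap (D a b f)"
proof
  fix X
  let ?K = "\<lambda>i j g X. (if i = b then D a j g X else 0) + (if j = b then D i a g X else 0)
    + (if i = a then D j b g X else 0) + (if j = a then D b i g X else (0 :: real))"
  have c1: "D i j (D a b g) = (\<lambda>X. D a b (D i j g) X + ?K i j g X)" if "polf g" for i j g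
    using D_commutator[OF that, of i j a b] by (simp add: fun_eq_iff algebra_simps)
  have c2: "D i j (D i j (D a b f)) X
    = D a b (D i j (D i j f)) X + ?K i j (D i j f) X + D i j (?K i j f) X" for i j
    using f by (simp add: c1[OF f] c1[of "D i j f"])
  have c3: "D i j (?K i j f) X = (if i = b then D i j (D a j f) X else 0) + (if j = b then D i j (D i a f) X else 0)
    + (if i = a then D i j (D j b f) X else 0) + (if j = a then D i j (D b i f) X else 0)" for i j
    using f by (simp add: D_if)
  have neg: "D i j (D k l f) X = - D j i (D k l f) X" "D i j (D k l f) X = - D i j (D l k f) X" for i j k l
  proof -
    show "D i j (D k l f) X = - D j i (D k l f) X" using f by (intro D_antisym) auto
    have "D k l f = (\<lambda>X. - D l k f X)" using D_antisym[OF f, of k l] by auto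
    then show "D i j (D k l f) X = - D i j (D l k f) X" using f by simp
  qed
  have s1: "(\<Sum>i<N. \<Sum>j<N. ?K i j (D i j f) X) = 2 * (\<Sum>j<N. D a j (D b j f) X) - 2 * (\<Sum>j<N. D b j (D a j f) X)"
  proof -
    have "(\<Sum>i<N. \<Sum>j<N. ?K i j (D i j f) X)
      = (\<Sum>j<N. D a j (D b j f) X) + (\<Sum>i<N. D i a (D i b f) X)
      + (\<Sum>j<N. D j b (D a j f) X) + (\<Sum>i<N. D b i (D i a f) X)"
      using ab by (simp add: sum.distrib sum_if_row)
    also have "(\<Sum>i<N. D i a (D i b f) X) = (\<Sum>j<N. D a j (D b j f) X)"
      using neg by (intro sum.cong refl) (metis minus_minus)
    also have "(\<Sum>j<N. D j b (D a j f) X) = - (\<Sum>j<N. D b j (D a j f) X)"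
      unfolding sum_negf[symmetric] using neg by (intro sum.cong refl) metis
    also have "(\<Sum>i<N. D b i (D i a f) X) = - (\<Sum>j<N. D b j (D a j f) X)"
      unfolding sum_negf[symmetric] using neg by (intro sum.cong refl) metis
    finally show ?thesis by simp
  qed
  have s2: "(\<Sum>i<N. \<Sum>j<N. D i j (?K i j f) X) = 2 * (\<Sum>j<N. D b j (D a j f) X) - 2 * (\<Sum>j<N. D a j (D b j f) X)"
  proof -
    have "(\<Sum>i<N. \<Sum>j<N. D i j (?K i j f) X)
      = (\<Sum>j<N. D b j (D a j f) X) + (\<Sum>i<N. D i b (D i a f) X)
      + (\<Sum>j<N. D a j (D j b f) X) + (\<Sum>i<N. D i a (D b i f) X)"
      unfolding c3 using ab by (simp add: sum.distrib sum_if_row)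
    also have "(\<Sum>i<N. D i b (D i a f) X) = (\<Sum>j<N. D b j (D a j f) X)"
      using neg by (intro sum.cong refl) (metis minus_minus)
    also have "(\<Sum>j<N. D a j (D j b f) X) = - (\<Sum>j<N. D a j (D b j f) X)"
      unfolding sum_negf[symmetric] using neg by (intro sum.cong refl) metis
    also have "(\<Sum>i<N. D i a (D b i f) X) = - (\<Sum>j<N. D a j (D b j f) X)"
      unfolding sum_negf[symmetric] using neg by (intro sum.cong refl) metis
    finally show ?thesis by simp
  qed
  have "lap (D a b f) X = - (\<Sum>i<N. \<Sum>j<N. D a b (D i j (D i j f)) X)
      - ((\<Sum>i<N. \<Sum>j<N. ?K i j (D i j f) X) + (\<Sum>i<N. \<Sum>j<N. D i j (?K i j f) X))"
    unfolding lap_def c2 by (simp add: sum.distrib)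
  also have "\<dots> = - (\<Sum>i<N. \<Sum>j<N. D a b (D i j (D i j f)) X)"
    unfolding s1 s2 by simp
  also have "\<dots> = D a b (lap f) X"
    using f by (simp add: lap_eq)
  finally show "D a b (lap f) X = lap (D a b f) X" by simp
qed

lemma mean_lap:
  assumes "polf f" "polf g"
  shows "mean (\<lambda>X. lap f X * g X) = dir f g"
proof -
  have "mean (\<lambda>X. lap f X * g X) = mean (\<lambda>X. \<Sum>i<N. \<Sum>j<N. - (D i j (D i j f) X * g X))"
    by (simp add: lap_def sum_distrib_right sum_negf)
  also have "\<dots> = (\<Sum>i<N. \<Sum>j<N. - mean (\<lambda>X. D i j (D i j f) X * g X))"
    using assms by (simp add: mean_sum mean_minus)
  also have "\<dots> = dir f g"
    unfolding dir_def using assms by (intro sum.cong refl) (simp add: mean_by_parts)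
  finally show ?thesis .
qed

lemma dir_commute: "dir f g = dir g f"
  by (simp add: dir_def mult.commute)

lemma dir_nonneg: "0 \<le> dir f f"
  unfolding dir_def by (intro sum_nonneg mean_nonneg) auto

lemma dir_diff:
  assumes "polf f" "polf g"
  shows "dir (\<lambda>X. f X - s * g X) (\<lambda>X. f X - s * g X) = dir f f - 2 * s * dir f g + s\<^sup>2 * dir g g"
proof -
  have "mean (\<lambda>X. D i j (\<lambda>X. f X - s * g X) X * D i j (\<lambda>X. f X - s * g X) X)
      = mean (\<lambda>X. D i j f X * D i j f X) - 2 * s * mean (\<lambda>X. D i j f X * D i j g X)
        + s\<^sup>2 * mean (\<lambda>X. D i j g X * D i j g X)" for i j
  proof -
    have "mean (\<lambda>X. D i j (\<lambda>X. f X - s * g X) X * D i j (\<lambda>X. f X - s * g X) X)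
      = mean (\<lambda>X. D i j f X * D i j f X - (2 * s) * (D i j f X * D i j g X) + s\<^sup>2 * (D i j g X * D i j g X))"
      using assms by (simp add: algebra_simps power2_eq_square)
    also have "\<dots> = mean (\<lambda>X. D i j f X * D i j f X) - (2 * s) * mean (\<lambda>X. D i j f X * D i j g X)
        + s\<^sup>2 * mean (\<lambda>X. D i j g X * D i j g X)"
      using assms by (simp only: mean_add mean_diff mean_cmult polf_D polf_mult polf_const polf_diff)
    finally show ?thesis .
  qed
  then show ?thesis
    by (simp add: dir_def sum.distrib sum_subtractf sum_distrib_left)
qed

lemma mean_lap_square:
  assumes "polf f"
  shows "mean (\<lambda>X. (lap f X)\<^sup>2) = (\<Sum>i<N. \<Sum>j<N. \<Sum>k<N. \<Sum>l<N. mean (\<lambda>X. (D k l (D i j f) X)\<^sup>2))"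
proof -
  have "mean (\<lambda>X. (lap f X)\<^sup>2) = dir f (lap f)"
    using assms mean_lap[of f "lap f"] by (simp add: power2_eq_square)
  also have "\<dots> = (\<Sum>i<N. \<Sum>j<N. dir (D i j f) (D i j f))"
    unfolding dir_def[of f "lap f"]
  proof (intro sum.cong refl)
    fix i j assume "i \<in> {..<N}" "j \<in> {..<N}"
    then show "mean (\<lambda>X. D i j f X * D i j (lap f) X) = dir (D i j f) (D i j f)"
      using mean_lap[of "D i j f" "D i j f"] assms by (simp add: D_lap mult.commute)
  qed
  finally show ?thesis by (simp add: dir_def power2_eq_square)
qed

text \<open>For distinct \<open>l\<close> and \<open>i\<close>, each of the \<open>N - 2\<close>
  remaining \<open>j\<close> writes \<open>D l i\<close> as a commutator. The bound (x - y)^2 \<le>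
  2 x^2 + 2 y^2 yields two sums of squared second derivatives, each a partial sum of the full
  Hessian sum; 2 times 2 is the constant 4.\<close>

lemma bochner:
  assumes f: "polf f" and N: "2 \<le> N"
  shows "(real N - 2) * dir f f \<le> 4 * mean (\<lambda>X. (lap f X)\<^sup>2)"
proof -
  define T where "T i j k l = mean (\<lambda>X. (D k l (D i j f) X)\<^sup>2)" for i j k l
  define d where "d i j = mean (\<lambda>X. (D i j f X)\<^sup>2)" for i j
  have T: "0 \<le> T i j k l" for i j k l
    unfolding T_def by (rule mean_nonneg) auto
  have d: "0 \<le> d i j" for i j
    unfolding d_def by (rule mean_nonneg) auto
  have S: "mean (\<lambda>X. (lap f X)\<^sup>2) = (\<Sum>i<N. \<Sum>j<N. \<Sum>k<N. \<Sum>l<N. T i j k l)"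
    unfolding T_def by (rule mean_lap_square[OF f])
  \<comment> \<open>The condition \<open>l \<noteq> i\<close> can be left out of the test, since
    \<open>d i i = 0\<close>.\<close>
  have 1: "(if j \<noteq> i \<and> j \<noteq> l then d l i else 0) \<le> 2 * (T j l i j + T i j j l)" for i j l
  proof (cases "j \<noteq> i \<and> j \<noteq> l \<and> l \<noteq> i")
    case True
    then have c: "D l i f X = D i j (D j l f) X - D j l (D i j f) X" for X
      using D_commutator[OF f, of i j j l X] by simp
    have "d l i \<le> mean (\<lambda>X. 2 * ((D i j (D j l f) X)\<^sup>2 + (D j l (D i j f) X)\<^sup>2))"
      unfolding d_def
    proof (rule mean_mono)
      fix X
      show "(D l i f X)\<^sup>2 \<le> 2 * ((D i j (D j l f) X)\<^sup>2 + (D j l (D i j f) X)\<^sup>2)"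
        unfolding c using zero_le_power2[of "D i j (D j l f) X + D j l (D i j f) X"]
        by (simp add: power2_eq_square algebra_simps)
    qed (use f in auto)
    also have "\<dots> = 2 * (T j l i j + T i j j l)"
      using f by (simp add: mean_cmult mean_add T_def)
    finally show ?thesis using True by simp
  next
    case False
    then have "(if j \<noteq> i \<and> j \<noteq> l then d l i else 0) = 0"
      by (auto simp: d_def)
    then show ?thesis using T[of j l i j] T[of i j j l] by simp
  qed
  have 2: "(\<Sum>i<N. \<Sum>l<N. \<Sum>j<N. T j l i j) \<le> mean (\<lambda>X. (lap f X)\<^sup>2)"
  proof -
    have "(\<Sum>i<N. \<Sum>l<N. \<Sum>j<N. T j l i j) = (\<Sum>i<N. \<Sum>j<N. \<Sum>l<N. T j l i j)"
      by (rule sum.cong[OF refl], rule sum.swap)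
    also have "\<dots> = (\<Sum>j<N. \<Sum>i<N. \<Sum>l<N. T j l i j)"
      by (rule sum.swap)
    also have "\<dots> = (\<Sum>j<N. \<Sum>l<N. \<Sum>i<N. T j l i j)"
      by (rule sum.cong[OF refl], rule sum.swap)
    also have "\<dots> \<le> mean (\<lambda>X. (lap f X)\<^sup>2)"
      unfolding S by (rule sum_mono, rule sum_mono, rule sum_mono, rule member_le_sum) (auto intro: T)
    finally show ?thesis .
  qed
  have 3: "(\<Sum>i<N. \<Sum>l<N. \<Sum>j<N. T i j j l) \<le> mean (\<lambda>X. (lap f X)\<^sup>2)"
  proof -
    have "(\<Sum>i<N. \<Sum>l<N. \<Sum>j<N. T i j j l) = (\<Sum>i<N. \<Sum>j<N. \<Sum>l<N. T i j j l)"
      by (rule sum.cong[OF refl], rule sum.swap)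
    also have "\<dots> \<le> mean (\<lambda>X. (lap f X)\<^sup>2)"
      unfolding S
    proof (rule sum_mono, rule sum_mono)
      fix i j assume "j \<in> {..<N}"
      then show "(\<Sum>l<N. T i j j l) \<le> (\<Sum>k<N. \<Sum>l<N. T i j k l)"
        by (intro member_le_sum[of j "{..<N}" "\<lambda>k. \<Sum>l<N. T i j k l"] sum_nonneg T) auto
    qed
    finally show ?thesis .
  qed
  have "(real N - 2) * dir f f = (\<Sum>i<N. \<Sum>l<N. (real N - 2) * d l i)"
    unfolding dir_def d_def by (subst sum.swap) (simp add: sum_distrib_left power2_eq_square)
  also have "\<dots> \<le> (\<Sum>i<N. \<Sum>l<N. \<Sum>j<N. if j \<noteq> i \<and> j \<noteq> l then d l i else 0)"
  proof (intro sum_mono)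
    fix i l assume il: "i \<in> {..<N}" "l \<in> {..<N}"
    \<comment> \<open>For \<open>i = l\<close> there are even \<open>N - 1\<close> admissible
      \<open>j\<close>; \<open>2 \<le> N\<close> keeps the natural subtraction honest.\<close>
    have "(real N - 2) * d l i \<le> real (N - card {i, l}) * d l i"
      using N by (intro mult_right_mono d) (auto simp: card_insert_if)
    also have "N - card {i, l} = card ({..<N} - {i, l})"
      using il by (subst card_Diff_subset) auto
    also have "real (card ({..<N} - {i, l})) * d l i = (\<Sum>j\<in>{..<N} - {i, l}. d l i)"
      by simp
    also have "\<dots> = (\<Sum>j<N. if j \<noteq> i \<and> j \<noteq> l then d l i else 0)"
      by (intro sum.mono_neutral_cong_left) auto
    finally show "(real N - 2) * d l i \<le> (\<Sum>j<N. if j \<noteq> i \<and> j \<noteq> l then d l i else 0)" .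
  qed
  also have "\<dots> \<le> (\<Sum>i<N. \<Sum>l<N. \<Sum>j<N. 2 * (T j l i j + T i j j l))"
    by (intro sum_mono 1)
  also have "\<dots> = 2 * (\<Sum>i<N. \<Sum>l<N. \<Sum>j<N. T j l i j) + 2 * (\<Sum>i<N. \<Sum>l<N. \<Sum>j<N. T i j j l)"
    by (simp add: sum.distrib sum_distrib_left algebra_simps)
  also have "\<dots> \<le> 4 * mean (\<lambda>X. (lap f X)\<^sup>2)"
    using 2 3 by linarith
  finally show ?thesis .
qed

text \<open>The norms of the iterates of \<open>lap\<close> are log-convex and grow at most geometrically.\<close>

lemma mean_lap_square_le:
  assumes f: "pol m C f"
  shows "mean (\<lambda>X. (lap f X)\<^sup>2) \<le> ((2 * real N * real m)\<^sup>2)\<^sup>2 * mean (\<lambda>X. (f X)\<^sup>2)"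
proof -
  define K where "K = (2 * real N * real m)\<^sup>2"
  define F where "F k = (lap ^^ k) f" for k
  define c where "c k = mean (\<lambda>X. (F k X)\<^sup>2)" for k
  have pF: "pol m (K ^ k * C) (F k)" for k
  proof (induction k)
    case (Suc k)
    then show ?case using pol_lap[OF Suc] by (simp add: F_def K_def mult.assoc)
  qed (use f in \<open>simp add: F_def\<close>)
  then have pF': "polf (F k)" for k by (auto simp: polf_def)
  have "c 1 \<le> K\<^sup>2 * c 0"
  proof (rule log_convex_growth)
    show "0 \<le> c k" for k unfolding c_def by (rule mean_nonneg) auto
    \<comment> \<open>A sup bound on the group: \<open>K ^ k * C\<close> dominates the coefficients
      of \<open>F k\<close>, whose degree is still \<open>m\<close>.\<close>
    show "c k \<le> C\<^sup>2 * (K\<^sup>2) ^ k" for k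
    proof -
      have "c k \<le> mean (\<lambda>X. (K ^ k * C)\<^sup>2)"
        unfolding c_def
      proof (rule mean_mono)
        fix X assume "X \<in> orth_ents N"
        then show "(F k X)\<^sup>2 \<le> (K ^ k * C)\<^sup>2"
          using pol_bound_orth[OF pF] by (metis abs_le_square_iff abs_of_nonneg pF pol_nonneg)
      qed (use pF' in auto)
      then show ?thesis by (simp add: power_mult_distrib power_mult[symmetric] mult.commute)
    qed
    \<comment> \<open>Symmetry of the Dirichlet form moves one \<open>lap\<close> to the other
      factor; then Cauchy-Schwarz applies.\<close>
    show "(c (Suc k))\<^sup>2 \<le> c k * c (Suc (Suc k))" for k
    proof -
      have "c (Suc k) = mean (\<lambda>X. lap (F k) X * F (Suc k) X)"
        by (simp add: c_def F_def power2_eq_square)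
      also have "\<dots> = dir (F (Suc k)) (F k)"
        by (simp only: mean_lap[OF pF' pF'] dir_commute[of "F k"])
      also have "\<dots> = mean (\<lambda>X. F k X * lap (F (Suc k)) X)"
        by (subst mean_lap[OF pF' pF', symmetric]) (simp only: mult.commute)
      finally have "c (Suc k) = mean (\<lambda>X. F k X * F (Suc (Suc k)) X)"
        by (simp add: F_def)
      then show ?thesis
        using mean_cauchy_schwarz[OF pF' pF', of k "Suc (Suc k)"] by (simp add: c_def)
    qed
  qed simp
  then show ?thesis by (simp add: c_def F_def K_def)
qed

text \<open>Both say that \<open>lap\<close> is bounded by \<open>K\<close> as a quadratic form. The
  second comes from \<open>mean_lap_square_le\<close> for \<open>lap f\<close> by Cauchy-Schwarz,
  the first from the second through nonnegativity of an energy.\<close>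

lemma lap_dirichlet_bounds:
  assumes f: "pol m C f"
  defines "K \<equiv> (2 * real N * real m)\<^sup>2"
  shows "mean (\<lambda>X. (lap f X)\<^sup>2) \<le> K * dir f f"
    and "dir (lap f) (lap f) \<le> K * mean (\<lambda>X. (lap f X)\<^sup>2)"
proof -
  have pf: "polf f" using f by (auto simp: polf_def)
  let ?b = "mean (\<lambda>X. (lap f X)\<^sup>2)"
  have K: "0 \<le> K" by (simp add: K_def)
  have b: "0 \<le> ?b" by (rule mean_nonneg) auto
  have "(dir (lap f) (lap f))\<^sup>2 = (mean (\<lambda>X. lap (lap f) X * lap f X))\<^sup>2"
    using pf by (simp add: mean_lap)
  also have "\<dots> \<le> mean (\<lambda>X. (lap (lap f) X)\<^sup>2) * ?b"
    using pf by (intro mean_cauchy_schwarz) auto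
  also have "\<dots> \<le> (K\<^sup>2 * ?b) * ?b"
    using mean_lap_square_le[OF pol_lap[OF f]] b by (intro mult_right_mono) (auto simp: K_def)
  finally have "(dir (lap f) (lap f))\<^sup>2 \<le> (K * ?b)\<^sup>2"
    by (simp add: power2_eq_square algebra_simps)
  then show 2: "dir (lap f) (lap f) \<le> K * ?b"
    by (rule power2_le_imp_le) (use K b in auto)
  have bdir: "?b = dir f (lap f)"
    using mean_lap[of f "lap f"] pf by (simp add: power2_eq_square)
  show "?b \<le> K * dir f f"
  proof (cases "K = 0")
    case True
    then show ?thesis
      using mean_lap_square_le[OF f] by (auto simp: K_def)
  next
    case False
    then have K0: "K > 0" using K by simp
    \<comment> \<open>The energy of \<open>f - lap f / K\<close>; the step \<open>1 / K\<close> is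
      optimal for the quadratic bound in the step size.\<close>
    have "0 \<le> dir f f - 2 * (1 / K) * ?b + (1 / K)\<^sup>2 * dir (lap f) (lap f)"
      unfolding bdir dir_diff[OF pf polf_lap[OF pf], symmetric] by (rule dir_nonneg)
    also have "\<dots> \<le> dir f f - 2 * (1 / K) * ?b + (1 / K)\<^sup>2 * (K * ?b)"
      using 2 by (intro add_left_mono mult_left_mono) auto
    also have "\<dots> = dir f f - ?b / K"
      using K0 by (simp add: power2_eq_square)
    finally show ?thesis using K0 by (simp add: field_simps)
  qed
qed

end

subsection \<open>Givens rotations\<close>

text \<open>A representative of the component of determinant -1. It acts from the right, on columns,
  and therefore commutes with the rotations, which act on rows.\<close>

definition flipm :: "nat \<Rightarrow> real mat" where
  "flipm N = mat_diag N (\<lambda>i. if i = N - 1 then - 1 else 1)"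

definition colflip :: "nat \<Rightarrow> (nat \<Rightarrow> nat \<Rightarrow> real) \<Rightarrow> nat \<Rightarrow> nat \<Rightarrow> real" where
  "colflip N X = (\<lambda>k l. if l = N - 1 then - X k l else X k l)"

lemma flipm_carrier [simp]: "flipm N \<in> carrier_mat N N"
  by (simp add: flipm_def)

lemma flipm_orthogonal: "flipm N \<in> orthogonal_group N"
proof -
  have t: "transpose_mat (flipm N) = flipm N"
    by (rule eq_matI) (auto simp: flipm_def mat_diag_def)
  have "flipm N * flipm N = mat_diag N (\<lambda>i. 1)"
    unfolding flipm_def mat_diag_diag by (rule arg_cong[of _ _ "mat_diag N"]) auto
  then show ?thesis by (simp add: orthogonal_group_def t)
qed

lemma ent_flipm: "A \<in> carrier_mat N N \<Longrightarrow> ent N (A * flipm N) = colflip N (ent N A)"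
  unfolding flipm_def by (subst mat_diag_mult_right) (auto simp: ent_def colflip_def fun_eq_iff)

lemma det_flipm: "0 < N \<Longrightarrow> Determinant.det (flipm N) = - 1"
proof -
  assume N: "0 < N"
  have "Determinant.det (flipm N) = (\<Prod>i\<in>{0..<N}. if i = N - 1 then - 1 else 1)"
    by (subst det_upper_triangular[of _ N])
      (auto simp: flipm_def mat_diag_def upper_triangular_def prod_list_diag_prod intro!: prod.cong)
  then show ?thesis using N by simp
qed

lemma det_orthogonal: "A \<in> orthogonal_group N \<Longrightarrow> Determinant.det A = 1 \<or> Determinant.det A = - 1"
proof -
  assume "A \<in> orthogonal_group N"
  then have A: "A \<in> carrier_mat N N" "A * transpose_mat A = 1\<^sub>m N"
    by (auto simp: orthogonal_group_def)
  have "Determinant.det A * Determinant.det A = Determinant.det (A * transpose_mat A)"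
    using A(1) by (subst det_mult[of _ N]) (auto simp: det_transpose)
  then show ?thesis using A by (simp add: square_eq_1_iff)
qed

text \<open>A rotation is the square of the rotation by half the angle, so its determinant is the
  square of 1 or -1.\<close>

lemma det_rotm: "i < N \<Longrightarrow> j < N \<Longrightarrow> Determinant.det (rotm N i j t) = 1"
proof -
  assume ij: "i < N" "j < N"
  have "Determinant.det (rotm N i j t) = Determinant.det (rotm N i j (t / 2)) * Determinant.det (rotm N i j (t / 2))"
    using rotm_mult[OF ij, of "t / 2" "t / 2"] det_mult[of "rotm N i j (t / 2)" N "rotm N i j (t / 2)"] by simp
  also have "\<dots> = 1"
    using det_orthogonal[OF rotm_orthogonal[OF ij, of "t / 2"]] by auto
  finally show ?thesis .
qed

text \<open>Words in plane rotations. Skips make \<open>n\<close> an upper bound for the length, and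
  the bound on the angles makes the increment estimate uniform over all words of that
  length.\<close>

inductive rots :: "nat \<Rightarrow> nat \<Rightarrow> ((nat \<Rightarrow> nat \<Rightarrow> real) \<Rightarrow> nat \<Rightarrow> nat \<Rightarrow> real) \<Rightarrow> bool" for N where
  rots_id: "rots N 0 (\<lambda>X. X)"
| rots_skip: "rots N n T \<Longrightarrow> rots N (Suc n) T"
| rots_rot: "rots N n T \<Longrightarrow> i < N \<Longrightarrow> j < N \<Longrightarrow> \<bar>t\<bar> \<le> 2 * pi \<Longrightarrow> rots N (Suc n) (\<lambda>X. rot i j t (T X))"

lemma rots_comp: "rots N m S \<Longrightarrow> rots N n T \<Longrightarrow> rots N (m + n) (\<lambda>X. S (T X))"
  by (induction rule: rots.induct) (auto intro: rots.intros)

lemma rots_matrix: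
  assumes "rots N n T"
  shows "\<exists>H\<in>orthogonal_group N. Determinant.det H = 1 \<and> (\<forall>A\<in>carrier_mat N N. T (ent N A) = ent N (H * A))"
  using assms
proof induction
  case rots_id
  have "1\<^sub>m N \<in> orthogonal_group N" by (simp add: orthogonal_group_def)
  then show ?case by (intro bexI[of _ "1\<^sub>m N"]) auto
next
  case (rots_rot n T i j t)
  then obtain H where H: "H \<in> orthogonal_group N" "Determinant.det H = 1"
    "\<And>A. A \<in> carrier_mat N N \<Longrightarrow> T (ent N A) = ent N (H * A)" by auto
  have Hc: "H \<in> carrier_mat N N" using H(1) by (rule orthogonal_group_carrier)
  show ?case
  proof (intro bexI[of _ "rotm N i j t * H"] conjI ballI)
    show "rotm N i j t * H \<in> orthogonal_group N"
      using rots_rot H by (intro orthogonal_group_mult rotm_orthogonal)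
    show "Determinant.det (rotm N i j t * H) = 1"
      using rots_rot H Hc by (simp add: det_mult[of _ N] det_rotm)
    fix A :: "real mat" assume A: "A \<in> carrier_mat N N"
    have "rotm N i j t * H * A = rotm N i j t * (H * A)"
      using A Hc by (intro assoc_mult_mat[of _ N N _ N _ N]) auto
    then show "rot i j t (T (ent N A)) = ent N (rotm N i j t * H * A)"
      using A Hc H(3)[OF A] rots_rot by (simp add: ent_rotm)
  qed
qed auto

lemma rots_polf: "rots N n T \<Longrightarrow> polf f \<Longrightarrow> polf (\<lambda>X. f (T X))"
proof (induction arbitrary: f rule: rots.induct)
  case (rots_rot n T i j t)
  from rots_rot.IH[OF polf_rot[OF rots_rot.prems]] show ?case .
qed auto

lemma rots_orth_ents: "rots N n T \<Longrightarrow> X \<in> orth_ents N \<Longrightarrow> T X \<in> orth_ents N"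
  by (induction rule: rots.induct) (auto intro: orth_ents_rot)

lemma orth_ents_cols:
  assumes "X \<in> orth_ents N" "k < N" "l < N"
  shows "(\<Sum>p<N. X p k * X p l) = (if k = l then 1 else 0)"
proof -
  obtain A where "A \<in> orthogonal_group N" "X = ent N A" using assms by (auto simp: orth_ents_def)
  then show ?thesis using orthogonal_cols[of A N k l] assms by (simp add: ent_def)
qed

definition std_cols :: "nat \<Rightarrow> nat \<Rightarrow> (nat \<Rightarrow> nat \<Rightarrow> real) \<Rightarrow> bool" where
  "std_cols N k X \<longleftrightarrow> (\<forall>l<k. \<forall>r<N. X r l = (if r = l then 1 else 0))"

text \<open>Polar coordinates: the point \<open>(a, b)\<close> is turned onto the nonnegative half
  axis. The sign later forces diagonal entries to be 1 rather than -1.\<close>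

lemma rotation_angle:
  fixes a b :: real
  shows "\<exists>t. \<bar>t\<bar> \<le> 2 * pi \<and> cos t * b - sin t * a = 0 \<and> 0 \<le> cos t * a + sin t * b"
proof (cases "a = 0 \<and> b = 0")
  case True
  then show ?thesis by (intro exI[of _ 0]) auto
next
  case False
  define r where "r = sqrt (a\<^sup>2 + b\<^sup>2)"
  have r: "r > 0" "r\<^sup>2 = a\<^sup>2 + b\<^sup>2"
    using False by (auto simp: r_def sum_power2_gt_zero_iff)
  have "(a / r)\<^sup>2 + (b / r)\<^sup>2 = (a\<^sup>2 + b\<^sup>2) / r\<^sup>2"
    by (simp add: power_divide add_divide_distrib)
  also have "\<dots> = 1" using r by (metis divide_self less_irrefl power_not_zero)
  finally have "(a / r)\<^sup>2 + (b / r)\<^sup>2 = 1" .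
  then obtain t where t: "0 \<le> t" "t < 2 * pi" "a / r = cos t" "b / r = sin t"
    by (rule sincos_total_2pi)
  have ab: "a = r * cos t" "b = r * sin t"
    using r t by (auto simp: field_simps)
  have "cos t * a + sin t * b = r * ((cos t)\<^sup>2 + (sin t)\<^sup>2)"
    unfolding ab power2_eq_square by (simp only: distrib_left mult_ac)
  then have "0 \<le> cos t * a + sin t * b" using r by simp
  moreover have "cos t * b - sin t * a = 0" unfolding ab by simp
  ultimately show ?thesis using t by (intro exI[of _ t]) auto
qed

text \<open>Rows \<open>k + 1\<close> to \<open>k + m\<close> are rotated one by one against row
  \<open>k\<close>. The earlier columns survive because they vanish in row \<open>k\<close> and all
  rows below it. Without any rotation (\<open>m = 0\<close>) the sign of the diagonal entry is not
  controlled.\<close>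

lemma givens_column:
  assumes "std_cols N k X" "k + m < N"
  shows "\<exists>T. rots N m T \<and> std_cols N k (T X) \<and> (\<forall>r. k < r \<and> r \<le> k + m \<longrightarrow> T X r k = 0)
    \<and> (0 < m \<longrightarrow> 0 \<le> T X k k)"
  using assms
proof (induction m)
  case 0
  then show ?case by (intro exI[of _ "\<lambda>X. X"]) (auto intro: rots.intros)
next
  case (Suc m)
  then obtain T where T: "rots N m T" "std_cols N k (T X)"
    "\<And>r. k < r \<Longrightarrow> r \<le> k + m \<Longrightarrow> T X r k = 0" by auto
  define s where "s = k + Suc m"
  have s: "s < N" "k < s" "k < N" using Suc.prems by (auto simp: s_def)
  obtain t where t: "\<bar>t\<bar> \<le> 2 * pi" "cos t * T X s k - sin t * T X k k = 0"
    "0 \<le> cos t * T X k k + sin t * T X s k"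
    using rotation_angle by blast
  show ?case
  proof (intro exI[of _ "\<lambda>X. rot k s t (T X)"] conjI)
    show "rots N (Suc m) (\<lambda>X. rot k s t (T X))"
      using T s t by (intro rots.intros)
    show "std_cols N k (rot k s t (T X))"
      using T(2) s by (auto simp: std_cols_def rot_def)
    show "\<forall>r. k < r \<and> r \<le> k + Suc m \<longrightarrow> rot k s t (T X) r k = 0"
    proof (intro allI impI)
      fix r assume r: "k < r \<and> r \<le> k + Suc m"
      show "rot k s t (T X) r k = 0"
      proof (cases "r = s")
        case True
        then show ?thesis using t s by (simp add: rot_def)
      next
        case False
        then show ?thesis using T(3)[of r] r s by (simp add: rot_def s_def)
      qed
    qed
    show "0 < Suc m \<longrightarrow> 0 \<le> rot k s t (T X) k k"
      using t s by (simp add: rot_def)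
  qed
qed

text \<open>Orthogonality to the earlier columns, already standard vectors, kills the entries above
  the diagonal; unit length and the sign then give the diagonal entry 1. \<open>Suc k < N\<close>
  guarantees at least one rotation.\<close>

lemma givens_step:
  assumes X: "X \<in> orth_ents N" and std: "std_cols N k X" and k: "Suc k < N"
  shows "\<exists>T. rots N (N - 1 - k) T \<and> std_cols N (Suc k) (T X)"
proof -
  obtain T where T: "rots N (N - 1 - k) T" "std_cols N k (T X)"
    "\<And>r. k < r \<Longrightarrow> r \<le> k + (N - 1 - k) \<Longrightarrow> T X r k = 0" "0 \<le> T X k k"
    using givens_column[OF std, of "N - 1 - k"] k by auto
  define Y where "Y = T X"
  have Y: "Y \<in> orth_ents N" unfolding Y_def using T(1) X by (rule rots_orth_ents)
  have above: "Y r k = 0" if "r < k" for r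
  proof -
    have "0 = (\<Sum>p<N. Y p r * Y p k)"
      using orth_ents_cols[OF Y, of r k] that k by simp
    also have "\<dots> = (\<Sum>p<N. if p = r then Y p k else 0)"
      using T(2) that by (intro sum.cong) (auto simp: std_cols_def Y_def)
    finally show ?thesis using that k by simp
  qed
  have other: "Y r k = 0" if "r \<noteq> k" "r < N" for r
    using above[of r] T(3)[of r] that k by (cases "r < k") (auto simp: Y_def)
  have "1 = (\<Sum>p<N. Y p k * Y p k)"
    using orth_ents_cols[OF Y, of k k] k by simp
  also have "\<dots> = (\<Sum>p<N. if p = k then Y k k * Y k k else 0)"
    using other by (intro sum.cong) auto
  finally have "Y k k * Y k k = 1" using k by simp
  then have "Y k k = 1" using T(4) by (auto simp: Y_def square_eq_1_iff)
  then have "std_cols N (Suc k) Y"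
    using T(2) other by (auto simp: std_cols_def Y_def less_Suc_eq)
  then show ?thesis using T(1) by (auto simp: Y_def)
qed

lemma givens:
  assumes X: "X \<in> orth_ents N" and k: "k < N"
  shows "\<exists>T. rots N (k * N) T \<and> std_cols N k (T X)"
  using k
proof (induction k)
  case 0
  then show ?case by (intro exI[of _ "\<lambda>X. X"]) (auto intro: rots.intros simp: std_cols_def)
next
  case (Suc k)
  then obtain T where T: "rots N (k * N) T" "std_cols N k (T X)" by auto
  obtain S where S: "rots N (N - 1 - k) S" "std_cols N (Suc k) (S (T X))"
    using givens_step[OF rots_orth_ents[OF T(1) X] T(2) Suc.prems] by blast
  have skip: "rots N (m + n) R" if "rots N n R" for m n R
    using that by (induction m) (auto intro: rots.intros)
  \<comment> \<open>Pads the \<open>N - 1 - k\<close> rotations to \<open>N\<close> per column, for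
    a uniform count.\<close>
  have "N = Suc k + (N - 1 - k)" using Suc.prems by auto
  then have "rots N N S" using skip[OF S(1), of "Suc k"] by simp
  then have "rots N (N + k * N) (\<lambda>X. S (T X))" using T(1) by (rule rots_comp)
  then show ?case using S(2) by auto
qed

text \<open>The last column has no further row to be rotated against, so its sign survives.\<close>

lemma std_cols_orth:
  assumes X: "X \<in> orth_ents N" and std: "std_cols N (N - 1) X" and N: "0 < N"
  shows "X = ent N (1\<^sub>m N) \<or> X = ent N (flipm N)"
proof -
  define n where "n = N - 1"
  have n: "N = Suc n" using N by (simp add: n_def)
  have above: "X r n = 0" if "r < n" for r
  proof -
    have "0 = (\<Sum>p<N. X p r * X p n)"
      using orth_ents_cols[OF X, of r n] that n by simp
    also have "\<dots> = (\<Sum>p<N. if p = r then X p n else 0)"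
      using std that by (intro sum.cong) (auto simp: std_cols_def n)
    finally show ?thesis using that n by simp
  qed
  have "1 = (\<Sum>p<N. X p n * X p n)"
    using orth_ents_cols[OF X, of n n] n by simp
  also have "\<dots> = X n n * X n n"
    using above by (simp add: n)
  finally have pm: "X n n = 1 \<or> X n n = - 1" by (simp add: square_eq_1_iff)
  obtain A where A: "X = ent N A" using X by (auto simp: orth_ents_def)
  have *: "X k l = (if k < N \<and> l < N \<and> k = l then if l = n then X n n else 1 else 0)" for k l
  proof (cases "k < N \<and> l < N")
    case True
    then show ?thesis
      using above[of k] std n by (cases "l = n") (auto simp: std_cols_def less_Suc_eq)
  next
    case False
    then show ?thesis by (auto simp: A ent_def)
  qed
  have "X = ent N (1\<^sub>m N)" if "X n n = 1"
    by (intro ext, subst *) (auto simp: that ent_def)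
  moreover have "X = ent N (flipm N)" if "X n n = - 1"
    by (intro ext, subst *) (auto simp: that ent_def flipm_def mat_diag_def n)
  ultimately show ?thesis using pm by blast
qed

text \<open>Words of rotations preserve the determinant, which tells the two normal forms
  apart.\<close>

lemma special_orthogonal_rots:
  assumes g: "g \<in> orthogonal_group N" "Determinant.det g = 1" and N: "0 < N"
  shows "\<exists>T. rots N (N * N) T \<and> T (ent N g) = ent N (1\<^sub>m N)"
proof -
  have X: "ent N g \<in> orth_ents N" using g by (auto simp: orth_ents_def)
  obtain T where T: "rots N ((N - 1) * N) T" "std_cols N (N - 1) (T (ent N g))"
    using givens[OF X, of "N - 1"] N by auto
  obtain H where H: "H \<in> orthogonal_group N" "Determinant.det H = 1"
    "\<And>A. A \<in> carrier_mat N N \<Longrightarrow> T (ent N A) = ent N (H * A)"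
    using rots_matrix[OF T(1)] by auto
  have c: "g \<in> carrier_mat N N" "H \<in> carrier_mat N N"
    using g H by (auto intro: orthogonal_group_carrier)
  have "T (ent N g) \<noteq> ent N (flipm N)"
  proof
    assume "T (ent N g) = ent N (flipm N)"
    then have "H * g = flipm N"
      using H(3)[OF c(1)] c by (intro ent_inj[of _ N]) auto
    then have "Determinant.det (H * g) = - 1" using det_flipm[OF N] by simp
    then show False using c g H by (simp add: det_mult[of _ N])
  qed
  then have "T (ent N g) = ent N (1\<^sub>m N)"
    using std_cols_orth[OF rots_orth_ents[OF T(1) X] T(2) N] by auto
  moreover have "rots N (m + n) R" if "rots N n R" for m n R
    using that by (induction m) (auto intro: rots.intros)
  from this[OF T(1), of N] have "rots N (N * N) T"
    using N by (simp add: diff_mult_distrib)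
  ultimately show ?thesis by auto
qed

subsection \<open>The Poincare inequality\<close>

context haar
begin

text \<open>The angle is cut into \<open>n\<close> equal pieces. By invariance all pieces have the
  same mean square, and Cauchy-Schwarz gives the factor \<open>n^2\<close> for their sum. Taylor's
  formula controls one piece, and the remainder disappears as \<open>n\<close> tends to
  infinity.\<close>

lemma mean_rot_increment:
  assumes f: "polf f" and ij: "i < N" "j < N"
  shows "mean (\<lambda>X. (f (rot i j t X) - f X)\<^sup>2) \<le> t\<^sup>2 * mean (\<lambda>X. (D i j f X)\<^sup>2)"
proof -
  define \<phi> where "\<phi> s = mean (\<lambda>X. (f (rot i j s X) - f X)\<^sup>2)" for s
  define E where "E = mean (\<lambda>X. (D i j f X)\<^sup>2)"
  have scale: "\<phi> (real n * s) \<le> (real n)\<^sup>2 * \<phi> s" for n s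
  proof -
    let ?g = "\<lambda>k X. f (rot i j (real k * s) X)"
    have "\<phi> (real n * s) = mean (\<lambda>X. (\<Sum>k<n. ?g (Suc k) X - ?g k X)\<^sup>2)"
      unfolding \<phi>_def by (subst sum_lessThan_telescope) simp
    also have "\<dots> \<le> mean (\<lambda>X. real n * (\<Sum>k<n. (?g (Suc k) X - ?g k X)\<^sup>2))"
    proof (rule mean_mono)
      fix X
      show "(\<Sum>k<n. ?g (Suc k) X - ?g k X)\<^sup>2 \<le> real n * (\<Sum>k<n. (?g (Suc k) X - ?g k X)\<^sup>2)"
        using sum_squared_le_sum_of_squares[of "\<lambda>k. ?g (Suc k) X - ?g k X" "{..<n}"]
        by (simp add: mult.commute)
    qed (use f in auto)
    also have "\<dots> = real n * (\<Sum>k<n. mean (\<lambda>X. (?g (Suc k) X - ?g k X)\<^sup>2))"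
      using f by (subst mean_cmult, subst mean_sum) auto
    also have "\<dots> = real n * (\<Sum>k<n. \<phi> s)"
    proof (intro arg_cong[of _ _ "\<lambda>x. real n * x"] sum.cong refl)
      fix k
      have "mean (\<lambda>X. (?g (Suc k) X - ?g k X)\<^sup>2)
          = mean (\<lambda>X. (f (rot i j s (rot i j (real k * s) X)) - f (rot i j (real k * s) X))\<^sup>2)"
        by (simp add: rot_add algebra_simps)
      also have "\<dots> = \<phi> s"
        unfolding \<phi>_def using f ij
        by (intro mean_rot[of "\<lambda>Y. (f (rot i j s Y) - f Y)\<^sup>2"]) auto
      finally show "mean (\<lambda>X. (?g (Suc k) X - ?g k X)\<^sup>2) = \<phi> s" .
    qed
    finally show ?thesis by (simp add: power2_eq_square)
  qed
  obtain C where C: "C \<ge> 0"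
    "\<And>X s. X \<in> orth_ents N \<Longrightarrow> \<bar>f (rot i j s X) - f X - s * D i j f X\<bar> \<le> C * s\<^sup>2"
    using polf_taylor[OF f ij] by blast
  obtain B where B: "B \<ge> 0" "\<And>X. X \<in> orth_ents N \<Longrightarrow> \<bar>D i j f X\<bar> \<le> B"
    using polf_bound_orth[OF polf_D[OF f], of N i j] by auto
  have small: "\<phi> s \<le> s\<^sup>2 * E + (2 * B * C * \<bar>s\<bar> ^ 3 + C\<^sup>2 * s ^ 4)" for s
  proof -
    have "\<phi> s \<le> mean (\<lambda>X. s\<^sup>2 * (D i j f X)\<^sup>2 + (2 * B * C * \<bar>s\<bar> ^ 3 + C\<^sup>2 * s ^ 4))"
      unfolding \<phi>_def
    proof (rule mean_mono)
      fix X assume X: "X \<in> orth_ents N"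
      let ?d = "D i j f X"
      have "\<bar>f (rot i j s X) - f X\<bar> \<le> \<bar>s\<bar> * \<bar>?d\<bar> + C * s\<^sup>2"
        using C(2)[OF X, of s] abs_mult[of s ?d] by linarith
      then have "(f (rot i j s X) - f X)\<^sup>2 \<le> (\<bar>s\<bar> * \<bar>?d\<bar> + C * s\<^sup>2)\<^sup>2"
        by (metis abs_ge_zero power2_abs power_mono)
      also have "\<dots> = s\<^sup>2 * ?d\<^sup>2 + 2 * \<bar>?d\<bar> * (C * \<bar>s\<bar> ^ 3) + C\<^sup>2 * s ^ 4"
        by (simp add: power2_sum power_mult_distrib power2_eq_square power3_eq_cube power4_eq_xxxx abs_mult_self_eq algebra_simps)
      also have "\<dots> \<le> s\<^sup>2 * ?d\<^sup>2 + 2 * B * (C * \<bar>s\<bar> ^ 3) + C\<^sup>2 * s ^ 4"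
        using B(2)[OF X] C(1) by (intro add_mono mult_right_mono) auto
      finally show "(f (rot i j s X) - f X)\<^sup>2 \<le> s\<^sup>2 * ?d\<^sup>2 + (2 * B * C * \<bar>s\<bar> ^ 3 + C\<^sup>2 * s ^ 4)"
        by (simp add: mult.assoc)
    qed (use f in auto)
    also have "\<dots> = s\<^sup>2 * E + (2 * B * C * \<bar>s\<bar> ^ 3 + C\<^sup>2 * s ^ 4)"
      unfolding E_def using f by (subst mean_add) (auto simp: mean_cmult)
    finally show ?thesis .
  qed
  \<comment> \<open>The cubic and quartic Taylor terms at \<open>t / n\<close>, multiplied by
    \<open>n^2\<close>, are at most \<open>K / n\<close>.\<close>
  define K where "K = 2 * B * C * \<bar>t\<bar> ^ 3 + C\<^sup>2 * t ^ 4"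
  have bound: "\<phi> t \<le> t\<^sup>2 * E + K / real n" if n: "n \<ge> 1" for n
  proof -
    have n0: "real n > 0" using n by simp
    have "\<phi> t \<le> (real n)\<^sup>2 * \<phi> (t / real n)"
      using scale[of n "t / real n"] n0 by simp
    also have "\<dots> \<le> (real n)\<^sup>2 * ((t / real n)\<^sup>2 * E + (2 * B * C * \<bar>t / real n\<bar> ^ 3 + C\<^sup>2 * (t / real n) ^ 4))"
      by (rule mult_left_mono[OF small]) simp
    also have "\<dots> = t\<^sup>2 * E + (2 * B * C * \<bar>t\<bar> ^ 3 / real n + C\<^sup>2 * t ^ 4 / (real n)\<^sup>2)"
      using n0 by (simp add: power_divide abs_divide field_simps power2_eq_square power3_eq_cube power4_eq_xxxx)
    also have "C\<^sup>2 * t ^ 4 / (real n)\<^sup>2 \<le> C\<^sup>2 * t ^ 4 / real n"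
      using n by (intro divide_left_mono) (auto simp: power2_eq_square)
    finally show ?thesis by (simp add: K_def add_divide_distrib)
  qed
  have "(\<lambda>n. t\<^sup>2 * E + K / real n) \<longlonglongrightarrow> t\<^sup>2 * E + 0"
    by (intro tendsto_add tendsto_const lim_const_over_n)
  then have "\<phi> t \<le> t\<^sup>2 * E + 0"
    by (rule LIMSEQ_le_const) (use bound in blast)
  then show ?thesis by (simp add: \<phi>_def E_def)
qed

lemma mean_sq_D_le_dir:
  assumes "i < N" "j < N"
  shows "mean (\<lambda>X. (D i j f X)\<^sup>2) \<le> dir f f"
proof -
  have nn: "0 \<le> mean (\<lambda>X. D k l f X * D k l f X)" for k l
    by (rule mean_nonneg) auto
  have "mean (\<lambda>X. D i j f X * D i j f X) \<le> (\<Sum>l<N. mean (\<lambda>X. D i l f X * D i l f X))"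
    using assms by (intro member_le_sum[of j _ "\<lambda>l. mean (\<lambda>X. D i l f X * D i l f X)"] nn) auto
  also have "\<dots> \<le> dir f f"
    unfolding dir_def using assms
    by (intro member_le_sum[of i _ "\<lambda>k. \<Sum>l<N. mean (\<lambda>X. D k l f X * D k l f X)"] sum_nonneg nn) auto
  finally show ?thesis by (simp add: power2_eq_square)
qed

lemma mean_rots:
  "rots N n T \<Longrightarrow> polf f \<Longrightarrow> mean (\<lambda>X. f (T X)) = mean f"
proof (induction arbitrary: f rule: rots.induct)
  case (rots_rot n T i j t)
  from rots_rot.IH[OF polf_rot[OF rots_rot.prems, of i j t]] mean_rot[OF rots_rot.prems rots_rot.hyps(2,3), of t]
  show ?case by (rule trans)
qed auto

text \<open>The bound (x + y)^2 \<le> 2 x^2 + 2 y^2 is spent once per rotation, and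
  \<open>2 + 2 * 4^n \<le> 4^(n + 1)\<close> closes the induction. The exponential constant is
  harmless, since the iteration in \<open>poincare_pol\<close> forgets it.\<close>

lemma mean_rots_increment:
  assumes "rots N n T" "polf f"
  shows "mean (\<lambda>X. (f (T X) - f X)\<^sup>2) \<le> 4 ^ n * (2 * pi)\<^sup>2 * dir f f"
  using assms
proof (induction rule: rots.induct)
  case rots_id
  then show ?case using dir_nonneg by simp
next
  case (rots_skip n T)
  have "4 ^ n * (2 * pi)\<^sup>2 * dir f f \<le> 4 ^ Suc n * (2 * pi)\<^sup>2 * dir f f"
    using dir_nonneg by (intro mult_right_mono) auto
  with rots_skip show ?case by linarith
next
  case (rots_rot n T i j t)
  let ?d = "dir f f"
  have fT: "polf (\<lambda>X. f (T X))" "polf (\<lambda>X. f (rot i j t (T X)))"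
    using rots_polf[OF rots_rot.hyps(1)] rots_polf[OF rots_rot.hyps(1), of "\<lambda>X. f (rot i j t X)"] rots_rot.prems
    by auto
  have "mean (\<lambda>X. (f (rot i j t (T X)) - f X)\<^sup>2)
      \<le> mean (\<lambda>X. 2 * (f (rot i j t (T X)) - f (T X))\<^sup>2 + 2 * (f (T X) - f X)\<^sup>2)"
  proof (rule mean_mono)
    fix X
    show "(f (rot i j t (T X)) - f X)\<^sup>2 \<le> 2 * (f (rot i j t (T X)) - f (T X))\<^sup>2 + 2 * (f (T X) - f X)\<^sup>2"
      using zero_le_power2[of "f (rot i j t (T X)) - f (T X) - (f (T X) - f X)"]
      by (simp add: power2_eq_square algebra_simps)
  qed (use fT rots_rot.prems in auto)
  also have "\<dots> = 2 * mean (\<lambda>X. (f (rot i j t (T X)) - f (T X))\<^sup>2) + 2 * mean (\<lambda>X. (f (T X) - f X)\<^sup>2)"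
    using fT rots_rot.prems by (subst mean_add) (auto simp: mean_cmult)
  also have "mean (\<lambda>X. (f (rot i j t (T X)) - f (T X))\<^sup>2) = mean (\<lambda>X. (f (rot i j t X) - f X)\<^sup>2)"
    using rots_rot.prems by (intro mean_rots[OF rots_rot.hyps(1), of "\<lambda>X. (f (rot i j t X) - f X)\<^sup>2"]) auto
  also have "\<dots> \<le> t\<^sup>2 * mean (\<lambda>X. (D i j f X)\<^sup>2)"
    using rots_rot by (intro mean_rot_increment)
  also have "\<dots> \<le> (2 * pi)\<^sup>2 * ?d"
  proof (intro mult_mono mean_sq_D_le_dir mean_nonneg)
    show "t\<^sup>2 \<le> (2 * pi)\<^sup>2"
      using rots_rot.hyps(4) by (metis abs_ge_zero power2_abs power_mono)
  qed (use rots_rot in auto)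
  also have "mean (\<lambda>X. (f (T X) - f X)\<^sup>2) \<le> 4 ^ n * (2 * pi)\<^sup>2 * ?d"
    using rots_rot by auto
  also have "2 * ((2 * pi)\<^sup>2 * ?d) + 2 * (4 ^ n * (2 * pi)\<^sup>2 * ?d) = (2 + 2 * 4 ^ n) * ((2 * pi)\<^sup>2 * ?d)"
    by (simp add: algebra_simps)
  also have "\<dots> \<le> 4 ^ Suc n * ((2 * pi)\<^sup>2 * ?d)"
    using dir_nonneg by (intro mult_right_mono) auto
  finally show ?case by (simp add: mult.assoc)
qed

lemma integrable_bounded:
  assumes "f \<in> borel_measurable (orth_borel N)" "\<And>x. x \<in> orthogonal_group N \<Longrightarrow> \<bar>f x\<bar> \<le> (B :: real)"
  shows "integrable \<mu> f"
  using assms by (intro integrable_const_bound[of _ B] AE_I2) auto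

text \<open>The word \<open>T\<close> reduces \<open>g\<close> to the identity, so it is left
  multiplication by the inverse \<open>H\<close> of \<open>g\<close>. Substituting
  \<open>g * x\<close> for \<open>x\<close> turns increments along \<open>H\<close> into increments
  along \<open>g\<close>.\<close>

lemma special_increment:
  assumes f: "polf f" and g: "g \<in> orthogonal_group N" "Determinant.det g = 1" and N: "0 < N"
  shows "(\<integral>x. (f (ent N (g * x)) - f (ent N x))\<^sup>2 \<partial>\<mu>) \<le> 4 ^ (N * N) * (2 * pi)\<^sup>2 * dir f f"
proof -
  obtain T where T: "rots N (N * N) T" "T (ent N g) = ent N (1\<^sub>m N)"
    using special_orthogonal_rots[OF g N] by auto
  obtain H where H: "H \<in> orthogonal_group N"
    "\<And>A. A \<in> carrier_mat N N \<Longrightarrow> T (ent N A) = ent N (H * A)"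
    using rots_matrix[OF T(1)] by auto
  have c: "g \<in> carrier_mat N N" "H \<in> carrier_mat N N"
    using g H by (auto intro: orthogonal_group_carrier)
  have Hg: "H * g = 1\<^sub>m N"
    using T(2) H(2)[OF c(1)] c by (intro ent_inj[of _ N]) auto
  let ?F = "\<lambda>x. (f (ent N (H * x)) - f (ent N x))\<^sup>2"
  have m: "?F \<in> borel_measurable (orth_borel N)"
    using measurable_compose[OF measurable_left_mult[OF H(1)] measurable_polf[OF f]] measurable_polf[OF f]
    by auto
  have "(\<integral>x. (f (ent N (g * x)) - f (ent N x))\<^sup>2 \<partial>\<mu>) = (\<integral>x. ?F (g * x) \<partial>\<mu>)"
  proof (rule Bochner_Integration.integral_cong[OF refl])
    fix x assume "x \<in> space \<mu>"
    then have x: "x \<in> carrier_mat N N" by (auto intro: orthogonal_group_carrier)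
    have "H * (g * x) = H * g * x" using c x by (intro assoc_mult_mat[symmetric, of _ N N _ N _ N])
    also have "\<dots> = x" using x Hg by simp
    finally show "(f (ent N (g * x)) - f (ent N x))\<^sup>2 = ?F (g * x)"
      by (simp add: power2_commute)
  qed
  also have "\<dots> = (\<integral>x. ?F x \<partial>\<mu>)"
    by (rule integral_left_mult[OF g(1) m])
  also have "\<dots> = mean (\<lambda>X. (f (T X) - f X)\<^sup>2)"
    unfolding mean_def
  proof (rule Bochner_Integration.integral_cong[OF refl])
    fix x assume "x \<in> space \<mu>"
    then have "x \<in> carrier_mat N N" by (auto intro: orthogonal_group_carrier)
    then show "?F x = (f (T (ent N x)) - f (ent N x))\<^sup>2" by (simp add: H(2))
  qed
  also have "\<dots> \<le> 4 ^ (N * N) * (2 * pi)\<^sup>2 * dir f f"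
    by (rule mean_rots_increment[OF T(1) f])
  finally show ?thesis .
qed

lemma measurable_det [measurable]: "Determinant.det \<in> borel_measurable (orth_borel N)"
proof -
  have "(\<lambda>A. \<Sum>p\<in>{p. p permutes {0..<N}}. signof p * (\<Prod>i\<in>{0..<N}. ent N A i (p i))) \<in> borel_measurable (orth_borel N)"
    by measurable
  then show ?thesis
  proof (rule measurable_cong[THEN iffD1, rotated])
    fix A assume "A \<in> space (orth_borel N)"
    then have A: "A \<in> carrier_mat N N" by (auto intro: orthogonal_group_carrier)
    show "(\<Sum>p\<in>{p. p permutes {0..<N}}. signof p * (\<Prod>i\<in>{0..<N}. ent N A i (p i))) = Determinant.det A"
      unfolding det_def'[OF A]
    proof (intro sum.cong refl arg_cong2[of _ _ _ _ "(*)"] prod.cong)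
      fix p i assume "p \<in> {p. p permutes {0..<N}}" "i \<in> {0..<N}"
      then have "p i < N" using permutes_in_image[of p "{0..<N}" i] by auto
      then show "ent N A i (p i) = A $$ (i, p i)" using \<open>i \<in> {0..<N}\<close> by (auto simp: ent_def)
    qed
  qed
qed

text \<open>A bound with a dimension-dependent constant. The weight \<open>1 + det (y x\<^sup>T)\<close> restricts the
  comparison of two points \<open>x\<close> and \<open>y\<close> to the same component of \<open>O(N)\<close>; the flip invariance of
  \<open>f\<close> makes the \<open>det\<close> part of the weight integrate to zero.\<close>

lemma crude_poincare:
  assumes f: "polf f" and flip: "\<And>X. f (colflip N X) = f X" and mean0: "mean f = 0" and N: "0 < N"
  shows "mean (\<lambda>X. (f X)\<^sup>2) \<le> 4 ^ (N * N) * (2 * pi)\<^sup>2 * dir f f"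
proof -
  define c where "c = 4 ^ (N * N) * (2 * pi)\<^sup>2 * dir f f"
  define F where "F x = f (ent N x)" for x
  have Fm [measurable]: "F \<in> borel_measurable (orth_borel N)"
    unfolding F_def using measurable_polf[OF f] by simp
  obtain B where B: "\<And>x. x \<in> orthogonal_group N \<Longrightarrow> \<bar>F x\<bar> \<le> B" "B \<ge> 0"
    using polf_bound_orth[OF f, of N] by (auto simp: F_def)
  let ?d = "Determinant.det :: real mat \<Rightarrow> real"
  have dle: "\<bar>?d x\<bar> \<le> 1" if "x \<in> orthogonal_group N" for x
    using det_orthogonal[OF that] by auto
  \<comment> \<open>The weight is 2 for determinant 1 and 0 for determinant -1, where no comparison
    by rotations is possible.\<close>
  define W where "W g x = (1 + ?d g) * (F (g * x) - F x)\<^sup>2" for g x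
  have Wb: "\<bar>W g x\<bar> \<le> 2 * (2 * B)\<^sup>2" if "g \<in> orthogonal_group N" "x \<in> orthogonal_group N" for g x
  proof -
    have "\<bar>F (g * x) - F x\<bar> \<le> 2 * B"
      using B(1)[OF that(2)] B(1)[OF orthogonal_group_mult[OF that]] by linarith
    then have "(F (g * x) - F x)\<^sup>2 \<le> (2 * B)\<^sup>2"
      by (metis abs_ge_zero power2_abs power_mono)
    moreover have "\<bar>1 + ?d g\<bar> \<le> 2" using dle[OF that(1)] by linarith
    ultimately show ?thesis
      unfolding W_def abs_mult by (intro mult_mono) auto
  qed
  interpret P: pair_prob_space \<mu> \<mu> ..
  note [measurable] = measurable_orth_mult
  have Wm [measurable]: "(\<lambda>(g, x). W g x) \<in> borel_measurable (orth_borel N \<Otimes>\<^sub>M orth_borel N)"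
    unfolding W_def split_beta by measurable
  have Wint: "integrable (\<mu> \<Otimes>\<^sub>M \<mu>) (\<lambda>(g, x). W g x)"
    by (rule P.P.integrable_const_bound[of _ "2 * (2 * B)\<^sup>2"])
      (use Wb in \<open>auto simp: space_pair_measure\<close>)
  have upper: "(\<integral>g. (\<integral>x. W g x \<partial>\<mu>) \<partial>\<mu>) \<le> 2 * c"
  proof -
    have "(\<integral>x. W g x \<partial>\<mu>) \<le> 2 * c" if g: "g \<in> orthogonal_group N" for g
    proof (cases "?d g = 1")
      case True
      then show ?thesis
        using special_increment[OF f g _ N] by (simp add: W_def F_def c_def mult_ac)
    next
      case False
      then have "?d g = - 1" using det_orthogonal[OF g] by auto
      then show ?thesis using dir_nonneg[of f] by (simp add: W_def c_def)
    qed
    moreover have "integrable \<mu> (\<lambda>g. (\<integral>x. W g x \<partial>\<mu>))"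
      using P.integrable_fst'[OF Wint] by simp
    ultimately have "(\<integral>g. (\<integral>x. W g x \<partial>\<mu>) \<partial>\<mu>) \<le> (\<integral>g. 2 * c \<partial>\<mu>)"
      by (intro integral_mono) auto
    then show ?thesis using prob_space by simp
  qed
  have inner: "(\<integral>g. W g x \<partial>\<mu>) = (\<integral>y. (F y)\<^sup>2 \<partial>\<mu>) + (F x)\<^sup>2" if x: "x \<in> orthogonal_group N" for x
  proof -
    have xc: "x \<in> carrier_mat N N" using x by (rule orthogonal_group_carrier)
    \<comment> \<open>The integrand after the substitution \<open>y = g * x\<close>; here
      \<open>det g = det y * det x\<close>, because \<open>det x\<close> is 1 or -1.\<close>
    define V where "V y = (1 + ?d y * ?d x) * (F y - F x)\<^sup>2" for y
    have Vm: "V \<in> borel_measurable (orth_borel N)"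
      unfolding V_def by measurable
    have "(\<integral>g. W g x \<partial>\<mu>) = (\<integral>g. V (g * x) \<partial>\<mu>)"
    proof (rule Bochner_Integration.integral_cong[OF refl])
      fix g assume "g \<in> space \<mu>"
      then have "g \<in> carrier_mat N N" by (auto intro: orthogonal_group_carrier)
      then show "W g x = V (g * x)"
        using det_orthogonal[OF x] xc by (auto simp: W_def V_def det_mult[of _ N])
    qed
    also have "\<dots> = (\<integral>y. V y \<partial>\<mu>)"
      by (rule integral_right_mult[OF x Vm])
    also have "\<dots> = (\<integral>y. (F y - F x)\<^sup>2 + ?d x * (?d y * (F y - F x)\<^sup>2) \<partial>\<mu>)"
      by (rule Bochner_Integration.integral_cong) (auto simp: V_def algebra_simps)
    also have "\<dots> = (\<integral>y. (F y - F x)\<^sup>2 \<partial>\<mu>) + ?d x * (\<integral>y. ?d y * (F y - F x)\<^sup>2 \<partial>\<mu>)"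
    proof -
      have b: "\<bar>(F y - F x)\<^sup>2\<bar> \<le> (2 * B)\<^sup>2" if "y \<in> orthogonal_group N" for y
      proof -
        have "\<bar>F y - F x\<bar> \<le> 2 * B" using B(1)[OF that] B(1)[OF x] by linarith
        then have "\<bar>F y - F x\<bar>\<^sup>2 \<le> (2 * B)\<^sup>2" by (rule power_mono) simp
        then show ?thesis by simp
      qed
      have i1: "integrable \<mu> (\<lambda>y. (F y - F x)\<^sup>2)"
        by (rule integrable_bounded[OF _ b]) auto
      have i2: "integrable \<mu> (\<lambda>y. ?d y * (F y - F x)\<^sup>2)"
      proof (rule integrable_bounded)
        fix y assume y: "y \<in> orthogonal_group N"
        show "\<bar>?d y * (F y - F x)\<^sup>2\<bar> \<le> (2 * B)\<^sup>2"
          using b[OF y] det_orthogonal[OF y] by (auto simp: abs_mult)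
      qed auto
      show ?thesis using i1 i2 by simp
    qed
    also have "(\<integral>y. ?d y * (F y - F x)\<^sup>2 \<partial>\<mu>) = 0"
    proof -
      let ?G = "\<lambda>y. ?d y * (F y - F x)\<^sup>2"
      have "(\<integral>y. ?G y \<partial>\<mu>) = (\<integral>y. ?G (y * flipm N) \<partial>\<mu>)"
        by (rule integral_right_mult[symmetric, OF flipm_orthogonal]) auto
      also have "\<dots> = (\<integral>y. - ?G y \<partial>\<mu>)"
      proof (rule Bochner_Integration.integral_cong[OF refl])
        fix y assume "y \<in> space \<mu>"
        then have y: "y \<in> carrier_mat N N" by (auto intro: orthogonal_group_carrier)
        then show "?G (y * flipm N) = - ?G y"
          using det_flipm[OF N] by (simp add: F_def ent_flipm flip det_mult[of _ N])
      qed
      finally show ?thesis by simp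
    qed
    also have "(\<integral>y. (F y - F x)\<^sup>2 \<partial>\<mu>) = mean (\<lambda>X. (f X)\<^sup>2 - (2 * F x) * f X + (F x)\<^sup>2)"
      unfolding mean_def by (rule Bochner_Integration.integral_cong) (auto simp: F_def power2_eq_square algebra_simps)
    also have "\<dots> = mean (\<lambda>X. (f X)\<^sup>2) - (2 * F x) * mean f + (F x)\<^sup>2"
      using f by (simp only: mean_add mean_diff mean_cmult mean_const polf_power polf_mult polf_const polf_diff)
    also have "\<dots> = (\<integral>y. (F y)\<^sup>2 \<partial>\<mu>) + (F x)\<^sup>2"
      using mean0 by (simp add: mean_def F_def)
    finally show ?thesis by simp
  qed
  have F2: "integrable \<mu> (\<lambda>x. (F x)\<^sup>2)"
    unfolding F_def by (rule integrable_polf[of "\<lambda>X. (f X)\<^sup>2"]) (use f in auto)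
  have "(\<integral>x. (\<integral>g. W g x \<partial>\<mu>) \<partial>\<mu>) = (\<integral>x. (\<integral>y. (F y)\<^sup>2 \<partial>\<mu>) + (F x)\<^sup>2 \<partial>\<mu>)"
    by (rule Bochner_Integration.integral_cong) (auto simp: inner)
  also have "\<dots> = 2 * mean (\<lambda>X. (f X)\<^sup>2)"
    using F2 prob_space by (simp add: mean_def F_def)
  finally have "2 * mean (\<lambda>X. (f X)\<^sup>2) = (\<integral>x. (\<integral>g. W g x \<partial>\<mu>) \<partial>\<mu>)" ..
  also have "\<dots> = (\<integral>g. (\<integral>x. W g x \<partial>\<mu>) \<partial>\<mu>)"
    using P.Fubini_integral[OF Wint] .
  also note upper
  finally show ?thesis by (simp add: c_def mult_ac)
qed

section \<open>Improving the constant by a discrete heat flow\<close>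

lemma D_colflip:
  assumes "\<And>X. f (colflip N X) = f X"
  shows "D i j f (colflip N X) = D i j f X"
proof -
  have "rot i j t (colflip N X) = colflip N (rot i j t X)" for t
    by (auto simp: rot_def colflip_def fun_eq_iff)
  then show ?thesis by (simp add: D_def assms)
qed

text \<open>A step \<open>f - \<epsilon> * lap f\<close> lowers the second moment by at most
  \<open>2 * \<epsilon> * dir f f\<close> and contracts the energy by
  \<open>1 - \<epsilon> * \<rho>\<close>. So a constant \<open>c\<close> valid after the step yields
  \<open>c * (1 - \<epsilon> * \<rho>) + 2 * \<epsilon>\<close> before it. The fixed point of this
  affine contraction is \<open>2 / \<rho> = 8 / (N - 2)\<close>, whatever the starting
  constant.\<close>

lemma poincare_pol:
  assumes N: "3 \<le> N" and f: "pol m C f" and flip: "\<And>X. f (colflip N X) = f X" and mean0: "mean f = 0"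
  shows "mean (\<lambda>X. (f X)\<^sup>2) \<le> 8 / (real N - 2) * dir f f"
proof -
  define \<rho> where "\<rho> = (real N - 2) / 4"
  have \<rho>: "\<rho> > 0" using N by (simp add: \<rho>_def)
  \<comment> \<open>The degree is fixed while the coefficient bound \<open>C\<close> may grow from
    step to step, so a single \<open>\<epsilon>\<close> serves the whole iteration.\<close>
  define V where "V = {f. (\<exists>C. pol m C f) \<and> (\<forall>X. f (colflip N X) = f X) \<and> mean f = 0}"
  define K where "K = (2 * real N * real m)\<^sup>2"
  \<comment> \<open>Gives \<open>\<epsilon> * K \<le> 1\<close>, for stability of the step, and
    \<open>\<epsilon> * \<rho> < 1\<close>, for a positive contraction factor.\<close>
  define \<epsilon> where "\<epsilon> = 1 / (K + \<rho> + 1)"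
  have K: "K \<ge> 0" by (simp add: K_def)
  have \<epsilon>: "\<epsilon> > 0" "\<epsilon> * K \<le> 1" "\<epsilon> * \<rho> < 1"
    using K \<rho> by (auto simp: \<epsilon>_def field_simps)
  \<comment> \<open>The explicit solution of the recursion \<open>step\<close>, started above the
    crude constant.\<close>
  define c where "c n = 2 / \<rho> + (1 - \<epsilon> * \<rho>) ^ n * (4 ^ (N * N) * (2 * pi)\<^sup>2)" for n
  have c0: "c n \<ge> 0" for n using \<rho> \<epsilon> by (simp add: c_def)
  have step: "c (Suc n) = c n * (1 - \<epsilon> * \<rho>) + 2 * \<epsilon>" for n
    using \<rho> by (simp add: c_def field_simps)
  have valid: "\<forall>f\<in>V. mean (\<lambda>X. (f X)\<^sup>2) \<le> c n * dir f f" for n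
  proof (induction n)
    case 0
    show ?case
    proof
      fix f assume "f \<in> V"
      then have "mean (\<lambda>X. (f X)\<^sup>2) \<le> 4 ^ (N * N) * (2 * pi)\<^sup>2 * dir f f"
        using N by (intro crude_poincare) (auto simp: V_def polf_def)
      also have "\<dots> \<le> c 0 * dir f f"
        using \<rho> dir_nonneg by (intro mult_right_mono) (auto simp: c_def)
      finally show "mean (\<lambda>X. (f X)\<^sup>2) \<le> c 0 * dir f f" .
    qed
  next
    case (Suc n)
    show ?case
    proof
      fix f assume fV: "f \<in> V"
      then obtain C where fC: "pol m C f" by (auto simp: V_def)
      then have pf: "polf f" by (auto simp: polf_def)
      let ?b = "mean (\<lambda>X. (lap f X)\<^sup>2)" and ?h = "\<lambda>X. f X - \<epsilon> * lap f X"
      have b0: "0 \<le> ?b" by (rule mean_nonneg) auto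
      have bd: "mean (\<lambda>X. lap f X * f X) = dir f f" "dir f (lap f) = ?b"
        using mean_lap[OF pf pf] mean_lap[OF pf polf_lap[OF pf]] by (auto simp: power2_eq_square)
      have hV: "?h \<in> V"
        unfolding V_def
      proof (intro CollectI conjI allI)
        have "pol m (C + \<bar>- \<epsilon>\<bar> * (K * C)) (\<lambda>X. f X + (- \<epsilon>) * lap f X)"
          using pol_lap[OF fC] by (intro pol_add fC pol_cmult) (simp add: K_def)
        then show "\<exists>C. pol m C ?h" by auto
        have "mean (lap f) = 0"
          unfolding lap_eq using pf by (subst mean_minus, subst mean_sum) (auto simp: mean_sum mean_D)
        then show "mean ?h = 0"
          using fV pf by (subst mean_diff) (auto simp: mean_cmult V_def)
        fix X
        have fl: "\<And>X. f (colflip N X) = f X" using fV by (auto simp: V_def)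
        \<comment> \<open>The flip acts on columns and the rotations on rows, so invariance passes
          to derivatives and \<open>V\<close> is stable under the iteration.\<close>
        have "D i j f (colflip N X) = D i j f X" for i j X by (rule D_colflip) (rule fl)
        then have fl2: "D i j (D i j f) (colflip N X) = D i j (D i j f) X" for i j X by (rule D_colflip)
        show "f (colflip N X) - \<epsilon> * lap f (colflip N X) = f X - \<epsilon> * lap f X"
          by (simp add: lap_def fl fl2)
      qed
      have "mean (\<lambda>X. (?h X)\<^sup>2) = mean (\<lambda>X. (f X)\<^sup>2 - (2 * \<epsilon>) * (lap f X * f X) + \<epsilon>\<^sup>2 * (lap f X)\<^sup>2)"
        by (simp add: power2_eq_square algebra_simps)
      also have "\<dots> = mean (\<lambda>X. (f X)\<^sup>2) - (2 * \<epsilon>) * dir f f + \<epsilon>\<^sup>2 * ?b"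
        using pf by (simp only: mean_add mean_diff mean_cmult polf_power polf_mult polf_const polf_diff polf_lap bd)
      finally have h2: "mean (\<lambda>X. (f X)\<^sup>2) = mean (\<lambda>X. (?h X)\<^sup>2) + 2 * \<epsilon> * dir f f - \<epsilon>\<^sup>2 * ?b"
        by simp
      have "dir ?h ?h = dir f f - 2 * \<epsilon> * ?b + \<epsilon>\<^sup>2 * dir (lap f) (lap f)"
        using dir_diff[OF pf polf_lap[OF pf]] bd by simp
      \<comment> \<open>Half of the first-order gain \<open>2 * \<epsilon> * ?b\<close> pays for
        this term; hence the limit \<open>2 / \<rho>\<close> instead of
        \<open>1 / \<rho>\<close>.\<close>
      also have "\<epsilon>\<^sup>2 * dir (lap f) (lap f) \<le> \<epsilon> * ((\<epsilon> * K) * ?b)"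
        using lap_dirichlet_bounds(2)[OF fC] \<epsilon>(1) by (simp add: power2_eq_square K_def mult.assoc)
      also have "\<dots> \<le> \<epsilon> * (1 * ?b)"
        using \<epsilon> b0 by (intro mult_left_mono mult_right_mono) auto
      finally have dh: "dir ?h ?h \<le> dir f f - \<epsilon> * ?b" by simp
      have "\<rho> * dir f f \<le> ?b"
        using bochner[OF pf] N by (simp add: \<rho>_def)
      then have "\<epsilon> * (\<rho> * dir f f) \<le> \<epsilon> * ?b" using \<epsilon> by simp
      with dh have dh': "dir ?h ?h \<le> (1 - \<epsilon> * \<rho>) * dir f f"
        by (simp add: algebra_simps)
      have "mean (\<lambda>X. (f X)\<^sup>2) \<le> mean (\<lambda>X. (?h X)\<^sup>2) + 2 * \<epsilon> * dir f f"
        using h2 b0 by simp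
      also have "mean (\<lambda>X. (?h X)\<^sup>2) \<le> c n * dir ?h ?h"
        using Suc hV by auto
      also have "\<dots> \<le> c n * ((1 - \<epsilon> * \<rho>) * dir f f)"
        using dh' c0 by (intro mult_left_mono)
      finally show "mean (\<lambda>X. (f X)\<^sup>2) \<le> c (Suc n) * dir f f"
        unfolding step by (simp add: algebra_simps)
    qed
  qed
  have "c \<longlonglongrightarrow> 2 / \<rho> + 0 * (4 ^ (N * N) * (2 * pi)\<^sup>2)"
    unfolding c_def using \<epsilon> \<rho>
    by (intro tendsto_add tendsto_const tendsto_mult LIMSEQ_realpow_zero) auto
  then have "(\<lambda>n. c n * dir f f) \<longlonglongrightarrow> 2 / \<rho> * dir f f"
    using tendsto_mult_right[of c] by fastforce
  moreover have "mean (\<lambda>X. (f X)\<^sup>2) \<le> c n * dir f f" for n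
    using valid f flip mean0 by (auto simp: V_def)
  ultimately have "mean (\<lambda>X. (f X)\<^sup>2) \<le> 2 / \<rho> * dir f f"
    by (meson LIMSEQ_le_const)
  then show ?thesis by (simp add: \<rho>_def)
qed

lemma poincare:
  assumes N: "3 \<le> N" and f: "polf f" and flip: "\<And>X. f (colflip N X) = f X"
  shows "mean (\<lambda>X. (f X - mean f)\<^sup>2) \<le> 8 / (real N - 2) * dir f f"
proof -
  let ?h = "\<lambda>X. f X - mean f"
  have "polf ?h" using f by auto
  then obtain m C where "pol m C ?h" by (auto simp: polf_def)
  moreover have "mean ?h = 0" using f by (simp add: mean_diff)
  moreover have "dir ?h ?h = dir f f" using f by (simp add: dir_def)
  ultimately show ?thesis
    using poincare_pol[OF N, of m C ?h] flip by simp
qed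

end

subsection \<open>Polynomial approximation with gradients\<close>

lemma pderiv_sum: "pderiv (\<Sum>i\<in>I. p i) = (\<Sum>i\<in>I. pderiv (p i))"
  by (induction I rule: infinite_finite_induct) (auto simp: pderiv_add)

text \<open>The derivative is approximated and the approximant integrated, since closeness of a
  polynomial to \<open>\<phi>\<close> alone says nothing about derivatives. An additive constant
  matches the values at \<open>a\<close>.\<close>

lemma C1_weierstrass:
  fixes \<phi> \<phi>' :: "real \<Rightarrow> real"
  assumes ab: "a \<le> b" and der: "\<And>t. t \<in> {a..b} \<Longrightarrow> (\<phi> has_real_derivative \<phi>' t) (at t within {a..b})"
    and cont: "continuous_on {a..b} \<phi>'" and \<delta>: "0 < \<delta>"
  shows "\<exists>p. \<forall>t\<in>{a..b}. \<bar>poly p t - \<phi> t\<bar> \<le> \<delta> \<and> \<bar>poly (pderiv p) t - \<phi>' t\<bar> \<le> \<delta>"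
proof -
  \<comment> \<open>Integration over \<open>{a..b}\<close> multiplies the error by at most
    \<open>b - a\<close>; the 1 in the denominator admits \<open>a = b\<close>.\<close>
  define e where "e = min \<delta> (\<delta> / (b - a + 1))"
  have e: "e > 0" "e \<le> \<delta>" "e * (b - a) \<le> \<delta>"
  proof -
    show "e > 0" "e \<le> \<delta>" using \<delta> ab by (auto simp: e_def)
    have "e * (b - a) \<le> \<delta> / (b - a + 1) * (b - a)"
      using ab by (intro mult_right_mono) (auto simp: e_def)
    also have "\<dots> \<le> \<delta>" using ab \<delta> by (simp add: field_simps)
    finally show "e * (b - a) \<le> \<delta>" .
  qed
  obtain g where "real_polynomial_function g" and g: "\<And>t. t \<in> {a..b} \<Longrightarrow> \<bar>\<phi>' t - g t\<bar> < e"
    using Stone_Weierstrass_real_polynomial_function[OF compact_Icc cont e(1)] by blast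
  then obtain c n where gsum: "g = (\<lambda>x. \<Sum>i\<le>n. c i * x ^ i)"
    by (auto simp: real_polynomial_function_iff_sum)
  define q where "q = (\<Sum>i\<le>n. monom (c i / real (Suc i)) (Suc i))"
  define p where "p = q + [:\<phi> a - poly q a:]"
  have "pderiv p = (\<Sum>i\<le>n. monom (c i) i)"
    unfolding p_def q_def
    by (simp add: pderiv_add pderiv_sum pderiv_monom pderiv_pCons del: of_nat_Suc)
  then have pd: "poly (pderiv p) t = g t" for t
    by (simp add: gsum poly_sum poly_monom)
  have pa: "poly p a = \<phi> a" by (simp add: p_def)
  show ?thesis
  proof (intro exI[of _ p] ballI conjI)
    fix t assume t: "t \<in> {a..b}"
    show "\<bar>poly (pderiv p) t - \<phi>' t\<bar> \<le> \<delta>"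
      using g[OF t] e by (simp add: pd abs_minus_commute)
    have "norm ((poly p t - \<phi> t) - (poly p a - \<phi> a)) \<le> e * norm (t - a)"
    proof (rule field_differentiable_bound[of "{a..b}"])
      fix u assume u: "u \<in> {a..b}"
      show "((\<lambda>u. poly p u - \<phi> u) has_field_derivative (poly (pderiv p) u - \<phi>' u)) (at u within {a..b})"
        using der[OF u] by (intro derivative_intros has_field_derivative_at_within[OF poly_DERIV])
      show "norm (poly (pderiv p) u - \<phi>' u) \<le> e"
        using g[OF u] by (simp add: pd abs_minus_commute)
    qed (use t ab in auto)
    also have "\<dots> \<le> e * (b - a)" using t e by (intro mult_left_mono) auto
    also have "\<dots> \<le> \<delta>" by (rule e(3))
    finally show "\<bar>poly p t - \<phi> t\<bar> \<le> \<delta>" by (simp add: pa)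
  qed
qed

lemma polf_poly [simp, intro]: "polf f \<Longrightarrow> polf (\<lambda>X. poly p (f X))"
  by (induction p) auto

lemma D_poly: "polf f \<Longrightarrow> D i j (\<lambda>X. poly p (f X)) = (\<lambda>X. poly (pderiv p) (f X) * D i j f X)"
proof (rule D_eqI)
  fix X assume f: "polf f"
  have "((\<lambda>t. poly p (f (rot i j t X))) has_real_derivative
      poly (pderiv p) (f (rot i j 0 X)) * D i j f X) (at 0)"
    by (rule DERIV_chain2[OF poly_DERIV polf_has_derivative0[OF f]])
  then show "((\<lambda>t. poly p (f (rot i j t X))) has_real_derivative
      poly (pderiv p) (f X) * D i j f X) (at 0)" by simp
qed

text \<open>The candidate gradient \<open>G\<close> is separate data, so differentiability of
  \<open>f\<close> itself never enters. The approximants carry the flip invariance that the Poincare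
  inequality demands.\<close>

definition C1lim where
  "C1lim N f G \<longleftrightarrow> (\<forall>\<delta>>0. \<exists>g. polf g \<and> (\<forall>X. g (colflip N X) = g X) \<and>
     (\<forall>X\<in>orth_ents N. \<bar>g X - f X\<bar> \<le> \<delta> \<and> (\<forall>i<N. \<forall>j<N. \<bar>D i j g X - G i j X\<bar> \<le> \<delta>)))"

lemma C1limD:
  assumes "C1lim N f G" "0 < \<delta>"
  obtains g where "polf g" "\<And>X. g (colflip N X) = g X"
    "\<And>X. X \<in> orth_ents N \<Longrightarrow> \<bar>g X - f X\<bar> \<le> \<delta>"
    "\<And>X i j. X \<in> orth_ents N \<Longrightarrow> i < N \<Longrightarrow> j < N \<Longrightarrow> \<bar>D i j g X - G i j X\<bar> \<le> \<delta>"
proof -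
  have "\<exists>g. polf g \<and> (\<forall>X. g (colflip N X) = g X) \<and>
     (\<forall>X\<in>orth_ents N. \<bar>g X - f X\<bar> \<le> \<delta> \<and> (\<forall>i<N. \<forall>j<N. \<bar>D i j g X - G i j X\<bar> \<le> \<delta>))"
    using assms by (simp add: C1lim_def)
  then obtain g where g: "polf g" "\<forall>X. g (colflip N X) = g X"
    "\<forall>X\<in>orth_ents N. \<bar>g X - f X\<bar> \<le> \<delta> \<and> (\<forall>i<N. \<forall>j<N. \<bar>D i j g X - G i j X\<bar> \<le> \<delta>)"
    by (elim exE conjE)
  show thesis by (rule that[OF g(1)]) (use g in simp_all)
qed

lemma C1lim_polf:
  assumes "polf f" "\<And>X. f (colflip N X) = f X"
  shows "C1lim N f (\<lambda>i j. D i j f)"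
  unfolding C1lim_def using assms by (intro allI impI exI[of _ f]) auto

lemma C1lim_add:
  assumes "C1lim N f F" "C1lim N g G"
  shows "C1lim N (\<lambda>X. f X + g X) (\<lambda>i j X. F i j X + G i j X)"
  unfolding C1lim_def
proof (intro allI impI)
  fix \<delta> :: real assume "0 < \<delta>"
  then have \<delta>: "0 < \<delta> / 2" by simp
  obtain f' where f': "polf f'" "\<And>X. f' (colflip N X) = f' X"
    "\<And>X. X \<in> orth_ents N \<Longrightarrow> \<bar>f' X - f X\<bar> \<le> \<delta> / 2"
    "\<And>X i j. X \<in> orth_ents N \<Longrightarrow> i < N \<Longrightarrow> j < N \<Longrightarrow> \<bar>D i j f' X - F i j X\<bar> \<le> \<delta> / 2"
    by (rule C1limD[OF assms(1) \<delta>]) (erule that, simp_all)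
  obtain g' where g': "polf g'" "\<And>X. g' (colflip N X) = g' X"
    "\<And>X. X \<in> orth_ents N \<Longrightarrow> \<bar>g' X - g X\<bar> \<le> \<delta> / 2"
    "\<And>X i j. X \<in> orth_ents N \<Longrightarrow> i < N \<Longrightarrow> j < N \<Longrightarrow> \<bar>D i j g' X - G i j X\<bar> \<le> \<delta> / 2"
    by (rule C1limD[OF assms(2) \<delta>]) (erule that, simp_all)
  show "\<exists>h. polf h \<and> (\<forall>X. h (colflip N X) = h X) \<and>
     (\<forall>X\<in>orth_ents N. \<bar>h X - (f X + g X)\<bar> \<le> \<delta> \<and>
       (\<forall>i<N. \<forall>j<N. \<bar>D i j h X - (F i j X + G i j X)\<bar> \<le> \<delta>))"
  proof (intro exI[of _ "\<lambda>X. f' X + g' X"] conjI allI ballI impI)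
    fix X i j assume X: "X \<in> orth_ents N"
    show "\<bar>f' X + g' X - (f X + g X)\<bar> \<le> \<delta>"
      using f'(3)[OF X] g'(3)[OF X] by linarith
    assume "i < N" "j < N"
    then show "\<bar>D i j (\<lambda>X. f' X + g' X) X - (F i j X + G i j X)\<bar> \<le> \<delta>"
      unfolding D_add[OF f'(1) g'(1)] using f'(4)[OF X, of i j] g'(4)[OF X, of i j] by linarith
  qed (use f' g' in auto)
qed

lemma C1lim_sum:
  assumes "finite S" "\<And>s. s \<in> S \<Longrightarrow> C1lim N (f s) (F s)"
  shows "C1lim N (\<lambda>X. \<Sum>s\<in>S. f s X) (\<lambda>i j X. \<Sum>s\<in>S. F s i j X)"
  using assms
proof (induction S rule: finite_induct)
  case empty
  show ?case using C1lim_polf[of "\<lambda>X. 0" N] by simp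
next
  case (insert s S)
  then show ?case using C1lim_add[of N "f s" "F s" "\<lambda>X. \<Sum>s\<in>S. f s X"] by simp
qed

text \<open>An approximant of \<open>f\<close> may leave \<open>{a..b}\<close> slightly; the margins
  keep its values where \<open>\<phi>\<close> is controlled. \<open>G\<close> must be bounded
  because the chain rule multiplies the errors of \<open>\<phi>'\<close> by a gradient.\<close>

lemma C1lim_compose:
  fixes \<phi> \<phi>' :: "real \<Rightarrow> real"
  assumes f: "C1lim N f G" and range: "\<And>X. X \<in> orth_ents N \<Longrightarrow> f X \<in> {a..b}"
    and G: "\<And>X i j. X \<in> orth_ents N \<Longrightarrow> i < N \<Longrightarrow> j < N \<Longrightarrow> \<bar>G i j X\<bar> \<le> B"
    and ab: "a' < a" "a \<le> b" "b < b'"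
    and der: "\<And>t. t \<in> {a'..b'} \<Longrightarrow> (\<phi> has_real_derivative \<phi>' t) (at t within {a'..b'})"
    and cont: "continuous_on {a'..b'} \<phi>'"
  shows "C1lim N (\<lambda>X. \<phi> (f X)) (\<lambda>i j X. \<phi>' (f X) * G i j X)"
  unfolding C1lim_def
proof (intro allI impI)
  fix \<delta> :: real assume \<delta>: "0 < \<delta>"
  define C where "C = \<bar>B\<bar> + 1"
  have C: "C \<ge> 1" "B \<le> C" by (auto simp: C_def)
  obtain L where L: "L \<ge> 1" "\<And>t. t \<in> {a'..b'} \<Longrightarrow> \<bar>\<phi>' t\<bar> \<le> L"
  proof -
    have "bounded (\<phi>' ` {a'..b'})"
      using compact_continuous_image[OF cont compact_Icc] by (rule compact_imp_bounded)
    then obtain K where K: "\<forall>t\<in>{a'..b'}. \<bar>\<phi>' t\<bar> \<le> K"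
      by (auto simp: bounded_iff)
    show ?thesis
    proof (rule that[of "max 1 K"])
      fix t assume "t \<in> {a'..b'}"
      with K have "\<bar>\<phi>' t\<bar> \<le> K" by blast
      then show "\<bar>\<phi>' t\<bar> \<le> max 1 K" by simp
    qed simp
  qed
  define \<delta>1 where "\<delta>1 = \<delta> / (3 * (C + 1))"
  have \<delta>1: "\<delta>1 > 0" "\<delta>1 * (C + 1) = \<delta> / 3" "\<delta>1 \<le> \<delta> / 3"
    using \<delta> C by (auto simp: \<delta>1_def field_simps)
  have le: "a' \<le> b'" using ab by simp
  obtain p where "\<forall>t\<in>{a'..b'}. \<bar>poly p t - \<phi> t\<bar> \<le> \<delta>1 \<and> \<bar>poly (pderiv p) t - \<phi>' t\<bar> \<le> \<delta>1"
    using C1_weierstrass[OF le der cont \<delta>1(1)] by blast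
  note p = this[rule_format]
  have "uniformly_continuous_on {a'..b'} \<phi>'"
    by (rule compact_uniformly_continuous[OF cont compact_Icc])
  from this[unfolded uniformly_continuous_on_def, rule_format, OF \<delta>1(1)]
  obtain \<eta> where \<eta>: "\<eta> > 0"
    and "\<forall>t\<in>{a'..b'}. \<forall>s\<in>{a'..b'}. dist s t < \<eta> \<longrightarrow> dist (\<phi>' s) (\<phi>' t) < \<delta>1"
    by (elim exE conjE)
  note \<eta>' = this(2)[rule_format]
  \<comment> \<open>In turn: the two margins, uniform continuity of \<open>\<phi>'\<close> with room
    for a strict inequality, a bounded gradient of the approximant, and an error of at most a third
    of \<open>\<delta>\<close> after multiplication by \<open>L\<close>.\<close>
  define \<delta>2 where "\<delta>2 = Min {a - a', b' - b, \<eta> / 2, 1, \<delta> / (3 * L)}"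
  have \<delta>2: "\<delta>2 > 0" "\<delta>2 \<le> a - a'" "\<delta>2 \<le> b' - b" "\<delta>2 < \<eta>" "\<delta>2 \<le> 1" "L * \<delta>2 \<le> \<delta> / 3"
  proof -
    show "\<delta>2 > 0" "\<delta>2 \<le> a - a'" "\<delta>2 \<le> b' - b" "\<delta>2 \<le> 1"
      using ab \<eta> \<delta> L by (auto simp: \<delta>2_def)
    have le: "\<delta>2 \<le> \<eta> / 2" "\<delta>2 \<le> \<delta> / (3 * L)"
      unfolding \<delta>2_def by (rule Min_le; simp)+
    then show "\<delta>2 < \<eta>" using \<eta> by linarith
    have "L * \<delta>2 \<le> L * (\<delta> / (3 * L))" using le L(1) by (intro mult_left_mono) auto
    then show "L * \<delta>2 \<le> \<delta> / 3" using L(1) by simp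
  qed
  obtain g where g: "polf g" "\<And>X. g (colflip N X) = g X"
    "\<And>X. X \<in> orth_ents N \<Longrightarrow> \<bar>g X - f X\<bar> \<le> \<delta>2"
    "\<And>X i j. X \<in> orth_ents N \<Longrightarrow> i < N \<Longrightarrow> j < N \<Longrightarrow> \<bar>D i j g X - G i j X\<bar> \<le> \<delta>2"
    by (rule C1limD[OF f \<delta>2(1)]) (erule that, simp_all)
  have gin: "g X \<in> {a'..b'}" and fin: "f X \<in> {a'..b'}" if X: "X \<in> orth_ents N" for X
    using g(3)[OF X] range[OF X] \<delta>2 ab by auto
  show "\<exists>h. polf h \<and> (\<forall>X. h (colflip N X) = h X) \<and>
     (\<forall>X\<in>orth_ents N. \<bar>h X - \<phi> (f X)\<bar> \<le> \<delta> \<and>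
       (\<forall>i<N. \<forall>j<N. \<bar>D i j h X - \<phi>' (f X) * G i j X\<bar> \<le> \<delta>))"
  proof (intro exI[of _ "\<lambda>X. poly p (g X)"] conjI allI ballI impI)
    fix X i j assume X: "X \<in> orth_ents N"
    have "norm (\<phi> (g X) - \<phi> (f X)) \<le> L * norm (g X - f X)"
      by (rule field_differentiable_bound[of "{a'..b'}" \<phi> \<phi>']) (use der L gin[OF X] fin[OF X] in auto)
    also have "\<dots> \<le> L * \<delta>2" using g(3)[OF X] L(1) by (intro mult_left_mono) auto
    finally have "\<bar>\<phi> (g X) - \<phi> (f X)\<bar> \<le> \<delta> / 3" using \<delta>2 by simp
    moreover have "\<bar>poly p (g X) - \<phi> (g X)\<bar> \<le> \<delta> / 3" using p[OF gin[OF X]] \<delta>1 by linarith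
    ultimately show "\<bar>poly p (g X) - \<phi> (f X)\<bar> \<le> \<delta>" using \<delta> by linarith
    assume ij: "i < N" "j < N"
    let ?g' = "D i j g X" and ?G = "G i j X"
    have g'C: "\<bar>?g'\<bar> \<le> C + 1" using g(4)[OF X ij] G[OF X ij] \<delta>2 C by linarith
    have "\<bar>(poly (pderiv p) (g X) - \<phi>' (g X)) * ?g'\<bar> \<le> \<delta>1 * (C + 1)"
      unfolding abs_mult using p[OF gin[OF X]] g'C \<delta>1 by (intro mult_mono) auto
    moreover have "\<bar>(\<phi>' (g X) - \<phi>' (f X)) * ?g'\<bar> \<le> \<delta>1 * (C + 1)"
    proof -
      have "dist (g X) (f X) < \<eta>" using g(3)[OF X] \<delta>2 by (simp add: dist_real_def)
      then have "\<bar>\<phi>' (g X) - \<phi>' (f X)\<bar> \<le> \<delta>1"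
        using \<eta>'[OF fin[OF X] gin[OF X]] by (simp add: dist_real_def)
      then show ?thesis unfolding abs_mult using g'C \<delta>1 by (intro mult_mono) auto
    qed
    moreover have "\<bar>\<phi>' (f X) * (?g' - ?G)\<bar> \<le> L * \<delta>2"
      unfolding abs_mult using L fin[OF X] g(4)[OF X ij] by (intro mult_mono) auto
    \<comment> \<open>The errors of the polynomial, of its argument and of the gradient, a third of
      \<open>\<delta>\<close> each.\<close>
    moreover have "poly (pderiv p) (g X) * ?g' - \<phi>' (f X) * ?G
      = (poly (pderiv p) (g X) - \<phi>' (g X)) * ?g' + (\<phi>' (g X) - \<phi>' (f X)) * ?g' + \<phi>' (f X) * (?g' - ?G)"
      by (simp add: algebra_simps)
    ultimately have "\<bar>poly (pderiv p) (g X) * ?g' - \<phi>' (f X) * ?G\<bar> \<le> \<delta>"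
      using \<delta>1(2) \<delta>2(6) by linarith
    then show "\<bar>D i j (\<lambda>X. poly p (g X)) X - \<phi>' (f X) * ?G\<bar> \<le> \<delta>"
      using g(1) by (simp add: D_poly)
  qed (use g in auto)
qed

lemma (in haar) C1lim_poincare:
  assumes N: "3 \<le> N" and F: "C1lim N F G"
    and meas: "(\<lambda>x. F (ent N x)) \<in> borel_measurable (orth_borel N)"
    and bound: "\<And>X. X \<in> orth_ents N \<Longrightarrow> \<bar>F X\<bar> \<le> B"
    and grad: "\<And>X. X \<in> orth_ents N \<Longrightarrow> (\<Sum>i<N. \<Sum>j<N. (G i j X)\<^sup>2) \<le> L"
  shows "(\<integral>x. (F (ent N x) - mean F)\<^sup>2 \<partial>\<mu>) \<le> 8 / (real N - 2) * L"
proof (rule field_le_epsilon)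
  fix e :: real assume e: "e > 0"
  define c where "c = 8 / (real N - 2)"
  have c: "c \<ge> 0" using N by (simp add: c_def)
  have Fint: "integrable \<mu> (\<lambda>x. F (ent N x))"
    using meas bound by (intro integrable_bounded[of _ B]) auto
  obtain x0 where "x0 \<in> orthogonal_group N" using not_empty by auto
  then have X0: "ent N x0 \<in> orth_ents N" by simp
  have B0: "B \<ge> 0" using bound[OF X0] by linarith
  have L0: "L \<ge> 0" using grad[OF X0] by (meson sum_nonneg zero_le_power2 order_trans)
  have Gb: "\<bar>G i j X\<bar> \<le> L + 1" if X: "X \<in> orth_ents N" and ij: "i < N" "j < N" for X i j
  proof -
    have "(G i j X)\<^sup>2 \<le> (\<Sum>j<N. (G i j X)\<^sup>2)"
      using ij by (intro member_le_sum[of j _ "\<lambda>j. (G i j X)\<^sup>2"]) auto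
    also have "\<dots> \<le> (\<Sum>i<N. \<Sum>j<N. (G i j X)\<^sup>2)"
      using ij by (intro member_le_sum[of i _ "\<lambda>i. \<Sum>j<N. (G i j X)\<^sup>2"] sum_nonneg) auto
    also note grad[OF X]
    also have "L \<le> (L + 1)\<^sup>2" using L0 by (simp add: power2_eq_square algebra_simps)
    finally have "\<bar>G i j X\<bar> \<le> \<bar>L + 1\<bar>" by (simp only: abs_le_square_iff)
    then show ?thesis using L0 by simp
  qed
  \<comment> \<open>Collects the errors, all linear in \<open>\<delta>\<close>:
    \<open>8 * B + 4\<close> from replacing \<open>F\<close> by \<open>g\<close> in the variance,
    the rest from the \<open>N^2\<close> squared gradient entries.\<close>
  define K where "K = 8 * B + 4 + c * ((real N)\<^sup>2 * (2 * (L + 1) + 1))"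
  have "0 \<le> c * ((real N)\<^sup>2 * (2 * (L + 1) + 1))" using c L0 by simp
  then have K: "K > 0" using B0 by (simp add: K_def)
  define \<delta> where "\<delta> = min 1 (e / K)"
  have \<delta>: "\<delta> > 0" "\<delta> \<le> 1" "\<delta> * K \<le> e"
  proof -
    show "\<delta> > 0" "\<delta> \<le> 1" using e K by (auto simp: \<delta>_def)
    have "\<delta> * K \<le> e / K * K" using K by (intro mult_right_mono) (auto simp: \<delta>_def)
    then show "\<delta> * K \<le> e" using K by simp
  qed
  obtain g where g: "polf g" "\<And>X. g (colflip N X) = g X"
    "\<And>X. X \<in> orth_ents N \<Longrightarrow> \<bar>g X - F X\<bar> \<le> \<delta>"
    "\<And>X i j. X \<in> orth_ents N \<Longrightarrow> i < N \<Longrightarrow> j < N \<Longrightarrow> \<bar>D i j g X - G i j X\<bar> \<le> \<delta>"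
    by (rule C1limD[OF F \<delta>(1)]) (erule that, simp_all)
  have mg: "\<bar>mean g - mean F\<bar> \<le> \<delta>"
  proof -
    have "mean g - mean F = (\<integral>x. g (ent N x) - F (ent N x) \<partial>\<mu>)"
      unfolding mean_def using Fint g(1) by simp
    moreover have "\<dots> \<le> (\<integral>x. \<delta> \<partial>\<mu>)" "(\<integral>x. - \<delta> \<partial>\<mu>) \<le> \<dots>"
      using Fint g(1) g(3)[OF ent_in]
      by (intro integral_mono; force simp: abs_le_iff)+
    ultimately show ?thesis using prob_space by (simp add: abs_le_iff)
  qed
  have mF: "\<bar>mean F\<bar> \<le> B"
  proof -
    have "(\<integral>x. F (ent N x) \<partial>\<mu>) \<le> (\<integral>x. B \<partial>\<mu>)" "(\<integral>x. - B \<partial>\<mu>) \<le> (\<integral>x. F (ent N x) \<partial>\<mu>)"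
      using Fint bound[OF ent_in] by (intro integral_mono; force simp: abs_le_iff)+
    then show ?thesis using prob_space by (simp add: mean_def abs_le_iff)
  qed
  have V: "(\<integral>x. (F (ent N x) - mean F)\<^sup>2 \<partial>\<mu>) \<le> mean (\<lambda>X. (g X - mean g)\<^sup>2 + \<delta> * (8 * B + 4))"
    unfolding mean_def[of "\<lambda>X. (g X - mean g)\<^sup>2 + \<delta> * (8 * B + 4)"]
  proof (rule integral_mono)
    show "integrable \<mu> (\<lambda>x. (F (ent N x) - mean F)\<^sup>2)"
    proof (rule integrable_bounded)
      fix x assume "x \<in> orthogonal_group N"
      then have "\<bar>F (ent N x) - mean F\<bar> \<le> 2 * B" using bound[OF ent_in] mF by fastforce
      then have "\<bar>F (ent N x) - mean F\<bar>\<^sup>2 \<le> (2 * B)\<^sup>2" by (rule power_mono) simp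
      then show "\<bar>(F (ent N x) - mean F)\<^sup>2\<bar> \<le> (2 * B)\<^sup>2" by simp
    qed (use meas in auto)
    show "integrable \<mu> (\<lambda>x. (g (ent N x) - mean g)\<^sup>2 + \<delta> * (8 * B + 4))"
      using g(1) by (intro integrable_polf[of "\<lambda>X. (g X - mean g)\<^sup>2 + \<delta> * (8 * B + 4)"]) auto
    fix x assume "x \<in> space \<mu>"
    then have X: "ent N x \<in> orth_ents N" by simp
    define u v where "u = F (ent N x) - mean F" and "v = g (ent N x) - mean g"
    have uv: "\<bar>u - v\<bar> \<le> 2 * \<delta>" using g(3)[OF X] mg by (simp add: u_def v_def)
    have u: "\<bar>u\<bar> \<le> 2 * B" using bound[OF X] mF by (simp add: u_def)
    have "\<bar>u + v\<bar> \<le> 4 * B + 2" using uv u \<delta>(2) by linarith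
    then have "\<bar>(u - v) * (u + v)\<bar> \<le> (2 * \<delta>) * (4 * B + 2)"
      unfolding abs_mult using uv \<delta>(1) by (intro mult_mono) auto
    moreover have "u\<^sup>2 = v\<^sup>2 + (u - v) * (u + v)" by (simp add: power2_eq_square algebra_simps)
    ultimately have "u\<^sup>2 \<le> v\<^sup>2 + (2 * \<delta>) * (4 * B + 2)" by linarith
    then show "(F (ent N x) - mean F)\<^sup>2 \<le> (g (ent N x) - mean g)\<^sup>2 + \<delta> * (8 * B + 4)"
      by (simp add: u_def v_def algebra_simps)
  qed
  also have "\<dots> = mean (\<lambda>X. (g X - mean g)\<^sup>2) + \<delta> * (8 * B + 4)"
    using mean_add[of "\<lambda>X. (g X - mean g)\<^sup>2" "\<lambda>X. \<delta> * (8 * B + 4)"] g(1) by simp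
  also have "mean (\<lambda>X. (g X - mean g)\<^sup>2) \<le> c * dir g g"
    unfolding c_def by (rule poincare[OF N g(1,2)])
  also have "dir g g \<le> L + \<delta> * ((real N)\<^sup>2 * (2 * (L + 1) + 1))"
  proof -
    have "dir g g = mean (\<lambda>X. \<Sum>i<N. \<Sum>j<N. D i j g X * D i j g X)"
      using g(1) by (simp add: dir_def mean_sum)
    also have "\<dots> \<le> mean (\<lambda>X. L + \<delta> * ((real N)\<^sup>2 * (2 * (L + 1) + 1)))"
    proof (rule mean_mono)
      fix X assume X: "X \<in> orth_ents N"
      have "(\<Sum>i<N. \<Sum>j<N. D i j g X * D i j g X) \<le> (\<Sum>i<N. \<Sum>j<N. (G i j X)\<^sup>2 + \<delta> * (2 * (L + 1) + 1))"
      proof (rule sum_mono, rule sum_mono)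
        fix i j assume "i \<in> {..<N}" "j \<in> {..<N}"
        then have ij: "i < N" "j < N" by auto
        have d: "\<bar>D i j g X - G i j X\<bar> \<le> \<delta>" by (rule g(4)[OF X ij])
        have s: "\<bar>D i j g X + G i j X\<bar> \<le> 2 * (L + 1) + 1"
        proof -
          have "\<bar>D i j g X + G i j X\<bar> \<le> \<bar>D i j g X - G i j X\<bar> + 2 * \<bar>G i j X\<bar>" by linarith
          then show ?thesis using d Gb[OF X ij] \<delta>(2) by (auto simp: field_simps)
        qed
        have "\<bar>(D i j g X - G i j X) * (D i j g X + G i j X)\<bar> \<le> \<delta> * (2 * (L + 1) + 1)"
          unfolding abs_mult using d s \<delta>(1) by (intro mult_mono) auto
        moreover have "D i j g X * D i j g X = (G i j X)\<^sup>2 + (D i j g X - G i j X) * (D i j g X + G i j X)"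
          by (simp add: power2_eq_square algebra_simps)
        ultimately show "D i j g X * D i j g X \<le> (G i j X)\<^sup>2 + \<delta> * (2 * (L + 1) + 1)" by linarith
      qed
      also have "\<dots> = (\<Sum>i<N. \<Sum>j<N. (G i j X)\<^sup>2) + \<delta> * ((real N)\<^sup>2 * (2 * (L + 1) + 1))"
        by (simp add: sum.distrib power2_eq_square algebra_simps)
      finally show "(\<Sum>i<N. \<Sum>j<N. D i j g X * D i j g X) \<le> L + \<delta> * ((real N)\<^sup>2 * (2 * (L + 1) + 1))"
        using grad[OF X] by linarith
    qed (use g(1) in auto)
    finally show ?thesis by simp
  qed
  finally have "(\<integral>x. (F (ent N x) - mean F)\<^sup>2 \<partial>\<mu>)
      \<le> c * (L + \<delta> * ((real N)\<^sup>2 * (2 * (L + 1) + 1))) + \<delta> * (8 * B + 4)"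
    using c by (auto simp: mult_left_mono)
  also have "\<dots> = c * L + \<delta> * K" by (simp add: K_def algebra_simps)
  also have "\<dots> \<le> c * L + e" using \<delta>(3) by simp
  finally show "(\<integral>x. (F (ent N x) - mean F)\<^sup>2 \<partial>\<mu>) \<le> 8 / (real N - 2) * L + e"
    by (simp add: c_def)
qed

subsection \<open>Variance and stability of the free energy\<close>

text \<open>The form \<open>sigma^T O diag(d) O^T sigma\<close>, written in the coordinates of the
  spin vector along the columns of \<open>O\<close> (\<open>spin_form_eq_quad\<close>). Only squares
  of these occur, hence the invariance under \<open>colflip\<close>.\<close>

definition quad :: "nat \<Rightarrow> (nat \<Rightarrow> real) \<Rightarrow> (nat \<Rightarrow> real) \<Rightarrow> (nat \<Rightarrow> nat \<Rightarrow> real) \<Rightarrow> real" where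
  "quad N d s X = (\<Sum>k<N. d k * (\<Sum>p<N. s p * X p k)\<^sup>2)"

definition spin_fun :: "nat \<Rightarrow> (nat \<Rightarrow> real) \<Rightarrow> bool" where
  "spin_fun N s \<longleftrightarrow> (\<forall>p<N. s p \<in> {- 1, 1})"

lemma polf_quad [simp, intro]: "polf (quad N d s)"
proof -
  have "polf (\<lambda>X. \<Sum>k<N. d k * (\<Sum>p<N. s p * X p k)\<^sup>2)" by auto
  then show ?thesis by (simp add: quad_def[abs_def])
qed

lemma quad_colflip: "quad N d s (colflip N X) = quad N d s X"
proof -
  have "(\<Sum>p<N. s p * colflip N X p k)\<^sup>2 = (\<Sum>p<N. s p * X p k)\<^sup>2" for k
    by (cases "k = N - 1") (simp_all add: colflip_def sum_negf)
  then show ?thesis by (simp add: quad_def)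
qed

text \<open>With \<open>v = X^T s\<close> and \<open>y = X diag(d) v\<close> the derivative is
  \<open>2 * (s i * y j - s j * y i)\<close>.\<close>

lemma D_quad:
  assumes ij: "i < N" "j < N"
  shows "D i j (quad N d s) X = 2 * (s i * (\<Sum>k<N. d k * (\<Sum>p<N. s p * X p k) * X j k)
    - s j * (\<Sum>k<N. d k * (\<Sum>p<N. s p * X p k) * X i k))"
proof -
  let ?v = "\<lambda>k X. \<Sum>p<N. s p * X p k"
  have Dv: "D i j (?v k) X = s i * X j k - s j * X i k" for k X
  proof -
    have "D i j (?v k) X = (\<Sum>p<N. s p * ((if p = i then X j k else 0) - (if p = j then X i k else 0)))"
      by (simp add: D_entry)
    also have "\<dots> = (\<Sum>p<N. (if p = i then s i * X j k else 0) - (if p = j then s j * X i k else 0))"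
      by (intro sum.cong) (auto simp: algebra_simps)
    also have "\<dots> = s i * X j k - s j * X i k"
      using ij by (simp add: sum_subtractf)
    finally show ?thesis .
  qed
  have "D i j (quad N d s) X = D i j (\<lambda>X. \<Sum>k<N. d k * (?v k X * ?v k X)) X"
    by (simp add: quad_def[abs_def] power2_eq_square)
  also have "\<dots> = (\<Sum>k<N. d k * (D i j (?v k) X * ?v k X + ?v k X * D i j (?v k) X))"
    by (simp del: D_sum add: D_sum[of "{..<N}" "\<lambda>k X. d k * (?v k X * ?v k X)"] D_mult polf_sum)
  also have "\<dots> = (\<Sum>k<N. 2 * (s i * (d k * ?v k X * X j k) - s j * (d k * ?v k X * X i k)))"
    unfolding Dv by (intro sum.cong) (auto simp: algebra_simps)
  finally show ?thesis
    by (simp only: sum_subtractf sum_distrib_left[symmetric])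
qed

lemma orth_ents_transpose:
  assumes "X \<in> orth_ents N"
  shows "(\<lambda>k l. X l k) \<in> orth_ents N"
proof -
  obtain A where A: "A \<in> orthogonal_group N" "X = ent N A" using assms by (auto simp: orth_ents_def)
  have "(\<lambda>k l. X l k) = ent N (transpose_mat A)"
    using A orthogonal_group_carrier[OF A(1)] by (auto simp: ent_def fun_eq_iff)
  then show ?thesis
    using orthogonal_group_transpose[OF A(1)] by (auto simp: orth_ents_def)
qed

lemma orth_ents_norm:
  assumes X: "X \<in> orth_ents N"
  shows "(\<Sum>j<N. (\<Sum>k<N. a k * X j k)\<^sup>2) = (\<Sum>k<N. (a k)\<^sup>2)"
proof -
  have "(\<Sum>j<N. (\<Sum>k<N. a k * X j k)\<^sup>2) = (\<Sum>j<N. \<Sum>k<N. \<Sum>l<N. a k * a l * (X j k * X j l))"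
    by (simp add: power2_eq_square sum_product algebra_simps)
  also have "\<dots> = (\<Sum>k<N. \<Sum>j<N. \<Sum>l<N. a k * a l * (X j k * X j l))"
    by (rule sum.swap)
  also have "\<dots> = (\<Sum>k<N. \<Sum>l<N. \<Sum>j<N. a k * a l * (X j k * X j l))"
    by (rule sum.cong[OF refl], rule sum.swap)
  also have "\<dots> = (\<Sum>k<N. \<Sum>l<N. a k * a l * (if k = l then 1 else 0))"
    using orth_ents_cols[OF X] by (intro sum.cong refl) (simp flip: sum_distrib_left)
  also have "\<dots> = (\<Sum>k<N. \<Sum>l<N. if l = k then (a k)\<^sup>2 else 0)"
    by (intro sum.cong refl) (auto simp: power2_eq_square)
  finally show ?thesis by simp
qed

lemma spin_norm:
  assumes X: "X \<in> orth_ents N" and s: "spin_fun N s"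
  shows "(\<Sum>k<N. (\<Sum>p<N. s p * X p k)\<^sup>2) = real N"
proof -
  have "(\<Sum>k<N. (\<Sum>p<N. s p * X p k)\<^sup>2) = (\<Sum>p<N. (s p)\<^sup>2)"
    using orth_ents_norm[OF orth_ents_transpose[OF X]] .
  also have "\<dots> = (\<Sum>p<N. 1)"
    using s by (intro sum.cong) (auto simp: spin_fun_def)
  finally show ?thesis by simp
qed

lemma quad_diff_le:
  assumes X: "X \<in> orth_ents N" and s: "spin_fun N s" and d: "\<And>k. k < N \<Longrightarrow> \<bar>d k - e k\<bar> \<le> c"
  shows "\<bar>quad N d s X - quad N e s X\<bar> \<le> c * real N"
proof -
  have "\<bar>quad N d s X - quad N e s X\<bar> = \<bar>\<Sum>k<N. (d k - e k) * (\<Sum>p<N. s p * X p k)\<^sup>2\<bar>"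
    by (simp add: quad_def sum_subtractf left_diff_distrib)
  also have "\<dots> \<le> (\<Sum>k<N. \<bar>(d k - e k) * (\<Sum>p<N. s p * X p k)\<^sup>2\<bar>)"
    by (rule sum_abs)
  also have "\<dots> \<le> (\<Sum>k<N. c * (\<Sum>p<N. s p * X p k)\<^sup>2)"
    using d by (intro sum_mono) (auto simp: abs_mult intro!: mult_right_mono)
  also have "\<dots> = c * real N"
    using spin_norm[OF X s] by (simp flip: sum_distrib_left)
  finally show ?thesis .
qed

lemma quad_bound:
  assumes "X \<in> orth_ents N" "spin_fun N s" "\<And>k. k < N \<Longrightarrow> \<bar>d k\<bar> \<le> M"
  shows "\<bar>quad N d s X\<bar> \<le> M * real N"
  using quad_diff_le[OF assms(1,2), of d "\<lambda>_. 0" M] assms(3) by (simp add: quad_def)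

text \<open>As \<open>X\<close> is orthogonal, the vector \<open>y\<close> has squared norm at most
  \<open>M^2 * N\<close>. The factor 16 consists of \<open>2^2\<close> from the derivative, 2 from
  the square of a difference and 2 from the symmetric double sum, which also contributes the second
  \<open>N\<close>.\<close>

lemma quad_gradient:
  assumes X: "X \<in> orth_ents N" and s: "spin_fun N s" and d: "\<And>k. k < N \<Longrightarrow> \<bar>d k\<bar> \<le> M"
  shows "(\<Sum>i<N. \<Sum>j<N. (D i j (quad N d s) X)\<^sup>2) \<le> 16 * (real N)\<^sup>2 * M\<^sup>2"
proof -
  define y where "y j = (\<Sum>k<N. d k * (\<Sum>p<N. s p * X p k) * X j k)" for j
  have s1: "(s i)\<^sup>2 = 1" if "i < N" for i
    using s that by (auto simp: spin_fun_def)
  have "(\<Sum>j<N. (y j)\<^sup>2) = (\<Sum>k<N. (d k)\<^sup>2 * (\<Sum>p<N. s p * X p k)\<^sup>2)"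
    unfolding y_def orth_ents_norm[OF X] by (simp add: power_mult_distrib)
  also have "\<dots> \<le> (\<Sum>k<N. M\<^sup>2 * (\<Sum>p<N. s p * X p k)\<^sup>2)"
  proof (intro sum_mono mult_right_mono)
    fix k assume "k \<in> {..<N}"
    then have "\<bar>d k\<bar>\<^sup>2 \<le> M\<^sup>2" using d by (intro power_mono) auto
    then show "(d k)\<^sup>2 \<le> M\<^sup>2" by simp
  qed auto
  also have "\<dots> = M\<^sup>2 * real N"
    using spin_norm[OF X s] by (simp flip: sum_distrib_left)
  finally have y: "(\<Sum>j<N. (y j)\<^sup>2) \<le> M\<^sup>2 * real N" .
  have "(\<Sum>i<N. \<Sum>j<N. (D i j (quad N d s) X)\<^sup>2) \<le> (\<Sum>i<N. \<Sum>j<N. 8 * (y j)\<^sup>2 + 8 * (y i)\<^sup>2)"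
  proof (rule sum_mono, rule sum_mono)
    fix i j assume "i \<in> {..<N}" "j \<in> {..<N}"
    then have ij: "i < N" "j < N" by auto
    have "(D i j (quad N d s) X)\<^sup>2 = 4 * (s i * y j - s j * y i)\<^sup>2"
      unfolding D_quad[OF ij] y_def[symmetric] power_mult_distrib by simp
    also have "\<dots> \<le> 4 * (2 * (s i * y j)\<^sup>2 + 2 * (s j * y i)\<^sup>2)"
      using zero_le_power2[of "s i * y j + s j * y i"]
      by (simp add: power2_eq_square algebra_simps)
    also have "\<dots> = 8 * (y j)\<^sup>2 + 8 * (y i)\<^sup>2"
      using s1[OF ij(1)] s1[OF ij(2)] by (simp add: power_mult_distrib)
    finally show "(D i j (quad N d s) X)\<^sup>2 \<le> 8 * (y j)\<^sup>2 + 8 * (y i)\<^sup>2" .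
  qed
  also have "\<dots> = 16 * real N * (\<Sum>j<N. (y j)\<^sup>2)"
    by (simp add: sum.distrib sum_distrib_left mult.assoc)
  also have "\<dots> \<le> 16 * real N * (M\<^sup>2 * real N)"
    using y by (intro mult_left_mono) auto
  finally show ?thesis by (simp add: power2_eq_square algebra_simps)
qed

section \<open>The partition function in terms of the matrix entries\<close>

lemma finite_spins: "finite (spins N)"
proof -
  have "spins N \<subseteq> (\<lambda>f. vec N f) ` ({..<N} \<rightarrow>\<^sub>E {- 1, 1})"
  proof
    fix v assume v: "v \<in> spins N"
    then have "v = vec N (restrict (vec_index v) {..<N})"
      by (intro eq_vecI) (auto simp: spins_def)
    moreover have "restrict (vec_index v) {..<N} \<in> {..<N} \<rightarrow>\<^sub>E {- 1, 1}"
      using v by (simp add: restrict_PiE_iff spins_def)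
    ultimately show "v \<in> (\<lambda>f. vec N f) ` ({..<N} \<rightarrow>\<^sub>E {- 1, 1})" by (rule image_eqI)
  qed
  then show ?thesis by (rule finite_subset) (simp add: finite_PiE)
qed

lemma spins_nonempty: "spins N \<noteq> {}"
proof -
  have "vec N (\<lambda>_. 1) \<in> spins N" by (simp add: spins_def)
  then show ?thesis by blast
qed

lemma spin_fun_spins: "\<sigma> \<in> spins N \<Longrightarrow> spin_fun N (vec_index \<sigma>)"
  by (simp add: spins_def spin_fun_def)

definition partition_sum :: "nat \<Rightarrow> real \<Rightarrow> (nat \<Rightarrow> real) \<Rightarrow> (nat \<Rightarrow> nat \<Rightarrow> real) \<Rightarrow> real" where
  "partition_sum N \<beta> d X = (\<Sum>\<sigma>\<in>spins N. exp (\<beta> * quad N d (vec_index \<sigma>) X) / 2 ^ N)"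

lemma partition_sum_pos: "0 < partition_sum N \<beta> d X"
  unfolding partition_sum_def by (intro sum_pos finite_spins spins_nonempty) auto

lemma spin_form_eq_quad:
  assumes A: "A \<in> carrier_mat N N" and \<sigma>: "\<sigma> \<in> carrier_vec N"
  shows "scalar_prod \<sigma> ((A * mat_diag N d * transpose_mat A) *\<^sub>v \<sigma>) = quad N d (vec_index \<sigma>) (ent N A)"
proof -
  let ?B = "A * mat_diag N d * transpose_mat A"
  have B: "?B $$ (i, j) = (\<Sum>k<N. d k * A $$ (i, k) * A $$ (j, k))" if "i < N" "j < N" for i j
    using A that by (simp add: mat_diag_mult_right[OF A] scalar_prod_def lessThan_atLeast0 mult.commute)
  have "scalar_prod \<sigma> (?B *\<^sub>v \<sigma>) = (\<Sum>i<N. vec_index \<sigma> i * (\<Sum>j<N. ?B $$ (i, j) * vec_index \<sigma> j))"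
    using A \<sigma> by (auto simp: scalar_prod_def lessThan_atLeast0 intro!: sum.cong)
  also have "\<dots> = (\<Sum>i<N. \<Sum>j<N. \<Sum>k<N. d k * ((vec_index \<sigma> i * A $$ (i, k)) * (vec_index \<sigma> j * A $$ (j, k))))"
    by (simp add: B sum_distrib_left sum_distrib_right mult_ac)
  also have "\<dots> = (\<Sum>i<N. \<Sum>k<N. \<Sum>j<N. d k * ((vec_index \<sigma> i * A $$ (i, k)) * (vec_index \<sigma> j * A $$ (j, k))))"
    by (rule sum.cong[OF refl], rule sum.swap)
  also have "\<dots> = (\<Sum>k<N. \<Sum>i<N. \<Sum>j<N. d k * ((vec_index \<sigma> i * A $$ (i, k)) * (vec_index \<sigma> j * A $$ (j, k))))"
    by (rule sum.swap)
  also have "\<dots> = (\<Sum>k<N. d k * (\<Sum>p<N. vec_index \<sigma> p * A $$ (p, k))\<^sup>2)"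
  proof (rule sum.cong[OF refl])
    fix k
    have "(\<Sum>p<N. vec_index \<sigma> p * A $$ (p, k))\<^sup>2
        = (\<Sum>i<N. \<Sum>j<N. (vec_index \<sigma> i * A $$ (i, k)) * (vec_index \<sigma> j * A $$ (j, k)))"
      by (simp only: power2_eq_square sum_product)
    then show "(\<Sum>i<N. \<Sum>j<N. d k * ((vec_index \<sigma> i * A $$ (i, k)) * (vec_index \<sigma> j * A $$ (j, k))))
        = d k * (\<Sum>p<N. vec_index \<sigma> p * A $$ (p, k))\<^sup>2"
      by (simp only: sum_distrib_left)
  qed
  also have "\<dots> = quad N d (vec_index \<sigma>) (ent N A)"
    by (simp add: quad_def ent_def)
  finally show ?thesis .
qed

lemma Z_N_eq_partition_sum:
  "A \<in> carrier_mat N N \<Longrightarrow> Z_N N \<beta> A (mat_diag N d) = partition_sum N \<beta> d (ent N A)"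
  unfolding Z_N_def partition_sum_def sum_distrib_left
  by (intro sum.cong refl) (auto simp: spin_form_eq_quad spins_def)

lemma Phi_N_eq_partition_sum:
  "A \<in> carrier_mat N N \<Longrightarrow> Phi_N N \<beta> A (mat_diag N d) = ln (partition_sum N \<beta> d (ent N A)) / real N"
  by (simp add: Phi_N_def Z_N_eq_partition_sum)

lemma partition_sum_le_exp_mult:
  assumes "\<And>\<sigma>. \<sigma> \<in> spins N \<Longrightarrow> \<beta> * quad N d (vec_index \<sigma>) X \<le> \<beta> * quad N e (vec_index \<sigma>) Y + c"
  shows "partition_sum N \<beta> d X \<le> exp c * partition_sum N \<beta> e Y"
  unfolding partition_sum_def sum_distrib_left
proof (rule sum_mono)
  fix \<sigma> assume "\<sigma> \<in> spins N"
  then have "exp (\<beta> * quad N d (vec_index \<sigma>) X) \<le> exp (\<beta> * quad N e (vec_index \<sigma>) Y + c)"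
    using assms by simp
  then show "exp (\<beta> * quad N d (vec_index \<sigma>) X) / 2 ^ N \<le> exp c * (exp (\<beta> * quad N e (vec_index \<sigma>) Y) / 2 ^ N)"
    by (simp add: exp_add divide_right_mono mult.commute)
qed

lemma ln_partition_sum_le:
  assumes "\<And>\<sigma>. \<sigma> \<in> spins N \<Longrightarrow> \<beta> * quad N d (vec_index \<sigma>) X \<le> \<beta> * quad N e (vec_index \<sigma>) Y + c"
  shows "ln (partition_sum N \<beta> d X) \<le> ln (partition_sum N \<beta> e Y) + c"
proof -
  have "ln (partition_sum N \<beta> d X) \<le> ln (exp c * partition_sum N \<beta> e Y)"
    using partition_sum_le_exp_mult[OF assms] partition_sum_pos by (subst ln_le_cancel_iff) auto
  then show ?thesis using partition_sum_pos[of N \<beta> e Y] by (simp add: ln_mult)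
qed

text \<open>A spin vector has squared norm \<open>N\<close>, so the two forms differ by at most
  \<open>c * N\<close> uniformly in the spins; dividing by \<open>N\<close> leaves a dimension-free
  constant.\<close>

lemma Phi_N_lipschitz:
  assumes A: "A \<in> orthogonal_group N" and N: "0 < N" and \<beta>: "0 \<le> \<beta>"
    and d: "\<And>k. k < N \<Longrightarrow> \<bar>d k - e k\<bar> \<le> c"
  shows "\<bar>Phi_N N \<beta> A (mat_diag N d) - Phi_N N \<beta> A (mat_diag N e)\<bar> \<le> \<beta> * c"
proof -
  have X: "ent N A \<in> orth_ents N" using A by (auto simp: orth_ents_def)
  have q: "\<bar>\<beta> * quad N d (vec_index \<sigma>) (ent N A) - \<beta> * quad N e (vec_index \<sigma>) (ent N A)\<bar> \<le> \<beta> * c * real N"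
    if "\<sigma> \<in> spins N" for \<sigma>
  proof -
    have "\<bar>\<beta> * quad N d (vec_index \<sigma>) (ent N A) - \<beta> * quad N e (vec_index \<sigma>) (ent N A)\<bar>
        = \<beta> * \<bar>quad N d (vec_index \<sigma>) (ent N A) - quad N e (vec_index \<sigma>) (ent N A)\<bar>"
      using \<beta> by (simp add: abs_mult flip: right_diff_distrib)
    also have "\<dots> \<le> \<beta> * (c * real N)"
      using quad_diff_le[OF X spin_fun_spins[OF that] d] \<beta> by (intro mult_left_mono) auto
    finally show ?thesis by simp
  qed
  have "ln (partition_sum N \<beta> d (ent N A)) \<le> ln (partition_sum N \<beta> e (ent N A)) + \<beta> * c * real N"
    by (rule ln_partition_sum_le) (use q in fastforce)
  moreover have "ln (partition_sum N \<beta> e (ent N A)) \<le> ln (partition_sum N \<beta> d (ent N A)) + \<beta> * c * real N"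
    by (rule ln_partition_sum_le) (use q in fastforce)
  ultimately have "\<bar>ln (partition_sum N \<beta> d (ent N A)) - ln (partition_sum N \<beta> e (ent N A))\<bar> \<le> \<beta> * c * real N"
    by (simp add: abs_le_iff)
  then show ?thesis
    using N A by (simp add: Phi_N_eq_partition_sum orthogonal_group_carrier field_simps flip: diff_divide_distrib)
qed

lemma weighted_cauchy_schwarz:
  fixes w u :: "'a \<Rightarrow> real"
  assumes "\<And>s. s \<in> S \<Longrightarrow> 0 \<le> w s"
  shows "(\<Sum>s\<in>S. w s * u s)\<^sup>2 \<le> (\<Sum>s\<in>S. w s) * (\<Sum>s\<in>S. w s * (u s)\<^sup>2)"
proof -
  have "(\<Sum>s\<in>S. sqrt (w s) * (sqrt (w s) * u s))\<^sup>2 \<le> (\<Sum>s\<in>S. (sqrt (w s))\<^sup>2) * (\<Sum>s\<in>S. (sqrt (w s) * u s)\<^sup>2)"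
    by (rule Cauchy_Schwarz_ineq_sum)
  moreover have "(\<Sum>s\<in>S. sqrt (w s) * (sqrt (w s) * u s)) = (\<Sum>s\<in>S. w s * u s)"
    using assms by (intro sum.cong) (auto simp flip: mult.assoc)
  ultimately show ?thesis using assms by (simp add: power_mult_distrib)
qed

section \<open>The free energy under Haar measure\<close>

context haar
begin

lemma measurable_partition_sum: "(\<lambda>x. partition_sum N \<beta> d (ent N x)) \<in> borel_measurable (orth_borel N)"
proof -
  have [measurable]: "(\<lambda>x. quad N d s (ent N x)) \<in> borel_measurable (orth_borel N)" for s
    by (rule measurable_polf) auto
  show ?thesis unfolding partition_sum_def by measurable
qed

lemma measurable_Phi_N: "(\<lambda>x. Phi_N N \<beta> x (mat_diag N d)) \<in> borel_measurable (orth_borel N)"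
proof -
  have "(\<lambda>x. ln (partition_sum N \<beta> d (ent N x)) / real N) \<in> borel_measurable (orth_borel N)"
    using measurable_partition_sum by measurable
  then show ?thesis
    by (rule measurable_cong[THEN iffD1, rotated])
      (auto simp: Phi_N_eq_partition_sum dest: orthogonal_group_carrier)
qed

lemma Phi_N_bounded: "\<exists>B. \<forall>x\<in>orthogonal_group N. \<bar>Phi_N N \<beta> x (mat_diag N d)\<bar> \<le> B"
proof -
  define M where "M = Max (insert 0 ((\<lambda>k. \<bar>d k\<bar>) ` {..<N}))"
  have M: "\<bar>d k\<bar> \<le> M" if "k < N" for k unfolding M_def using that by (intro Max_ge) auto
  define R where "R = \<bar>\<beta>\<bar> * (M * real N)"
  \<comment> \<open>A reference value: with zero diagonal and zero entries all exponents
    vanish.\<close>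
  define L where "L = ln (partition_sum N \<beta> (\<lambda>_. 0) (\<lambda>_ _. 0))"
  have "\<bar>Phi_N N \<beta> x (mat_diag N d)\<bar> \<le> (\<bar>L\<bar> + R) / real N" if x: "x \<in> orthogonal_group N" for x
  proof -
    have q: "\<bar>\<beta> * quad N d (vec_index \<sigma>) (ent N x)\<bar> \<le> R" if "\<sigma> \<in> spins N" for \<sigma>
      unfolding R_def abs_mult using quad_bound[OF ent_in[OF x] spin_fun_spins[OF that] M]
      by (intro mult_left_mono) auto
    have z: "\<beta> * quad N (\<lambda>_. 0) s (\<lambda>_ _. 0) = 0" for s by (simp add: quad_def)
    have "ln (partition_sum N \<beta> d (ent N x)) \<le> L + R" "L \<le> ln (partition_sum N \<beta> d (ent N x)) + R"
      unfolding L_def using q by (intro ln_partition_sum_le; fastforce simp: z abs_le_iff)+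
    then have "\<bar>ln (partition_sum N \<beta> d (ent N x))\<bar> \<le> \<bar>L\<bar> + R" by linarith
    then show ?thesis
      using x by (simp add: Phi_N_eq_partition_sum orthogonal_group_carrier divide_right_mono)
  qed
  then show ?thesis by blast
qed

lemma integrable_Phi_N: "integrable \<mu> (\<lambda>x. Phi_N N \<beta> x (mat_diag N d))"
proof -
  obtain B where "\<forall>x\<in>orthogonal_group N. \<bar>Phi_N N \<beta> x (mat_diag N d)\<bar> \<le> B"
    using Phi_N_bounded by blast
  then show ?thesis by (intro integrable_bounded[OF measurable_Phi_N, of _ _ B]) auto
qed

lemma Gamma_N_eq: "Gamma_N N \<beta> (mat_diag N d) = (\<integral>x. Phi_N N \<beta> x (mat_diag N d) \<partial>\<mu>)"
  by (simp add: Gamma_N_def Phi_N_def haar_prob_eqI[OF haar])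

lemma Gamma_N_lipschitz:
  assumes N: "0 < N" and \<beta>: "0 \<le> \<beta>" and d: "\<And>k. k < N \<Longrightarrow> \<bar>d k - e k\<bar> \<le> c"
  shows "\<bar>Gamma_N N \<beta> (mat_diag N d) - Gamma_N N \<beta> (mat_diag N e)\<bar> \<le> \<beta> * c"
proof -
  have "\<bar>\<integral>x. Phi_N N \<beta> x (mat_diag N d) - Phi_N N \<beta> x (mat_diag N e) \<partial>\<mu>\<bar>
      \<le> (\<integral>x. \<bar>Phi_N N \<beta> x (mat_diag N d) - Phi_N N \<beta> x (mat_diag N e)\<bar> \<partial>\<mu>)"
    by (rule integral_abs_bound)
  also have "\<dots> \<le> (\<integral>x. \<beta> * c \<partial>\<mu>)"
    using Phi_N_lipschitz[OF _ N \<beta> d]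
    by (intro integral_mono integrable_abs Bochner_Integration.integrable_diff integrable_Phi_N) auto
  finally show ?thesis
    using prob_space by (simp add: Gamma_N_eq integrable_Phi_N)
qed

text \<open>A permutation of the eigenvalues is absorbed into \<open>O\<close> by a permutation
  matrix on the right, which is where right invariance is used.\<close>

lemma Gamma_N_permute:
  assumes p: "p permutes {..<N}"
  shows "Gamma_N N \<beta> (mat_diag N (\<lambda>k. d (p k))) = Gamma_N N \<beta> (mat_diag N d)"
proof -
  define R where "R = mat N N (\<lambda>(i, j). if i = p j then 1 else 0 :: real)"
  have pin: "p j < N" if "j < N" for j
    using permutes_in_image[OF p, of j] that by auto
  have Rc: "R \<in> carrier_mat N N" by (simp add: R_def)
  have TR: "transpose_mat R * R = 1\<^sub>m N"
  proof (rule eq_matI)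
    fix i j assume "i < dim_row (1\<^sub>m N)" "j < dim_col (1\<^sub>m N)"
    then have ij: "i < N" "j < N" by auto
    have "(transpose_mat R * R) $$ (i, j) = (\<Sum>k<N. (if k = p i then 1 else 0) * (if k = p j then 1 else 0))"
      using ij by (simp add: R_def scalar_prod_def lessThan_atLeast0)
    also have "\<dots> = (\<Sum>k<N. if k = p i then if p i = p j then 1 else 0 else 0)"
      by (intro sum.cong) auto
    also have "\<dots> = (if i = j then 1 else 0)"
      using pin[OF ij(1)] inj_eq[OF permutes_inj[OF p]] by simp
    finally show "(transpose_mat R * R) $$ (i, j) = 1\<^sub>m N $$ (i, j)" using ij by simp
  qed (use Rc in auto)
  have "R * transpose_mat R = 1\<^sub>m N"
    using mat_mult_left_right_inverse[OF _ Rc TR] Rc by simp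
  then have RO: "R \<in> orthogonal_group N"
    using Rc TR by (simp add: orthogonal_group_def)
  have "Phi_N N \<beta> (x * R) (mat_diag N (\<lambda>k. d (p k))) = Phi_N N \<beta> x (mat_diag N d)"
    if x: "x \<in> orthogonal_group N" for x
  proof -
    have xc: "x \<in> carrier_mat N N" using x by (rule orthogonal_group_carrier)
    have ent: "ent N (x * R) i j = ent N x i (p j)" if "i < N" "j < N" for i j
    proof -
      have "ent N (x * R) i j = (\<Sum>k<N. if k = p j then ent N x i k else 0)"
        unfolding ent_mult[OF xc Rc that]
        by (intro sum.cong refl) (use that in \<open>simp add: R_def ent_def\<close>)
      then show ?thesis using pin[OF that(2)] by simp
    qed
    have "quad N (\<lambda>k. d (p k)) s (ent N (x * R)) = quad N d s (ent N x)" for s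
    proof -
      have "quad N (\<lambda>k. d (p k)) s (ent N (x * R)) = (\<Sum>k<N. d (p k) * (\<Sum>i<N. s i * ent N x i (p k))\<^sup>2)"
        by (simp add: quad_def ent)
      also have "\<dots> = quad N d s (ent N x)"
        unfolding quad_def
        using sum.permute[OF p, of "\<lambda>k. d k * (\<Sum>i<N. s i * ent N x i k)\<^sup>2"] by (simp add: o_def)
      finally show ?thesis .
    qed
    then show ?thesis
      using xc Rc by (simp add: Phi_N_eq_partition_sum partition_sum_def)
  qed
  then have "(\<integral>x. Phi_N N \<beta> (x * R) (mat_diag N (\<lambda>k. d (p k))) \<partial>\<mu>) = (\<integral>x. Phi_N N \<beta> x (mat_diag N d) \<partial>\<mu>)"
    by (intro Bochner_Integration.integral_cong) auto
  then show ?thesis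
    using integral_right_mult[OF RO measurable_Phi_N, of \<beta> "\<lambda>k. d (p k)"] by (simp add: Gamma_N_eq)
qed

text \<open>The gradient of \<open>ln Z\<close> is the Gibbs average of the gradients of the
  exponents. Cauchy-Schwarz with the Gibbs weights bounds its square by the average of the squares,
  so \<open>quad_gradient\<close> applies; its \<open>N^2\<close> is cancelled by the normalisation
  \<open>1 / N\<close> of the free energy, and \<open>128 = 8 * 16\<close>.\<close>

lemma variance_Phi_N:
  assumes N: "3 \<le> N" and \<beta>: "0 \<le> \<beta>" and d: "\<And>k. k < N \<Longrightarrow> \<bar>d k\<bar> \<le> M"
  shows "(\<integral>x. (Phi_N N \<beta> x (mat_diag N d) - Gamma_N N \<beta> (mat_diag N d))\<^sup>2 \<partial>\<mu>)
    \<le> 128 * \<beta>\<^sup>2 * M\<^sup>2 / (real N - 2)"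
proof -
  let ?q = "\<lambda>\<sigma>. quad N d (vec_index \<sigma>)"
  have M0: "0 \<le> M" using d[of 0] N by linarith
  define R where "R = M * real N"
  have qR: "?q \<sigma> X \<in> {- R..R}" if "\<sigma> \<in> spins N" "X \<in> orth_ents N" for \<sigma> X
    using quad_bound[OF that(2) spin_fun_spins[OF that(1)], of d M] d by (auto simp: R_def abs_le_iff)
  have R0: "0 \<le> R" using M0 by (simp add: R_def)
  have Dq: "\<bar>D i j (?q \<sigma>) X\<bar> \<le> 4 * real N * M"
    if "\<sigma> \<in> spins N" "X \<in> orth_ents N" and ij: "i < N" "j < N" for \<sigma> X i j
  proof -
    have "(D i j (?q \<sigma>) X)\<^sup>2 \<le> (\<Sum>j<N. (D i j (?q \<sigma>) X)\<^sup>2)"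
      using ij by (intro member_le_sum[of j _ "\<lambda>j. (D i j (?q \<sigma>) X)\<^sup>2"]) auto
    also have "\<dots> \<le> (\<Sum>i<N. \<Sum>j<N. (D i j (?q \<sigma>) X)\<^sup>2)"
      using ij by (intro member_le_sum[of i _ "\<lambda>i. \<Sum>j<N. (D i j (?q \<sigma>) X)\<^sup>2"] sum_nonneg) auto
    also have "\<dots> \<le> (4 * real N * M)\<^sup>2"
      using quad_gradient[OF that(2) spin_fun_spins[OF that(1)] d] by (simp add: power_mult_distrib)
    finally have "\<bar>D i j (?q \<sigma>) X\<bar> \<le> \<bar>4 * real N * M\<bar>" by (simp only: abs_le_square_iff)
    then show ?thesis using M0 by simp
  qed
  define w where "w \<sigma> X = exp (\<beta> * ?q \<sigma> X) / 2 ^ N" for \<sigma> X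
  have w: "w \<sigma> X > 0" for \<sigma> X by (simp add: w_def)
  have partition_sum: "partition_sum N \<beta> d = (\<lambda>X. \<Sum>\<sigma>\<in>spins N. w \<sigma> X)"
    by (simp add: partition_sum_def w_def fun_eq_iff)
  define G where "G i j X = (\<Sum>\<sigma>\<in>spins N. \<beta> * w \<sigma> X * D i j (?q \<sigma>) X)" for i j X
  have "C1lim N (\<lambda>X. exp (\<beta> * ?q \<sigma> X) / 2 ^ N) (\<lambda>i j X. \<beta> * (exp (\<beta> * ?q \<sigma> X) / 2 ^ N) * D i j (?q \<sigma>) X)"
    if "\<sigma> \<in> spins N" for \<sigma>
    using qR[OF that] Dq[OF that] R0
    by (intro C1lim_compose[where \<phi> = "\<lambda>t. exp (\<beta> * t) / 2 ^ N" and \<phi>' = "\<lambda>t. \<beta> * (exp (\<beta> * t) / 2 ^ N)"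
          and a = "- R" and b = R and a' = "- R - 1" and b' = "R + 1" and B = "4 * real N * M"]
        C1lim_polf polf_quad quad_colflip)
      (auto intro!: derivative_eq_intros continuous_intros)
  then have Z: "C1lim N (partition_sum N \<beta> d) G"
    unfolding partition_sum G_def w_def by (intro C1lim_sum finite_spins)
  define K where "K = real (card (spins N))"
  have K: "K > 0" using finite_spins[of N] spins_nonempty[of N] by (simp add: K_def card_gt_0_iff)
  \<comment> \<open>Bounds for the partition sum on \<open>O(N)\<close>. It stays away from 0, so
    \<open>ln\<close> has a continuous derivative on \<open>{z0 / 2..z1 + 1}\<close>.\<close>
  define z0 z1 where "z0 = K * (exp (- (\<beta> * R)) / 2 ^ N)" and "z1 = K * (exp (\<beta> * R) / 2 ^ N)"
  have z0: "z0 > 0" using K by (simp add: z0_def)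
  have wb: "exp (- (\<beta> * R)) / 2 ^ N \<le> w \<sigma> X" "w \<sigma> X \<le> exp (\<beta> * R) / 2 ^ N"
    if "\<sigma> \<in> spins N" "X \<in> orth_ents N" for \<sigma> X
  proof -
    have "- (\<beta> * R) \<le> \<beta> * ?q \<sigma> X" "\<beta> * ?q \<sigma> X \<le> \<beta> * R"
      using qR[OF that] \<beta> mult_left_mono[of "- R" "?q \<sigma> X" \<beta>] mult_left_mono[of "?q \<sigma> X" R \<beta>] by auto
    then show "exp (- (\<beta> * R)) / 2 ^ N \<le> w \<sigma> X" "w \<sigma> X \<le> exp (\<beta> * R) / 2 ^ N"
      by (auto simp: w_def divide_right_mono)
  qed
  have Zr: "partition_sum N \<beta> d X \<in> {z0..z1}" if "X \<in> orth_ents N" for X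
    using sum_bounded_below[of "spins N", OF wb(1)[OF _ that]] sum_bounded_above[of "spins N", OF wb(2)[OF _ that]]
    by (simp add: partition_sum z0_def z1_def K_def)
  obtain x0 where "x0 \<in> orthogonal_group N" using not_empty by auto
  then have z01: "z0 \<le> z1" using Zr[of "ent N x0"] by auto
  have GB: "\<bar>G i j X\<bar> \<le> K * (\<beta> * (exp (\<beta> * R) / 2 ^ N) * (4 * real N * M))"
    if X: "X \<in> orth_ents N" and ij: "i < N" "j < N" for i j X
  proof -
    have "\<bar>G i j X\<bar> \<le> (\<Sum>\<sigma>\<in>spins N. \<bar>\<beta> * w \<sigma> X * D i j (?q \<sigma>) X\<bar>)"
      unfolding G_def by (rule sum_abs)
    also have "\<dots> \<le> (\<Sum>\<sigma>\<in>spins N. \<beta> * (exp (\<beta> * R) / 2 ^ N) * (4 * real N * M))"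
    proof (rule sum_mono)
      fix \<sigma> assume \<sigma>: "\<sigma> \<in> spins N"
      have "\<bar>\<beta> * w \<sigma> X * D i j (?q \<sigma>) X\<bar> = \<beta> * w \<sigma> X * \<bar>D i j (?q \<sigma>) X\<bar>"
        using \<beta> w[of \<sigma> X] by (simp add: abs_mult)
      also have "\<dots> \<le> \<beta> * (exp (\<beta> * R) / 2 ^ N) * (4 * real N * M)"
        using wb[OF \<sigma> X] Dq[OF \<sigma> X ij] \<beta> M0 w[of \<sigma> X] by (intro mult_mono mult_left_mono) auto
      finally show "\<bar>\<beta> * w \<sigma> X * D i j (?q \<sigma>) X\<bar> \<le> \<beta> * (exp (\<beta> * R) / 2 ^ N) * (4 * real N * M)" .
    qed
    finally show ?thesis by (simp add: K_def)
  qed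
  have F: "C1lim N (\<lambda>X. ln (partition_sum N \<beta> d X) / real N) (\<lambda>i j X. 1 / (partition_sum N \<beta> d X * real N) * G i j X)"
  proof (rule C1lim_compose[OF Z Zr GB])
    show "z0 / 2 < z0" "z0 \<le> z1" "z1 < z1 + 1" using z0 z01 by auto
    show "((\<lambda>t. ln t / real N) has_real_derivative 1 / (t * real N)) (at t within {z0 / 2..z1 + 1})"
      if "t \<in> {z0 / 2..z1 + 1}" for t
      using that z0 N by (auto intro!: derivative_eq_intros)
    show "continuous_on {z0 / 2..z1 + 1} (\<lambda>t. 1 / (t * real N))"
      using z0 N by (intro continuous_intros) auto
  qed
  have grad: "(\<Sum>i<N. \<Sum>j<N. (1 / (partition_sum N \<beta> d X * real N) * G i j X)\<^sup>2) \<le> 16 * \<beta>\<^sup>2 * M\<^sup>2"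
    if X: "X \<in> orth_ents N" for X
  proof -
    define z where "z = partition_sum N \<beta> d X"
    have z: "z > 0" unfolding z_def by (rule partition_sum_pos)
    have zw: "z = (\<Sum>\<sigma>\<in>spins N. w \<sigma> X)" by (simp add: z_def partition_sum)
    \<comment> \<open>The squared prefactor of the weighted sum, times the total weight
      \<open>z\<close> that Cauchy-Schwarz contributes.\<close>
    define c where "c = (\<beta> / (z * real N))\<^sup>2 * z"
    have c0: "c \<ge> 0" using z by (simp add: c_def)
    have "(\<Sum>i<N. \<Sum>j<N. (1 / (z * real N) * G i j X)\<^sup>2)
        \<le> (\<Sum>i<N. \<Sum>j<N. c * (\<Sum>\<sigma>\<in>spins N. w \<sigma> X * (D i j (?q \<sigma>) X)\<^sup>2))"
    proof (rule sum_mono, rule sum_mono)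
      fix i j
      have "(1 / (z * real N) * G i j X)\<^sup>2 = (\<beta> / (z * real N))\<^sup>2 * (\<Sum>\<sigma>\<in>spins N. w \<sigma> X * D i j (?q \<sigma>) X)\<^sup>2"
        by (simp add: G_def mult.assoc power_mult_distrib power_divide flip: sum_distrib_left)
      also have "\<dots> \<le> (\<beta> / (z * real N))\<^sup>2 * (z * (\<Sum>\<sigma>\<in>spins N. w \<sigma> X * (D i j (?q \<sigma>) X)\<^sup>2))"
      proof (rule mult_left_mono)
        show "(\<Sum>\<sigma>\<in>spins N. w \<sigma> X * D i j (?q \<sigma>) X)\<^sup>2 \<le> z * (\<Sum>\<sigma>\<in>spins N. w \<sigma> X * (D i j (?q \<sigma>) X)\<^sup>2)"
          unfolding zw by (rule weighted_cauchy_schwarz) (rule less_imp_le[OF w])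
      qed simp
      finally show "(1 / (z * real N) * G i j X)\<^sup>2 \<le> c * (\<Sum>\<sigma>\<in>spins N. w \<sigma> X * (D i j (?q \<sigma>) X)\<^sup>2)"
        by (simp add: c_def mult.assoc)
    qed
    also have "\<dots> = c * (\<Sum>\<sigma>\<in>spins N. w \<sigma> X * (\<Sum>i<N. \<Sum>j<N. (D i j (?q \<sigma>) X)\<^sup>2))"
    proof -
      have "(\<Sum>i<N. \<Sum>j<N. \<Sum>\<sigma>\<in>spins N. w \<sigma> X * (D i j (?q \<sigma>) X)\<^sup>2)
          = (\<Sum>i<N. \<Sum>\<sigma>\<in>spins N. \<Sum>j<N. w \<sigma> X * (D i j (?q \<sigma>) X)\<^sup>2)"
        by (rule sum.cong[OF refl], rule sum.swap)
      also have "\<dots> = (\<Sum>\<sigma>\<in>spins N. \<Sum>i<N. \<Sum>j<N. w \<sigma> X * (D i j (?q \<sigma>) X)\<^sup>2)"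
        by (rule sum.swap)
      finally show ?thesis by (simp only: sum_distrib_left[symmetric])
    qed
    also have "\<dots> \<le> c * (\<Sum>\<sigma>\<in>spins N. w \<sigma> X * (16 * (real N)\<^sup>2 * M\<^sup>2))"
      using w quad_gradient[OF X spin_fun_spins d] c0
      by (intro mult_left_mono sum_mono) (auto intro: less_imp_le)
    also have "\<dots> = c * (z * (16 * (real N)\<^sup>2 * M\<^sup>2))"
      unfolding zw by (simp only: sum_distrib_right)
    also have "\<dots> = 16 * \<beta>\<^sup>2 * M\<^sup>2"
      using z N by (simp add: c_def power2_eq_square field_simps)
    finally show ?thesis by (simp add: z_def)
  qed
  obtain B where B: "\<And>x. x \<in> orthogonal_group N \<Longrightarrow> \<bar>Phi_N N \<beta> x (mat_diag N d)\<bar> \<le> B"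
    using Phi_N_bounded by blast
  have bound: "\<bar>ln (partition_sum N \<beta> d X) / real N\<bar> \<le> B" if "X \<in> orth_ents N" for X
    using that B by (auto simp: orth_ents_def Phi_N_eq_partition_sum orthogonal_group_carrier)
  have meanF: "mean (\<lambda>X. ln (partition_sum N \<beta> d X) / real N) = Gamma_N N \<beta> (mat_diag N d)"
    unfolding mean_def Gamma_N_eq
    by (rule Bochner_Integration.integral_cong) (auto simp: Phi_N_eq_partition_sum orthogonal_group_carrier)
  have "(\<integral>x. (Phi_N N \<beta> x (mat_diag N d) - Gamma_N N \<beta> (mat_diag N d))\<^sup>2 \<partial>\<mu>)
      = (\<integral>x. (ln (partition_sum N \<beta> d (ent N x)) / real N - mean (\<lambda>X. ln (partition_sum N \<beta> d X) / real N))\<^sup>2 \<partial>\<mu>)"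
    unfolding meanF
    by (rule Bochner_Integration.integral_cong) (auto simp: Phi_N_eq_partition_sum orthogonal_group_carrier)
  also have "\<dots> \<le> 8 / (real N - 2) * (16 * \<beta>\<^sup>2 * M\<^sup>2)"
    using measurable_partition_sum by (intro C1lim_poincare[OF N F _ bound grad]) auto
  finally show ?thesis by simp
qed

end

subsection \<open>Wasserstein distance of empirical measures\<close>

lemma empirical_measure_eq_distr:
  assumes N: "0 < N"
  shows "empirical_measure N (mat_diag N a) = distr (uniform_count_measure {..<N}) borel a"
proof (rule measure_eqI)
  fix B assume "B \<in> sets (empirical_measure N (mat_diag N a))"
  then have B: "B \<in> sets borel" by simp
  have "emeasure (distr (uniform_count_measure {..<N}) borel a) B
      = emeasure (uniform_count_measure {..<N}) {i \<in> {..<N}. a i \<in> B}"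
    using B by (subst emeasure_distr)
      (auto simp: space_uniform_count_measure vimage_def intro!: arg_cong2[of _ _ _ _ emeasure])
  also have "\<dots> = ennreal (real (card {i \<in> {..<N}. a i \<in> B}) / real N)"
    by (subst emeasure_uniform_count_measure) auto
  also have "\<dots> = ennreal (1 / real N) * ennreal (\<Sum>i<N. indicator B (a i))"
    by (simp add: ennreal_mult[symmetric] indicator_def sum.If_cases Int_def conj_commute)
  also have "ennreal (\<Sum>i<N. indicator B (a i)) = (\<Sum>i<N. emeasure (return borel (mat_diag N a $$ (i, i))) B)"
    using B by (subst sum_ennreal[symmetric]) (auto simp: mat_diag_def ennreal_indicator intro!: sum.cong)
  finally show "emeasure (empirical_measure N (mat_diag N a)) B = emeasure (distr (uniform_count_measure {..<N}) borel a) B"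
    using B by (simp add: emeasure_empirical_measure)
qed simp

lemma empirical_measure_permute:
  assumes "p permutes {..<N}"
  shows "empirical_measure N (mat_diag N (\<lambda>i. a (p i))) = empirical_measure N (mat_diag N a)"
proof (rule measure_eqI)
  fix B assume "B \<in> sets (empirical_measure N (mat_diag N (\<lambda>i. a (p i))))"
  then have B: "B \<in> sets borel" by simp
  have "(\<Sum>i<N. emeasure (return borel (mat_diag N (\<lambda>i. a (p i)) $$ (i, i))) B)
      = (\<Sum>i<N. emeasure (return borel (a (p i))) B)"
    by (intro sum.cong) (auto simp: mat_diag_def)
  also have "\<dots> = (\<Sum>i<N. emeasure (return borel (a i)) B)"
    using sum.permute[OF assms, of "\<lambda>i. emeasure (return borel (a i)) B"] by (simp add: o_def)
  also have "\<dots> = (\<Sum>i<N. emeasure (return borel (mat_diag N a $$ (i, i))) B)"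
    by (intro sum.cong) (auto simp: mat_diag_def)
  finally show "emeasure (empirical_measure N (mat_diag N (\<lambda>i. a (p i)))) B = emeasure (empirical_measure N (mat_diag N a)) B"
    using B by (simp add: emeasure_empirical_measure)
qed simp

lemma sorting_permutation:
  fixes a :: "nat \<Rightarrow> real"
  shows "\<exists>p. p permutes {..<N} \<and> (\<forall>i j. i \<le> j \<longrightarrow> j < N \<longrightarrow> a (p i) \<le> a (p j))"
proof -
  let ?xs = "map a [0..<N]"
  have "mset (sort ?xs) = mset ?xs" by simp
  then obtain p where p: "p permutes {..<length ?xs}" "permute_list p ?xs = sort ?xs"
    by (rule mset_eq_permutation)
  have nth: "sort ?xs ! i = a (p i)" if "i < N" for i
    using permute_list_nth[OF p(1), of i] permutes_in_image[OF p(1), of i] that by (simp add: p(2))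
  have "a (p i) \<le> a (p j)" if "i \<le> j" "j < N" for i j
    using sorted_nth_mono[OF sorted_sort[of ?xs] that(1)] that by (simp add: nth)
  then show ?thesis using p(1) by auto
qed

text \<open>The dual potentials of the monotone coupling.\<close>

lemma monotone_potentials:
  fixes A B :: "nat \<Rightarrow> real"
  assumes A: "\<And>i j. i \<le> j \<Longrightarrow> j < N \<Longrightarrow> A i \<le> A j" and B: "\<And>i j. i \<le> j \<Longrightarrow> j < N \<Longrightarrow> B i \<le> B j"
  shows "\<exists>u. \<forall>i<N. \<forall>j<N. A i * B j \<le> u i + (A j * B j - u j)"
proof -
  \<comment> \<open>A discrete integral of \<open>B\<close> against \<open>dA\<close>. Between
    \<open>i\<close> and \<open>j\<close> the integrand is compared with its value at
    \<open>j\<close>, which by monotonicity errs in the right direction in both orders.\<close>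
  define u where "u i = (\<Sum>k<i. B k * (A (Suc k) - A k))" for i
  have split: "u j = u i + (\<Sum>k=i..<j. B k * (A (Suc k) - A k))" if "i \<le> j" for i j
    unfolding u_def lessThan_atLeast0
    by (rule sum.atLeastLessThan_concat[symmetric]) (use that in auto)
  have tele: "A j - A i = (\<Sum>k=i..<j. A (Suc k) - A k)" if "i \<le> j" for i j
    using that by (simp add: sum_Suc_diff')
  have "A i * B j \<le> u i + (A j * B j - u j)" if ij: "i < N" "j < N" for i j
  proof (cases "i \<le> j")
    case True
    have "u j - u i \<le> (\<Sum>k=i..<j. B j * (A (Suc k) - A k))"
      unfolding split[OF True] using A B ij
      by (auto intro!: sum_mono mult_right_mono)
    also have "\<dots> = B j * (A j - A i)" unfolding tele[OF True] by (simp add: sum_distrib_left)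
    finally show ?thesis by (simp add: algebra_simps)
  next
    case False
    then have ji: "j \<le> i" by simp
    have "(\<Sum>k=j..<i. B j * (A (Suc k) - A k)) \<le> u i - u j"
      unfolding split[OF ji] using A B ij
      by (auto intro!: sum_mono mult_right_mono)
    moreover have "(\<Sum>k=j..<i. B j * (A (Suc k) - A k)) = B j * (A i - A j)"
      unfolding tele[OF ji] by (simp add: sum_distrib_left)
    ultimately show ?thesis by (simp add: algebra_simps)
  qed
  then show ?thesis by blast
qed

text \<open>Weak Kantorovich duality: if \<open>\<phi> x + \<psi> y \<le> (x - y)^2\<close> almost
  everywhere, the cost of a coupling is bounded below by a quantity that depends on the marginals
  only. The potentials are chosen so that this quantity is at least the cost of the sorted
  matching.\<close>

lemma coupling_cost_ge:
  assumes N: "0 < N"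
    and \<pi>: "\<pi> \<in> couplings (empirical_measure N (mat_diag N a)) (empirical_measure N (mat_diag N b))"
  shows "\<exists>p. p permutes {..<N} \<and> ennreal ((\<Sum>i<N. (a i - b (p i))\<^sup>2) / real N) \<le> (\<integral>\<^sup>+(x, y). ennreal ((x - y)\<^sup>2) \<partial>\<pi>)"
proof -
  obtain p where p: "p permutes {..<N}" "\<And>i j. i \<le> j \<Longrightarrow> j < N \<Longrightarrow> a (p i) \<le> a (p j)"
    using sorting_permutation[of N a] by auto
  obtain q where q: "q permutes {..<N}" "\<And>i j. i \<le> j \<Longrightarrow> j < N \<Longrightarrow> b (q i) \<le> b (q j)"
    using sorting_permutation[of N b] by auto
  define A B where "A i = a (p i)" and "B i = b (q i)" for i
  have "\<exists>u. \<forall>i<N. \<forall>j<N. A i * B j \<le> u i + (A j * B j - u j)"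
    by (rule monotone_potentials) (simp_all add: A_def B_def p(2) q(2))
  then obtain u where "\<forall>i<N. \<forall>j<N. A i * B j \<le> u i + (A j * B j - u j)" by (elim exE)
  then have u: "A i * B j \<le> u i + (A j * B j - u j)" if "i < N" "j < N" for i j
    using that by blast
  \<comment> \<open>Conjugation extends the potentials from the atoms to the real line; maxima of
    finitely many affine functions are measurable.\<close>
  define f where "f x = Max ((\<lambda>j. x * B j - (A j * B j - u j)) ` {..<N})" for x
  define g where "g y = Max ((\<lambda>i. A i * y - u i) ` {..<N})" for y
  have ne: "{..<N} \<noteq> {}" using N by auto
  have f: "f (A i) = u i" if i: "i < N" for i
    unfolding f_def
  proof (rule Max_eqI)
    show "u i \<in> (\<lambda>j. A i * B j - (A j * B j - u j)) ` {..<N}"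
      using i by (intro image_eqI[of _ _ i]) auto
  qed (use u[OF i] in force)+
  have g: "g (B j) \<le> A j * B j - u j" if j: "j < N" for j
    unfolding g_def using ne u[OF _ j] by (subst Max_le_iff) (auto simp: algebra_simps)
  have gle: "A i * y - u i \<le> g y" if "i < N" for i y
    unfolding g_def using that by (intro Max_ge) auto
  have [measurable]: "f \<in> borel_measurable borel" "g \<in> borel_measurable borel"
    unfolding f_def g_def by measurable
  define \<phi> where "\<phi> x = x\<^sup>2 - 2 * f x" for x
  define \<psi> where "\<psi> y = y\<^sup>2 - 2 * g y" for y
  have [measurable]: "\<phi> \<in> borel_measurable borel" "\<psi> \<in> borel_measurable borel"
    unfolding \<phi>_def \<psi>_def by measurable
  have p\<pi>: "prob_space \<pi>" and s\<pi> [measurable_cong]: "sets \<pi> = sets (borel \<Otimes>\<^sub>M borel)"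
    and m1: "distr \<pi> borel fst = distr (uniform_count_measure {..<N}) borel A"
    and m2: "distr \<pi> borel snd = distr (uniform_count_measure {..<N}) borel B"
    using \<pi> empirical_measure_permute[OF p(1), of a] empirical_measure_permute[OF q(1), of b]
      empirical_measure_eq_distr[OF N, of A] empirical_measure_eq_distr[OF N, of B]
    by (auto simp: couplings_def A_def[abs_def] B_def[abs_def])
  interpret \<pi>: prob_space \<pi> by (rule p\<pi>)
  let ?U = "uniform_count_measure {..<N}"
  have intU: "integrable ?U h" for h :: "nat \<Rightarrow> real"
    unfolding uniform_count_measure_def by (intro integrable_point_measure_finite) auto
  have i1: "integrable \<pi> (\<lambda>z. \<phi> (fst z))" "(\<integral>z. \<phi> (fst z) \<partial>\<pi>) = (\<Sum>i<N. \<phi> (A i)) / real N"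
  proof -
    have "integrable (distr \<pi> borel fst) \<phi>" unfolding m1 by (subst integrable_distr_eq) (auto intro: intU)
    then show "integrable \<pi> (\<lambda>z. \<phi> (fst z))" by (subst (asm) integrable_distr_eq) auto
    have "(\<integral>z. \<phi> (fst z) \<partial>\<pi>) = (\<integral>x. \<phi> x \<partial>distr \<pi> borel fst)" by (subst integral_distr) auto
    also have "\<dots> = (\<integral>i. \<phi> (A i) \<partial>?U)" unfolding m1 by (subst integral_distr) auto
    finally show "(\<integral>z. \<phi> (fst z) \<partial>\<pi>) = (\<Sum>i<N. \<phi> (A i)) / real N"
      by (simp add: integral_uniform_count_measure)
  qed
  have i2: "integrable \<pi> (\<lambda>z. \<psi> (snd z))" "(\<integral>z. \<psi> (snd z) \<partial>\<pi>) = (\<Sum>i<N. \<psi> (B i)) / real N"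
  proof -
    have "integrable (distr \<pi> borel snd) \<psi>" unfolding m2 by (subst integrable_distr_eq) (auto intro: intU)
    then show "integrable \<pi> (\<lambda>z. \<psi> (snd z))" by (subst (asm) integrable_distr_eq) auto
    have "(\<integral>z. \<psi> (snd z) \<partial>\<pi>) = (\<integral>x. \<psi> x \<partial>distr \<pi> borel snd)" by (subst integral_distr) auto
    also have "\<dots> = (\<integral>i. \<psi> (B i) \<partial>?U)" unfolding m2 by (subst integral_distr) auto
    finally show "(\<integral>z. \<psi> (snd z) \<partial>\<pi>) = (\<Sum>i<N. \<psi> (B i)) / real N"
      by (simp add: integral_uniform_count_measure)
  qed
  have [measurable]: "A ` {..<N} \<in> sets borel"
    by (intro borel_closed finite_imp_closed) auto
  \<comment> \<open>The pointwise inequality below rests on \<open>f (A i) = u i\<close>, so it is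
    available only at the atoms of the first marginal.\<close>
  have "AE x in distr \<pi> borel fst. x \<in> A ` {..<N}"
    unfolding m1 by (subst AE_distr_iff) (auto intro!: AE_I2 simp: space_uniform_count_measure)
  then have supp: "AE z in \<pi>. fst z \<in> A ` {..<N}"
    by (subst (asm) AE_distr_iff) auto
  have "(\<Sum>i<N. (A i - B i)\<^sup>2) \<le> (\<Sum>i<N. \<phi> (A i) + \<psi> (B i))"
  proof (rule sum_mono)
    fix i assume "i \<in> {..<N}"
    then have "i < N" by simp
    then show "(A i - B i)\<^sup>2 \<le> \<phi> (A i) + \<psi> (B i)"
      using f[of i] g[of i] by (simp add: \<phi>_def \<psi>_def power2_diff)
  qed
  then have "(\<Sum>i<N. (A i - B i)\<^sup>2) / real N \<le> (\<Sum>i<N. \<phi> (A i) + \<psi> (B i)) / real N"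
    by (rule divide_right_mono) simp
  also have "\<dots> = (\<integral>z. \<phi> (fst z) + \<psi> (snd z) \<partial>\<pi>)"
    using i1 i2 by (simp add: sum.distrib add_divide_distrib)
  finally have dual: "(\<Sum>i<N. (A i - B i)\<^sup>2) / real N \<le> (\<integral>z. \<phi> (fst z) + \<psi> (snd z) \<partial>\<pi>)" .
  have ae: "AE z in \<pi>. \<phi> (fst z) + \<psi> (snd z) \<le> (fst z - snd z)\<^sup>2"
    using supp
  proof eventually_elim
    case (elim z)
    then obtain i where i: "i < N" "fst z = A i" by auto
    have "A i * snd z \<le> f (A i) + g (snd z)"
      using gle[OF i(1), of "snd z"] f[OF i(1)] by linarith
    then show ?case
      unfolding i(2) by (simp add: \<phi>_def \<psi>_def power2_diff)
  qed
  let ?I = "\<integral>\<^sup>+z. ennreal ((fst z - snd z)\<^sup>2) \<partial>\<pi>"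
  have le: "ennreal ((\<Sum>i<N. (A i - B i)\<^sup>2) / real N) \<le> (\<integral>\<^sup>+(x, y). ennreal ((x - y)\<^sup>2) \<partial>\<pi>)"
  proof (cases "?I = \<infinity>")
    case False
    then have int: "integrable \<pi> (\<lambda>z. (fst z - snd z)\<^sup>2)"
      by (intro integrableI_nonneg) (auto simp: less_top)
    have "(\<integral>z. \<phi> (fst z) + \<psi> (snd z) \<partial>\<pi>) \<le> (\<integral>z. (fst z - snd z)\<^sup>2 \<partial>\<pi>)"
      using i1(1) i2(1) int ae by (intro integral_mono_AE) auto
    then have "ennreal ((\<Sum>i<N. (A i - B i)\<^sup>2) / real N) \<le> ennreal (\<integral>z. (fst z - snd z)\<^sup>2 \<partial>\<pi>)"
      using dual by (intro ennreal_leI) linarith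
    also have "\<dots> = ?I"
      using int by (intro nn_integral_eq_integral[symmetric]) auto
    finally show ?thesis by (simp add: case_prod_beta')
  qed (simp add: case_prod_beta')
  \<comment> \<open>Undoes the two sortings: index \<open>p i\<close> is matched with
    \<open>q i\<close>.\<close>
  define r where "r = q \<circ> inv_into UNIV p"
  have r: "r permutes {..<N}"
    unfolding r_def using p(1) q(1) by (intro permutes_compose permutes_inv)
  have "(\<Sum>i<N. (a i - b (r i))\<^sup>2) = (\<Sum>i<N. (a (p i) - b (r (p i)))\<^sup>2)"
    using sum.permute[OF p(1), of "\<lambda>i. (a i - b (r i))\<^sup>2"] by (simp add: o_def)
  also have "\<dots> = (\<Sum>i<N. (A i - B i)\<^sup>2)"
    by (simp add: A_def B_def r_def permutes_inverses(2)[OF p(1)])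
  finally show ?thesis using r le by (intro exI[of _ r]) simp
qed

lemma permutation_coupling:
  assumes N: "0 < N" and p: "p permutes {..<N}"
  shows "\<exists>\<pi>\<in>couplings (empirical_measure N (mat_diag N a)) (empirical_measure N (mat_diag N b)).
    (\<integral>\<^sup>+(x, y). ennreal ((x - y)\<^sup>2) \<partial>\<pi>) = ennreal ((\<Sum>i<N. (a i - b (p i))\<^sup>2) / real N)"
proof
  let ?U = "uniform_count_measure {..<N}"
  define \<pi> where "\<pi> = distr ?U (borel \<Otimes>\<^sub>M borel) (\<lambda>i. (a i, b (p i)))"
  have [measurable]: "h \<in> borel_measurable ?U" for h :: "nat \<Rightarrow> real"
    unfolding measurable_cong_sets[OF sets_uniform_count_measure_count_space refl] by simp
  interpret U: prob_space ?U
    using N by (intro prob_space_uniform_count_measure) auto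
  show "\<pi> \<in> couplings (empirical_measure N (mat_diag N a)) (empirical_measure N (mat_diag N b))"
    unfolding couplings_def
  proof (intro CollectI conjI)
    show "prob_space \<pi>"
      unfolding \<pi>_def by (rule U.prob_space_distr) auto
    show "sets \<pi> = sets (borel \<Otimes>\<^sub>M borel)" by (simp add: \<pi>_def)
    show "distr \<pi> borel fst = empirical_measure N (mat_diag N a)"
      unfolding \<pi>_def empirical_measure_eq_distr[OF N]
      by (subst distr_distr) (auto simp: o_def)
    show "distr \<pi> borel snd = empirical_measure N (mat_diag N b)"
      unfolding \<pi>_def
      by (subst empirical_measure_permute[OF p, of b, symmetric], subst empirical_measure_eq_distr[OF N],
          subst distr_distr) (auto simp: o_def)
  qed
  have "(\<integral>\<^sup>+(x, y). ennreal ((x - y)\<^sup>2) \<partial>\<pi>) = (\<integral>\<^sup>+i. ennreal ((a i - b (p i))\<^sup>2) \<partial>?U)"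
    unfolding \<pi>_def by (subst nn_integral_distr) auto
  also have "\<dots> = (\<Sum>i<N. ennreal (1 / real N) * ennreal ((a i - b (p i))\<^sup>2))"
    unfolding uniform_count_measure_def by (subst nn_integral_point_measure_finite) auto
  also have "\<dots> = ennreal ((\<Sum>i<N. (a i - b (p i))\<^sup>2) / real N)"
    by (simp add: ennreal_mult[symmetric] sum_ennreal sum_divide_distrib)
  finally show "(\<integral>\<^sup>+(x, y). ennreal ((x - y)\<^sup>2) \<partial>\<pi>) = ennreal ((\<Sum>i<N. (a i - b (p i))\<^sup>2) / real N)" .
qed

text \<open>Apart from the matching, this gives measurability of the \<open>W2\<close> event: a
  finite minimum replaces the infimum over couplings.\<close>

theorem W2_empirical_measure:
  assumes N: "0 < N"
  shows "W2 (empirical_measure N (mat_diag N a)) (empirical_measure N (mat_diag N b))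
    = sqrt (MIN p\<in>{p. p permutes {..<N}}. (\<Sum>i<N. (a i - b (p i))\<^sup>2) / real N)"
proof -
  let ?c = "\<lambda>p. (\<Sum>i<N. (a i - b (p i))\<^sup>2) / real N" and ?P = "{p. p permutes {..<N}}"
  have fin: "finite ?P" "?P \<noteq> {}"
    using finite_permutations[of "{..<N}"] permutes_id[of "{..<N}"] by blast+
  define m where "m = Min (?c ` ?P)"
  have "m \<in> ?c ` ?P" unfolding m_def using fin by (intro Min_in) auto
  then obtain p where p: "p permutes {..<N}" "m = ?c p" by auto
  have m0: "0 \<le> m" unfolding p(2) by (intro divide_nonneg_nonneg sum_nonneg) auto
  let ?C = "couplings (empirical_measure N (mat_diag N a)) (empirical_measure N (mat_diag N b))"
  have "(INF \<pi>\<in>?C. \<integral>\<^sup>+(x, y). ennreal ((x - y)\<^sup>2) \<partial>\<pi>) = ennreal m"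
  proof (rule antisym)
    show "(INF \<pi>\<in>?C. \<integral>\<^sup>+(x, y). ennreal ((x - y)\<^sup>2) \<partial>\<pi>) \<le> ennreal m"
      using permutation_coupling[OF N p(1), of a b] unfolding p(2) by (auto intro: INF_lower2)
    show "ennreal m \<le> (INF \<pi>\<in>?C. \<integral>\<^sup>+(x, y). ennreal ((x - y)\<^sup>2) \<partial>\<pi>)"
    proof (rule INF_greatest)
      fix \<pi> assume "\<pi> \<in> ?C"
      then obtain q where q: "q permutes {..<N}" "ennreal (?c q) \<le> (\<integral>\<^sup>+(x, y). ennreal ((x - y)\<^sup>2) \<partial>\<pi>)"
        using coupling_cost_ge[OF N] by blast
      have "m \<le> ?c q" unfolding m_def using fin q(1) by (intro Min_le) auto
      then show "ennreal m \<le> (\<integral>\<^sup>+(x, y). ennreal ((x - y)\<^sup>2) \<partial>\<pi>)"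
        using q(2) by (meson ennreal_leI order_trans)
    qed
  qed
  then show ?thesis using m0 by (simp add: W2_def m_def)
qed

lemma W2_empirical_matching:
  assumes N: "0 < N" and W: "W2 (empirical_measure N (mat_diag N a)) (empirical_measure N (mat_diag N b)) \<le> c / sqrt (real N)"
    and c: "0 \<le> c"
  shows "\<exists>p. p permutes {..<N} \<and> (\<forall>i<N. \<bar>a i - b (p i)\<bar> \<le> c)"
proof -
  let ?c = "\<lambda>p. (\<Sum>i<N. (a i - b (p i))\<^sup>2) / real N" and ?P = "{p. p permutes {..<N}}"
  have fin: "finite ?P" "?P \<noteq> {}"
    using finite_permutations[of "{..<N}"] permutes_id[of "{..<N}"] by blast+
  have "Min (?c ` ?P) \<in> ?c ` ?P" using fin by (intro Min_in) auto
  then obtain p where p: "p permutes {..<N}" "Min (?c ` ?P) = ?c p" by auto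
  have "sqrt (?c p) \<le> c / sqrt (real N)"
    using W unfolding W2_empirical_measure[OF N] p(2) .
  then have "(sqrt (?c p))\<^sup>2 \<le> (c / sqrt (real N))\<^sup>2"
    by (intro power_mono) (auto intro!: divide_nonneg_nonneg sum_nonneg)
  then have "(\<Sum>i<N. (a i - b (p i))\<^sup>2) \<le> c\<^sup>2"
    using N by (simp add: power_divide sum_nonneg field_simps)
  moreover have "(a i - b (p i))\<^sup>2 \<le> (\<Sum>i<N. (a i - b (p i))\<^sup>2)" if "i < N" for i
    using that by (intro member_le_sum[of i _ "\<lambda>i. (a i - b (p i))\<^sup>2"]) auto
  ultimately have "(a i - b (p i))\<^sup>2 \<le> c\<^sup>2" if "i < N" for i
    using that by (meson order_trans)
  then have "\<bar>a i - b (p i)\<bar> \<le> c" if "i < N" for i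
    using that c by (metis abs_le_square_iff abs_of_nonneg)
  with p(1) show ?thesis by blast
qed

subsection \<open>Convergence in probability\<close>

context haar
begin

lemma Phi_N_concentration:
  assumes N: "3 \<le> N" and \<beta>: "0 \<le> \<beta>" and \<epsilon>: "0 < \<epsilon>" and d: "\<And>k. k < N \<Longrightarrow> \<bar>d k\<bar> \<le> M"
  shows "measure \<mu> {x \<in> orthogonal_group N. \<bar>Phi_N N \<beta> x (mat_diag N d) - Gamma_N N \<beta> (mat_diag N d)\<bar> > \<epsilon>}
    \<le> 128 * \<beta>\<^sup>2 * M\<^sup>2 / ((real N - 2) * \<epsilon>\<^sup>2)"
proof -
  let ?F = "\<lambda>x. Phi_N N \<beta> x (mat_diag N d)"
  have m [measurable]: "?F \<in> borel_measurable \<mu>"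
    using measurable_Phi_N by measurable
  obtain B where B: "\<forall>x\<in>orthogonal_group N. \<bar>?F x\<bar> \<le> B" using Phi_N_bounded by blast
  have "integrable \<mu> (\<lambda>x. (?F x)\<^sup>2)"
  proof (rule integrable_bounded)
    show "(\<lambda>x. (?F x)\<^sup>2) \<in> borel_measurable (orth_borel N)"
      using measurable_Phi_N by measurable
    fix x assume "x \<in> orthogonal_group N"
    then have "\<bar>?F x\<bar>\<^sup>2 \<le> B\<^sup>2" using B by (intro power_mono) auto
    then show "\<bar>(?F x)\<^sup>2\<bar> \<le> B\<^sup>2" by simp
  qed
  then have "prob {x \<in> space \<mu>. \<epsilon> \<le> \<bar>?F x - expectation ?F\<bar>} \<le> variance ?F / \<epsilon>\<^sup>2"
    using \<epsilon> by (intro Chebyshev_inequality m) auto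
  also have "\<dots> \<le> (128 * \<beta>\<^sup>2 * M\<^sup>2 / (real N - 2)) / \<epsilon>\<^sup>2"
    using variance_Phi_N[OF N \<beta> d] by (intro divide_right_mono) (auto simp: Gamma_N_eq)
  finally have "prob {x \<in> space \<mu>. \<epsilon> \<le> \<bar>?F x - expectation ?F\<bar>} \<le> 128 * \<beta>\<^sup>2 * M\<^sup>2 / ((real N - 2) * \<epsilon>\<^sup>2)"
    by simp
  moreover have "prob {x \<in> orthogonal_group N. \<bar>?F x - Gamma_N N \<beta> (mat_diag N d)\<bar> > \<epsilon>}
      \<le> prob {x \<in> space \<mu>. \<epsilon> \<le> \<bar>?F x - expectation ?F\<bar>}"
  proof (rule finite_measure_mono)
    show "{x \<in> space \<mu>. \<epsilon> \<le> \<bar>?F x - expectation ?F\<bar>} \<in> events"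
      using m by measurable
  qed (auto simp: Gamma_N_eq)
  ultimately show ?thesis by linarith
qed

end

text \<open>Independence makes the joint law a product, and integrating over \<open>O\<close> first
  freezes the diagonal. Each section is empty or covered by \<open>Phi_N_concentration\<close>; the
  bound on the entries inside \<open>S\<close> makes this uniform.\<close>

lemma Phi_N_deviation_independent:
  fixes d :: "nat \<Rightarrow> 'a \<Rightarrow> real" and Q :: "'a \<Rightarrow> real mat" and M :: real
  assumes P: "prob_space P" and N: "3 \<le> N" and \<beta>: "0 \<le> \<beta>" and \<epsilon>: "0 < \<epsilon>"
    and haar: "is_haar_prob N (distr P (orth_borel N) Q)"
    and indep: "prob_space.indep_var P (orth_borel N) Q (mat_borel N) (\<lambda>\<omega>. mat_diag N (\<lambda>i. d i \<omega>))"
  defines "S \<equiv> {\<omega> \<in> space P. (\<forall>k<N. \<bar>d k \<omega>\<bar> \<le> M) \<and>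
      \<bar>Phi_N N \<beta> (Q \<omega>) (mat_diag N (\<lambda>i. d i \<omega>)) - Gamma_N N \<beta> (mat_diag N (\<lambda>i. d i \<omega>))\<bar> > \<epsilon>}"
  shows "S \<in> sets P" and "measure P S \<le> 128 * \<beta>\<^sup>2 * M\<^sup>2 / ((real N - 2) * \<epsilon>\<^sup>2)"
proof -
  interpret P: prob_space P by fact
  define \<mu> where "\<mu> = distr P (orth_borel N) Q"
  interpret haar N \<mu> using haar by unfold_locales (simp add: \<mu>_def)
  let ?D = "\<lambda>\<omega>. mat_diag N (\<lambda>i. d i \<omega>)"
  have Qm [measurable]: "Q \<in> P \<rightarrow>\<^sub>M orth_borel N" and Dm [measurable]: "?D \<in> P \<rightarrow>\<^sub>M mat_borel N"
    and joint: "\<mu> \<Otimes>\<^sub>M distr P (mat_borel N) ?D = distr P (orth_borel N \<Otimes>\<^sub>M mat_borel N) (\<lambda>\<omega>. (Q \<omega>, ?D \<omega>))"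
    using indep by (auto simp: P.indep_var_distribution_eq \<mu>_def)
  let ?\<nu> = "distr P (mat_borel N) ?D"
  interpret \<nu>: prob_space ?\<nu> by (rule P.prob_space_distr[OF Dm])
  interpret PP: pair_prob_space \<mu> ?\<nu> ..
  \<comment> \<open>The law of the random diagonal matrix is a measure on the space of all matrices;
    taking diagonal parts gives \<open>g\<close> and \<open>G\<close> the form of a free energy at
    every point of that space.\<close>
  let ?dg = "\<lambda>A. mat_diag N (\<lambda>k. A $$ (k, k))"
  define g where "g x A = Phi_N N \<beta> x (?dg A)" for x A
  have em [measurable]: "(\<lambda>A. A $$ (k, k)) \<in> borel_measurable (mat_borel N)" if "k < N" for k
    using that by (intro measurable_mat_borel_entry)
  have gm [measurable]: "(\<lambda>(x, A). g x A) \<in> borel_measurable (orth_borel N \<Otimes>\<^sub>M mat_borel N)"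
  proof -
    have q: "(\<lambda>z. quad N (\<lambda>k. snd z $$ (k, k)) s (ent N (fst z))) \<in> borel_measurable (orth_borel N \<Otimes>\<^sub>M mat_borel N)" for s
      unfolding quad_def
      by (intro borel_measurable_sum borel_measurable_times borel_measurable_power borel_measurable_const
          measurable_compose[OF measurable_snd em] measurable_compose[OF measurable_fst measurable_ent]) auto
    have "(\<lambda>z. ln (partition_sum N \<beta> (\<lambda>k. snd z $$ (k, k)) (ent N (fst z))) / real N) \<in> borel_measurable (orth_borel N \<Otimes>\<^sub>M mat_borel N)"
      unfolding partition_sum_def using q by measurable
    then show ?thesis
      by (rule measurable_cong[THEN iffD1, rotated])
        (auto simp: g_def Phi_N_eq_partition_sum space_pair_measure dest: orthogonal_group_carrier)
  qed
  define G where "G A = (\<integral>x. g x A \<partial>\<mu>)" for A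
  have [measurable]: "G \<in> borel_measurable (mat_borel N)"
  proof -
    have "(\<lambda>(A, x). g x A) \<in> borel_measurable (mat_borel N \<Otimes>\<^sub>M \<mu>)"
      by measurable
    then show ?thesis unfolding G_def by (rule borel_measurable_lebesgue_integral)
  qed
  have GG: "G A = Gamma_N N \<beta> (?dg A)" for A
    by (simp add: G_def g_def Gamma_N_eq)
  define T where "T = {z \<in> space (orth_borel N \<Otimes>\<^sub>M mat_borel N).
    (\<forall>k\<in>{..<N}. \<bar>snd z $$ (k, k)\<bar> \<le> M) \<and> \<bar>g (fst z) (snd z) - G (snd z)\<bar> > \<epsilon>}"
  have Tm [measurable]: "T \<in> sets (orth_borel N \<Otimes>\<^sub>M mat_borel N)"
  proof -
    have "(\<lambda>z. \<bar>snd z $$ (k, k)\<bar>) \<in> borel_measurable (orth_borel N \<Otimes>\<^sub>M mat_borel N)" if "k \<in> {..<N}" for k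
      using that by (intro borel_measurable_abs measurable_compose[OF measurable_snd em]) auto
    then have T1: "{z \<in> space (orth_borel N \<Otimes>\<^sub>M mat_borel N). \<forall>k\<in>{..<N}. \<bar>snd z $$ (k, k)\<bar> \<le> M} \<in> sets (orth_borel N \<Otimes>\<^sub>M mat_borel N)"
      by (intro sets.sets_Collect_finite_All borel_measurable_le borel_measurable_const) auto
    have T2: "{z \<in> space (orth_borel N \<Otimes>\<^sub>M mat_borel N). \<bar>g (fst z) (snd z) - G (snd z)\<bar> > \<epsilon>} \<in> sets (orth_borel N \<Otimes>\<^sub>M mat_borel N)"
    proof -
      have [measurable]: "(\<lambda>z. g (fst z) (snd z)) \<in> borel_measurable (orth_borel N \<Otimes>\<^sub>M mat_borel N)"
        using gm by (simp add: case_prod_beta')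
      show ?thesis by measurable
    qed
    have T: "T = {z \<in> space (orth_borel N \<Otimes>\<^sub>M mat_borel N). \<forall>k\<in>{..<N}. \<bar>snd z $$ (k, k)\<bar> \<le> M}
      \<inter> {z \<in> space (orth_borel N \<Otimes>\<^sub>M mat_borel N). \<bar>g (fst z) (snd z) - G (snd z)\<bar> > \<epsilon>}"
      by (auto simp: T_def)
    show ?thesis unfolding T by (rule sets.Int[OF T1 T2])
  qed
  have dgD: "?dg (?D \<omega>) = ?D \<omega>" for \<omega>
    by (rule eq_matI) (auto simp: mat_diag_def)
  have S_eq: "S = (\<lambda>\<omega>. (Q \<omega>, ?D \<omega>)) -` T \<inter> space P"
    using measurable_space[OF Qm] measurable_space[OF Dm]
    by (auto simp: S_def T_def g_def GG dgD space_pair_measure) (auto simp: mat_diag_def)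
  have QDm: "(\<lambda>\<omega>. (Q \<omega>, ?D \<omega>)) \<in> P \<rightarrow>\<^sub>M orth_borel N \<Otimes>\<^sub>M mat_borel N" by measurable
  show "S \<in> sets P"
    unfolding S_eq by (rule measurable_sets[OF QDm Tm])
  define K where "K = 128 * \<beta>\<^sup>2 * M\<^sup>2 / ((real N - 2) * \<epsilon>\<^sup>2)"
  have K: "0 \<le> K" using N by (simp add: K_def)
  have "emeasure P S = emeasure (\<mu> \<Otimes>\<^sub>M ?\<nu>) T"
    unfolding joint S_eq by (rule emeasure_distr[OF QDm Tm, symmetric])
  also have "\<dots> = (\<integral>\<^sup>+A. emeasure \<mu> ((\<lambda>x. (x, A)) -` T) \<partial>?\<nu>)"
    using Tm by (intro PP.emeasure_pair_measure_alt2) measurable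
  also have "\<dots> \<le> (\<integral>\<^sup>+A. ennreal K \<partial>?\<nu>)"
  proof (rule nn_integral_mono)
    fix A
    show "emeasure \<mu> ((\<lambda>x. (x, A)) -` T) \<le> ennreal K"
    proof (cases "A \<in> space (mat_borel N) \<and> (\<forall>k<N. \<bar>A $$ (k, k)\<bar> \<le> M)")
      case True
      then have "(\<lambda>x. (x, A)) -` T = {x \<in> orthogonal_group N.
          \<bar>Phi_N N \<beta> x (?dg A) - Gamma_N N \<beta> (?dg A)\<bar> > \<epsilon>}"
        by (auto simp: T_def g_def GG space_pair_measure)
      then show ?thesis
        using Phi_N_concentration[OF N \<beta> \<epsilon>, of "\<lambda>k. A $$ (k, k)" M] True
        by (simp add: emeasure_eq_measure K_def ennreal_leI)
    next
      case False
      then have "(\<lambda>x. (x, A)) -` T = {}"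
        by (auto simp: T_def space_pair_measure)
      then show ?thesis by simp
    qed
  qed
  also have "\<dots> = ennreal K" using \<nu>.emeasure_space_1 by simp
  finally show "measure P S \<le> 128 * \<beta>\<^sup>2 * M\<^sup>2 / ((real N - 2) * \<epsilon>\<^sup>2)"
    using K by (simp add: P.emeasure_eq_measure K_def)
qed

theorem proposition1p2:
  fixes P :: "nat \<Rightarrow> 'a measure"
    and d :: "nat \<Rightarrow> nat \<Rightarrow> 'a \<Rightarrow> real"
    and Q :: "nat \<Rightarrow> 'a \<Rightarrow> real mat"
    and M :: "nat \<Rightarrow> real"
    and \<beta> :: real
  assumes prob: "\<And>N. 0 < N \<Longrightarrow> prob_space (P N)"
    and finite_expectation: "\<And>N i. i < N \<Longrightarrow> integrable (P N) (d N i)"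
    and orth: "\<And>N. 0 < N \<Longrightarrow> Q N \<in> P N \<rightarrow>\<^sub>M orth_borel N"
    and haar: "\<And>N. 0 < N \<Longrightarrow> is_haar_prob N (distr (P N) (orth_borel N) (Q N))"
    and indep: "\<And>N. 0 < N \<Longrightarrow>
      prob_space.indep_var (P N) (orth_borel N) (Q N) (mat_borel N) (\<lambda>\<omega>. mat_diag N (\<lambda>i. d N i \<omega>))"
    and M_small: "M \<in> o(\<lambda>N. sqrt (real N))"
    and max_bound: "(\<lambda>N. \<P>(\<omega> in P N. (MAX i\<in>{..<N}. \<bar>d N i \<omega>\<bar>) > M N)) \<longlonglongrightarrow> 0"
    and W2_small: "\<And>c::real. 0 < c \<Longrightarrow>
      (\<lambda>N. \<P>(\<omega> in P N. W2 (empirical_measure N (mat_diag N (\<lambda>i. d N i \<omega>)))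
                           (empirical_measure N (mat_diag N (\<lambda>i. \<integral>\<omega>'. d N i \<omega>' \<partial>P N)))
                        > c / sqrt (real N))) \<longlonglongrightarrow> 0"
    and beta: "0 \<le> \<beta>"
  shows "\<forall>\<epsilon>>0. (\<lambda>N. \<P>(\<omega> in P N.
      \<bar>Phi_N N \<beta> (Q N \<omega>) (mat_diag N (\<lambda>i. d N i \<omega>))
        - Gamma_N N \<beta> (mat_diag N (\<lambda>i. \<integral>\<omega>'. d N i \<omega>' \<partial>P N))\<bar> > \<epsilon>)) \<longlonglongrightarrow> 0"
proof (intro allI impI)
  fix \<epsilon> :: real assume \<epsilon>: "0 < \<epsilon>"
  define a where "a N i = (\<integral>\<omega>'. d N i \<omega>' \<partial>P N)" for N i
  \<comment> \<open>Half of \<open>\<epsilon>\<close> is reserved for the change of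
    \<open>Gamma_N\<close>, which has Lipschitz constant \<open>\<beta>\<close>; the 1 admits
    \<open>\<beta> = 0\<close>.\<close>
  define c where "c = \<epsilon> / (2 * (\<beta> + 1))"
  have aD: "a N = (\<lambda>i. \<integral>\<omega>'. d N i \<omega>' \<partial>P N)" for N by (simp add: a_def fun_eq_iff)
  have c: "0 < c" "\<beta> * c \<le> \<epsilon> / 2"
    using \<epsilon> beta by (auto simp: c_def field_simps)
  let ?D = "\<lambda>N \<omega>. mat_diag N (\<lambda>i. d N i \<omega>)"
  define E where "E N = {\<omega> \<in> space (P N). \<bar>Phi_N N \<beta> (Q N \<omega>) (?D N \<omega>) - Gamma_N N \<beta> (mat_diag N (a N))\<bar> > \<epsilon>}" for N
  define A where "A N = {\<omega> \<in> space (P N). (MAX i\<in>{..<N}. \<bar>d N i \<omega>\<bar>) > M N}" for N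
  define B where "B N = {\<omega> \<in> space (P N). W2 (empirical_measure N (?D N \<omega>)) (empirical_measure N (mat_diag N (a N))) > c / sqrt (real N)}" for N
  define S where "S N = {\<omega> \<in> space (P N). (\<forall>k<N. \<bar>d N k \<omega>\<bar> \<le> M N) \<and>
      \<bar>Phi_N N \<beta> (Q N \<omega>) (?D N \<omega>) - Gamma_N N \<beta> (?D N \<omega>)\<bar> > \<epsilon> / 2}" for N
  \<comment> \<open>\<open>1536 = 128 * 4 * 3\<close>: the 4 comes from the deviation
    \<open>\<epsilon> / 2\<close>, the 3 from \<open>1 / (N - 2) \<le> 3 / N\<close> for
    \<open>N \<ge> 3\<close>.\<close>
  define K where "K N = 1536 * \<beta>\<^sup>2 / \<epsilon>\<^sup>2 * (M N / sqrt (real N))\<^sup>2" for N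
  have bound: "measure (P N) (E N) \<le> measure (P N) (A N) + measure (P N) (B N) + K N" if N: "3 \<le> N" for N
  proof -
    have N0: "0 < N" using N by simp
    interpret PN: prob_space "P N" using prob[OF N0] .
    interpret H: haar N "distr (P N) (orth_borel N) (Q N)"
      using haar[OF N0] by unfold_locales
    have dm [measurable]: "d N i \<in> borel_measurable (P N)" if "i < N" for i
      using finite_expectation[OF that] by (rule borel_measurable_integrable)
    have SP: "S N \<in> sets (P N)" "measure (P N) (S N) \<le> 128 * \<beta>\<^sup>2 * (M N)\<^sup>2 / ((real N - 2) * (\<epsilon> / 2)\<^sup>2)"
      unfolding S_def using \<epsilon>
      by (intro Phi_N_deviation_independent[OF prob[OF N0] N beta _ haar[OF N0] indep[OF N0]]; simp)+
    have Am: "A N \<in> sets (P N)"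
    proof -
      have "(\<lambda>\<omega>. MAX i\<in>{..<N}. \<bar>d N i \<omega>\<bar>) \<in> borel_measurable (P N)"
        by (intro borel_measurable_Max borel_measurable_abs dm) auto
      then show ?thesis unfolding A_def by measurable
    qed
    have Bm: "B N \<in> sets (P N)"
    proof -
      have "(\<lambda>\<omega>. MIN p\<in>{p. p permutes {..<N}}. (\<Sum>i<N. (d N i \<omega> - a N (p i))\<^sup>2) / real N) \<in> borel_measurable (P N)"
        by (intro borel_measurable_Min finite_permutations borel_measurable_divide borel_measurable_sum
            borel_measurable_power borel_measurable_diff dm borel_measurable_const) auto
      then show ?thesis unfolding B_def W2_empirical_measure[OF N0] by measurable
    qed
    have sub: "E N \<subseteq> (A N \<union> B N) \<union> S N"
    proof
      fix \<omega> assume \<omega>: "\<omega> \<in> E N"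
      show "\<omega> \<in> (A N \<union> B N) \<union> S N"
      proof (rule ccontr)
        assume not: "\<omega> \<notin> (A N \<union> B N) \<union> S N"
        have sp: "\<omega> \<in> space (P N)" using \<omega> by (simp add: E_def)
        have max: "(MAX i\<in>{..<N}. \<bar>d N i \<omega>\<bar>) \<le> M N" using not sp by (auto simp: A_def)
        have "\<bar>d N k \<omega>\<bar> \<le> M N" if "k < N" for k
        proof -
          have "\<bar>d N k \<omega>\<bar> \<le> (MAX i\<in>{..<N}. \<bar>d N i \<omega>\<bar>)" using that by (intro Max_ge) auto
          then show ?thesis using max by linarith
        qed
        then have 1: "\<bar>Phi_N N \<beta> (Q N \<omega>) (?D N \<omega>) - Gamma_N N \<beta> (?D N \<omega>)\<bar> \<le> \<epsilon> / 2"
          using not sp by (auto simp: S_def)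
        have "W2 (empirical_measure N (?D N \<omega>)) (empirical_measure N (mat_diag N (a N))) \<le> c / sqrt (real N)"
          using not sp by (auto simp: B_def)
        then obtain p where p: "p permutes {..<N}" "\<And>i. i < N \<Longrightarrow> \<bar>d N i \<omega> - a N (p i)\<bar> \<le> c"
          using W2_empirical_matching[OF N0, of "\<lambda>i. d N i \<omega>" "a N" c] c(1) by auto
        have "\<bar>Gamma_N N \<beta> (?D N \<omega>) - Gamma_N N \<beta> (mat_diag N (\<lambda>i. a N (p i)))\<bar> \<le> \<beta> * c"
          by (rule H.Gamma_N_lipschitz[OF N0 beta p(2)])
        then have "\<bar>Gamma_N N \<beta> (?D N \<omega>) - Gamma_N N \<beta> (mat_diag N (a N))\<bar> \<le> \<epsilon> / 2"
          using H.Gamma_N_permute[OF p(1), of \<beta> "a N"] c(2) by simp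
        with 1 have "\<bar>Phi_N N \<beta> (Q N \<omega>) (?D N \<omega>) - Gamma_N N \<beta> (mat_diag N (a N))\<bar> \<le> \<epsilon>"
          by linarith
        then show False using \<omega> by (simp add: E_def)
      qed
    qed
    have "measure (P N) (E N) \<le> measure (P N) ((A N \<union> B N) \<union> S N)"
      using sub Am Bm SP(1) by (intro PN.finite_measure_mono) auto
    also have "\<dots> \<le> measure (P N) (A N \<union> B N) + measure (P N) (S N)"
      using Am Bm SP(1) by (intro measure_Un_le) auto
    also have "measure (P N) (A N \<union> B N) \<le> measure (P N) (A N) + measure (P N) (B N)"
      using Am Bm by (intro measure_Un_le) auto
    also have "measure (P N) (S N) \<le> K N"
    proof -
      have "1 / (real N - 2) \<le> 3 / real N" using N by (simp add: field_simps)
      then have "512 * \<beta>\<^sup>2 * (M N)\<^sup>2 / \<epsilon>\<^sup>2 * (1 / (real N - 2)) \<le> 512 * \<beta>\<^sup>2 * (M N)\<^sup>2 / \<epsilon>\<^sup>2 * (3 / real N)"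
        by (intro mult_left_mono) auto
      also have "\<dots> = K N" by (simp add: K_def power_divide)
      finally show ?thesis using SP(2) by (simp add: power_divide field_simps)
    qed
    finally show ?thesis by simp
  qed
  have "(\<lambda>N. M N / sqrt (real N)) \<longlonglongrightarrow> 0"
    using smalloD_tendsto[OF M_small] .
  then have K0: "K \<longlonglongrightarrow> 1536 * \<beta>\<^sup>2 / \<epsilon>\<^sup>2 * 0\<^sup>2"
    unfolding K_def by (intro tendsto_intros)
  have A0: "(\<lambda>N. measure (P N) (A N)) \<longlonglongrightarrow> 0"
    using max_bound by (simp add: A_def)
  have B0: "(\<lambda>N. measure (P N) (B N)) \<longlonglongrightarrow> 0"
    using W2_small[OF c(1)] by (simp add: B_def aD)
  have upper: "(\<lambda>N. measure (P N) (A N) + measure (P N) (B N) + K N) \<longlonglongrightarrow> 0"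
    using tendsto_add[OF tendsto_add[OF A0 B0] K0] by simp
  have "(\<lambda>N. measure (P N) (E N)) \<longlonglongrightarrow> 0"
  proof (rule tendsto_sandwich[OF _ _ tendsto_const upper])
    show "\<forall>\<^sub>F N in sequentially. 0 \<le> measure (P N) (E N)" by simp
    show "\<forall>\<^sub>F N in sequentially. measure (P N) (E N) \<le> measure (P N) (A N) + measure (P N) (B N) + K N"
      using eventually_ge_at_top[of 3] by eventually_elim (rule bound)
  qed
  then show "(\<lambda>N. \<P>(\<omega> in P N.
      \<bar>Phi_N N \<beta> (Q N \<omega>) (mat_diag N (\<lambda>i. d N i \<omega>))
        - Gamma_N N \<beta> (mat_diag N (\<lambda>i. \<integral>\<omega>'. d N i \<omega>' \<partial>P N))\<bar> > \<epsilon>)) \<longlonglongrightarrow> 0"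
    by (simp add: E_def aD)
qed

end
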